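(* Let $P \subset N_{\mathbb{Q}}$ be a Fano polygon and let $Q_P$ be its associated quiver. Then $P$ is of finite mutation type if and only if $Q_P$ is mutation equivalent to a quiver of type $(A_1)^n$ for some $n \in \mathbb{Z}_{\geq 0}$, or of type $A_2$, $A_3$, or $D_4$.
   Context: Let $N \cong \mathbb{Z}^2$ be a lattice, $M = \operatorname{Hom}(N,\mathbb{Z})$ its dual, $N_{\mathbb{Q}} = N \otimes \mathbb{Q}$, $M_{\mathbb{Q}} = M \otimes \mathbb{Q}$. A Fano polygon is a convex lattice polygon $P \subset N_{\mathbb{Q}}$ (vertices in $N$) containing the origin in its interior and such that every vertex is a primitive lattice vector. Its dual is $P^\circ = \{ m \in M_{\mathbb{Q}} : \langle m, v\rangle \geq -1 \text{ for all } v \in P\}$. Mutation of polygons. Given $w \in M$ (the weight vector) and $f \in N$ with $\langle w, f\rangle = 0$ (the factor), define the piecewise linear map $T_{w,f}\colon M_{\mathbb{Q}} \to M_{\mathbb{Q}}$, $m \mapsto m + \max(0,\langle m, f\rangle) w$. If $T_{w,f}(P^\circ)$ is convex, $P$ is said to admit the mutation $(w,f)$, and it mutates to $(T_{w,f}(P^\circ))^\circ$, which is known to be again a Fano polygon. Two Fano polygons are mutation equivalent if they are related by a finite sequence of mutations and $\operatorname{GL}(N) \cong \operatorname{GL}(2,\mathbb{Z})$-equivalences. A Fano polygon is of finite mutation type if it is mutation equivalent to only finitely many Fano polygons, where polygons are counted up to $\operatorname{GL}(2,\mathbb{Z})$-equivalence. The quiver $Q_P$. For an edge $E$ of $P$ let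 $w_E \in M$ be its primitive inward-pointing normal, $h_E \geq 1$ its integral height (lattice distance from the origin), and $\ell_E$ its lattice length. Let $m_E = \lfloor \ell_E/h_E \rfloor$. The quiver $Q_P$ has exactly $m_E$ vertices for each edge $E$ of $P$ (so $\sum_E m_E$ vertices in total). Fix an identification $\bigwedge^2 M \cong \mathbb{Z}$. For vertices $v_i, v_j$ of $Q_P$ associated with edges $E_i,E_j$, put $b_{ij} = w_{E_i} \wedge w_{E_j} \in \mathbb{Z}$; there are $|b_{ij}|$ arrows between $v_i$ and $v_j$, directed from $v_i$ to $v_j$ if $b_{ij} > 0$ and from $v_j$ to $v_i$ if $b_{ij}<0$. Quivers. The mutation of a quiver $Q$ (without loops or 2-cycles) at a vertex $v$ is obtained by: (i) adding, for each subquiver $v_1 \to v \to v_2$, an arrow from $v_1$ to $v_2$; (ii) deleting a maximal set of disjoint two-cycles; (iii) reversing all arrows incident to $v$. Two quivers are mutation equivalent if they are related, up to isomorphism, by a finite sequence of mutations. For a simply-laced Dynkin diagram $D$, a quiver is of type $D$ if it is an orientation of the underlying graph of $D$ (same vertices, precisely one arrow for each edge). Type $(A_1)^n$ means $n$ vertices and no arrows. *)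

theory Defs
  imports "HOL-Analysis.Analysis"
begin

section \<open>Fano polygons\<close>

text \<open>
  A basis of \<open>N\<close> and the dual basis of \<open>M\<close> are fixed, so that \<open>N\<close> and \<open>M\<close> are both
  \<^typ>\<open>int ^ 2\<close> and the pairing \<open>M \<times> N \<rightarrow> \<int>\<close> is the dot product.  The ambient planes are
  \<open>N \<otimes> \<real>\<close> and \<open>M \<otimes> \<real>\<close>, both \<^typ>\<open>real ^ 2\<close>: a rational polygon is represented by the
  convex hull of its vertices over the reals, so that the convexity notions of the library apply.
\<close>

definition lat :: "int ^ 2 \<Rightarrow> real ^ 2" where
  "lat v = (\<chi> i. of_int (v $ i))"

definition primitive :: "int ^ 2 \<Rightarrow> bool" where
  "primitive v \<longleftrightarrow> coprime (v $ 1) (v $ 2)"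

definition fano_polygon :: "(real ^ 2) set \<Rightarrow> bool" where
  "fano_polygon P \<longleftrightarrow>
     polytope P \<and> 0 \<in> interior P \<and>
     (\<forall>x. x extreme_point_of P \<longrightarrow> (\<exists>v. primitive v \<and> x = lat v))"

definition polar_dual :: "(real ^ 2) set \<Rightarrow> (real ^ 2) set" where
  "polar_dual P = {m. \<forall>v\<in>P. m \<bullet> v \<ge> -1}"

definition GL_equivalent :: "(real ^ 2) set \<Rightarrow> (real ^ 2) set \<Rightarrow> bool" where
  "GL_equivalent P P' \<longleftrightarrow>
     (\<exists>A :: int ^ 2 ^ 2. invertible A \<and> P' = (\<lambda>x. (\<chi> i j. of_int (A $ i $ j)) *v x) ` P)"


section \<open>Mutation of polygons\<close>

definition mut_map :: "int ^ 2 \<Rightarrow> int ^ 2 \<Rightarrow> real ^ 2 \<Rightarrow> real ^ 2" where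
  "mut_map w f m = m + max 0 (m \<bullet> lat f) *\<^sub>R lat w"

definition admits_mutation :: "(real ^ 2) set \<Rightarrow> int ^ 2 \<Rightarrow> int ^ 2 \<Rightarrow> bool" where
  "admits_mutation P w f \<longleftrightarrow> lat w \<bullet> lat f = 0 \<and> convex (mut_map w f ` polar_dual P)"

definition polygon_mutation :: "int ^ 2 \<Rightarrow> int ^ 2 \<Rightarrow> (real ^ 2) set \<Rightarrow> (real ^ 2) set" where
  "polygon_mutation w f P = polar_dual (mut_map w f ` polar_dual P)"

definition polygon_step :: "(real ^ 2) set \<Rightarrow> (real ^ 2) set \<Rightarrow> bool" where
  "polygon_step P P' \<longleftrightarrow>
     (\<exists>w f. admits_mutation P w f \<and> P' = polygon_mutation w f P) \<or> GL_equivalent P P'"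

text \<open>
  On Fano polygons \<^const>\<open>polygon_step\<close> is symmetric (the mutation \<open>(w, f)\<close> is undone by
  \<open>(-w, f)\<close>), so its reflexive transitive closure is an equivalence relation there.
\<close>

definition polygon_mutation_equivalent :: "(real ^ 2) set \<Rightarrow> (real ^ 2) set \<Rightarrow> bool" where
  "polygon_mutation_equivalent = polygon_step\<^sup>*\<^sup>*"

definition finite_mutation_type :: "(real ^ 2) set \<Rightarrow> bool" where
  "finite_mutation_type P \<longleftrightarrow>
     finite ({P'. fano_polygon P' \<and> polygon_mutation_equivalent P P'}
             // {(P', P''). GL_equivalent P' P''})"


section \<open>Quivers\<close>

text \<open>A quiver is recorded by its vertices and the number of arrows from \<open>i\<close> to \<open>j\<close>.\<close>

record 'v quiver =
  qverts :: "'v set"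
  arrows :: "'v \<Rightarrow> 'v \<Rightarrow> nat"

text \<open>
  The three steps of the mutation of a quiver without loops or 2-cycles at \<open>v\<close>.  If there are
  \<open>a\<close> arrows from \<open>i\<close> to \<open>j\<close> and \<open>b\<close> arrows back, a maximal set of disjoint 2-cycles
  between \<open>i\<close> and \<open>j\<close> has \<open>min a b\<close> elements; removing it leaves \<open>a - b\<close> arrows from
  \<open>i\<close> to \<open>j\<close>, the subtraction being truncated.
\<close>

definition add_composites :: "'v \<Rightarrow> ('v \<Rightarrow> 'v \<Rightarrow> nat) \<Rightarrow> 'v \<Rightarrow> 'v \<Rightarrow> nat" where
  "add_composites v a i j = a i j + a i v * a v j"

definition delete_two_cycles :: "('v \<Rightarrow> 'v \<Rightarrow> nat) \<Rightarrow> 'v \<Rightarrow> 'v \<Rightarrow> nat" where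
  "delete_two_cycles a i j = a i j - a j i"

definition reverse_at :: "'v \<Rightarrow> ('v \<Rightarrow> 'v \<Rightarrow> nat) \<Rightarrow> 'v \<Rightarrow> 'v \<Rightarrow> nat" where
  "reverse_at v a i j = (if i = v \<or> j = v then a j i else a i j)"

definition quiver_mutation :: "'v \<Rightarrow> 'v quiver \<Rightarrow> 'v quiver" where
  "quiver_mutation v Q =
     \<lparr>qverts = qverts Q,
      arrows = reverse_at v (delete_two_cycles (add_composites v (arrows Q)))\<rparr>"

definition quiver_step :: "'v quiver \<Rightarrow> 'v quiver \<Rightarrow> bool" where
  "quiver_step Q Q' \<longleftrightarrow> (\<exists>v\<in>qverts Q. Q' = quiver_mutation v Q)"

definition quiver_isomorphic :: "'v quiver \<Rightarrow> 'u quiver \<Rightarrow> bool" where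
  "quiver_isomorphic Q Q' \<longleftrightarrow>
     (\<exists>\<phi>. bij_betw \<phi> (qverts Q) (qverts Q') \<and>
          (\<forall>i\<in>qverts Q. \<forall>j\<in>qverts Q. arrows Q' (\<phi> i) (\<phi> j) = arrows Q i j))"

text \<open>
  Isomorphisms commute with mutations, so it suffices to allow one at the end of the sequence.
\<close>

definition quiver_mutation_equivalent :: "'v quiver \<Rightarrow> 'u quiver \<Rightarrow> bool" where
  "quiver_mutation_equivalent Q Q' \<longleftrightarrow>
     (\<exists>Q''. quiver_step\<^sup>*\<^sup>* Q Q'' \<and> quiver_isomorphic Q'' Q')"


section \<open>Dynkin diagrams and the type of a quiver\<close>

text \<open>A simply-laced diagram is the pair of its vertex set and its set of (two-element) edges.\<close>

type_synonym diagram = "nat set \<times> nat set set"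

definition dynkin_A1_power :: "nat \<Rightarrow> diagram" where
  "dynkin_A1_power n = ({..<n}, {})"

definition dynkin_A :: "nat \<Rightarrow> diagram" where
  "dynkin_A n = ({..<n}, {{i, Suc i} | i. Suc i < n})"

text \<open>For \<open>n \<ge> 4\<close>: the path on \<open>0, \<dots>, n - 2\<close> with \<open>n - 1\<close> attached to \<open>n - 3\<close>.\<close>

definition dynkin_D :: "nat \<Rightarrow> diagram" where
  "dynkin_D n = ({..<n}, insert {n - 3, n - 1} {{i, Suc i} | i. Suc i < n - 1})"

definition quiver_of_type :: "nat quiver \<Rightarrow> diagram \<Rightarrow> bool" where
  "quiver_of_type Q D \<longleftrightarrow>
     qverts Q = fst D \<and>
     (\<forall>i j. arrows Q i j + arrows Q j i = (if {i, j} \<in> snd D then 1 else 0))"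


section \<open>The quiver of a Fano polygon\<close>

definition inner_normal :: "(real ^ 2) set \<Rightarrow> (real ^ 2) set \<Rightarrow> int ^ 2" where
  "inner_normal P E =
     (THE w. primitive w \<and>
        (\<exists>c. (\<forall>x\<in>E. lat w \<bullet> x = c) \<and> (\<forall>x\<in>P. lat w \<bullet> x \<ge> c)))"

definition edge_height :: "(real ^ 2) set \<Rightarrow> (real ^ 2) set \<Rightarrow> nat" where
  "edge_height P E = (THE h. \<forall>x\<in>E. lat (inner_normal P E) \<bullet> x = - real h)"

definition lattice_length :: "(real ^ 2) set \<Rightarrow> nat" where
  "lattice_length E = card (E \<inter> range lat) - 1"

definition edge_mult :: "(real ^ 2) set \<Rightarrow> (real ^ 2) set \<Rightarrow> nat" where
  "edge_mult P E = nat \<lfloor>real (lattice_length E) / real (edge_height P E)\<rfloor>"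

definition wedge :: "int ^ 2 \<Rightarrow> int ^ 2 \<Rightarrow> int" where
  "wedge w w' = w $ 1 * w' $ 2 - w $ 2 * w' $ 1"

text \<open>
  The vertices attached to an edge \<open>E\<close> are \<open>(E, k)\<close> for \<open>k < edge_mult P E\<close>.  Since
  \<^const>\<open>nat\<close> sends negative integers to \<open>0\<close>, a negative wedge product contributes
  arrows only in the opposite direction.
\<close>

definition fano_quiver :: "(real ^ 2) set \<Rightarrow> ((real ^ 2) set \<times> nat) quiver" where
  "fano_quiver P =
     (let V = {(E, k). E edge_of P \<and> k < edge_mult P E} in
       \<lparr>qverts = V,
        arrows = (\<lambda>i j. if i \<in> V \<and> j \<in> V
                        then nat (wedge (inner_normal P (fst i)) (inner_normal P (fst j)))
                        else 0)\<rparr>)"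

end

theory Submission
  imports Defs "HOL-Library.Multiset"
begin

text \<open>
  A Fano polygon \<open>P\<close> is replaced by its support function \<open>\<phi> m = max {- (m \<bullet> v) | v \<in> P}\<close>, the gauge of
  \<open>P\<degree>\<close>; a mutation precomposes \<open>\<phi>\<close> with a piecewise linear map.  The edge with inner normal \<open>w\<close>
  has height \<open>\<phi> w\<close>, and a mutation in \<open>w\<close> moves some of its \<open>m\<^sub>E\<close> nodes to \<open>- w\<close> while shearing the
  normals on one side, which on quivers is the usual mutation rule.

  If two normals \<open>u, v\<close> carry \<open>a\<close> and \<open>b\<close> nodes and \<open>(u \<and> v)\<^sup>2 a b \<ge> 4\<close>, alternately mutating all
  nodes at \<open>u\<close> and at \<open>v\<close> drives a point near the origin to infinity by a linear recursion of parabolic or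
  hyperbolic type, so heights are unbounded and the type is infinite.  Conversely, in a family of normals
  with \<open>(u \<and> v)\<^sup>2 a b \<le> 3\<close> throughout its mutation class, choose a member in which some normal \<open>u\<close>
  occurs as often as possible: a few single mutations show that all other normals coincide, which leaves
  only parallel normals or a star with at most three leaves.

  For parallel normals the reachable polygons are the images of powers of one piecewise linear map.  For a
  star with three leaves, finiteness is the periodicity of the piecewise linear maps of type \<open>G\<^sub>2\<close>
  (foldings of \<open>D\<^sub>4\<close>), together with three intermediate seeds.  Smaller stars are sub-families of this one.
\<close>

section \<open>Plane geometry and mutation of support functions\<close>

text \<open>The definition of mutation lives on the dual polygon, the multiplicities on the polygon
  itself. Support functions serve both: the image of a sublevel set under a piecewise linear map is
  the sublevel set of a composite, so a chain of mutations is a composite of explicit maps and no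
  list of vertices has to be followed. What remains is to express convexity of the image by the
  length of one face; a supporting line does this.

  The quiver records wedge products only and says nothing about heights. Infinite type is therefore
  proved on the polygon, with a quantity that finitely many polygons would bound: the height of an
  edge that carries a node. Finite type is proved without any estimate, by a finite list of
  functions that is closed under mutation up to a change of basis.

  The extremal choice takes the place of a classification of quivers: in the plane three normals
  satisfy a linear relation, so few arrows already determine the vectors, and a largest number of
  occurrences exists since it is at most the number of nodes.\<close>

definition cross :: "real ^ 2 \<Rightarrow> real ^ 2 \<Rightarrow> real" where
  "cross a b = a $ 1 * b $ 2 - a $ 2 * b $ 1"

definition rot :: "real ^ 2 \<Rightarrow> real ^ 2" where
  "rot a = vector [- (a $ 2), a $ 1]"

text \<open>\<open>tau w k\<close> is inverse to the mutation of weight \<open>k w\<close> and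
  factor \<open>rot w\<close>: pushing a sublevel set forward means composing its function with the
  inverse. The exponent is real so that negative powers are available.\<close>

definition tau :: "real ^ 2 \<Rightarrow> real \<Rightarrow> real ^ 2 \<Rightarrow> real ^ 2" where
  "tau w k m = m - (k * max 0 (cross w m)) *\<^sub>R w"

definition body :: "(real ^ 2 \<Rightarrow> real) \<Rightarrow> (real ^ 2) set" where
  "body \<phi> = {y. \<forall>m. - (m \<bullet> y) \<le> \<phi> m}"

text \<open>These are the support functions of Fano polygons: positivity puts the origin in the
  interior, and the vertices are among the primitive points of \<open>V\<close>. Further points of
  the polygon may belong to \<open>V\<close>, which spares the extraction of vertices after a
  mutation.\<close>

definition fan :: "(real ^ 2 \<Rightarrow> real) \<Rightarrow> bool" where
  "fan \<phi> \<longleftrightarrow> (\<forall>m. m \<noteq> 0 \<longrightarrow> \<phi> m > 0) \<and>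
     (\<exists>V. finite V \<and> (\<forall>v\<in>V. primitive v \<and> lat v \<in> body \<phi>) \<and>
          (\<forall>m. \<exists>v\<in>V. \<phi> m = - (m \<bullet> lat v)))"

text \<open>The face with inner normal \<open>w\<close> has lattice length at least \<open>k\<close> times its height \<open>\<phi> w\<close>
  (\<open>rot w\<close> is primitive along that face if \<open>w\<close> is primitive).\<close>

definition mult_ge :: "(real ^ 2 \<Rightarrow> real) \<Rightarrow> real ^ 2 \<Rightarrow> real \<Rightarrow> bool" where
  "mult_ge \<phi> w k \<longleftrightarrow> (\<exists>y\<in>body \<phi>. w \<bullet> y = - \<phi> w \<and> y + (k * \<phi> w) *\<^sub>R rot w \<in> body \<phi>)"

lemma rot_nth [simp]: "rot a $ 1 = - (a $ 2)" "rot a $ 2 = a $ 1"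
  by (simp_all add: rot_def)

lemma lat_nth [simp]: "lat v $ i = of_int (v $ i)"
  by (simp add: lat_def)

lemma vec2_eq: "(x :: 'a ^ 2) = y \<longleftrightarrow> x $ 1 = y $ 1 \<and> x $ 2 = y $ 2"
  by (simp add: vec_eq_iff forall_2)

lemma inner2: "(x :: real ^ 2) \<bullet> y = x $ 1 * y $ 1 + x $ 2 * y $ 2"
  by (simp add: inner_vec_def sum_2)

lemma inner_rot: "m \<bullet> rot w = cross w m"
  by (simp add: inner2 cross_def)

lemma inner_rot_self [simp]: "w \<bullet> rot w = 0"
  by (simp add: inner2)

lemma cross_simps [simp]:
  "cross w 0 = 0" "cross 0 w = 0" "cross w w = 0" "cross w (- m) = - cross w m" "cross (- w) m = - cross w m"
  "cross w (c *\<^sub>R m) = c * cross w m" "cross (c *\<^sub>R w) m = c * cross w m"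
  "cross w (a + b) = cross w a + cross w b" "cross w (a - b) = cross w a - cross w b"
  "cross (a + b) w = cross a w + cross b w" "cross (a - b) w = cross a w - cross b w"
  by (simp_all add: cross_def algebra_simps)

lemma cross_swap: "cross a b = - cross b a"
  by (simp add: cross_def)

lemma rot_simps [simp]: "rot (- a) = - rot a" "rot (c *\<^sub>R a) = c *\<^sub>R rot a" "rot (a + b) = rot a + rot b"
  by (simp_all add: vec2_eq)

lemma orthogonal_rot:
  fixes w y :: "real ^ 2"
  assumes "w \<noteq> 0" "w \<bullet> y = 0"
  obtains r where "y = r *\<^sub>R rot w"
proof -
  have n: "(w $ 1)^2 + (w $ 2)^2 \<noteq> 0" using assms(1) by (simp add: vec2_eq)
  have e: "w $ 1 * y $ 1 + w $ 2 * y $ 2 = 0" using assms(2) by (simp add: inner2)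
  let ?r = "(w $ 1 * y $ 2 - w $ 2 * y $ 1) / ((w $ 1)^2 + (w $ 2)^2)"
  have "y = ?r *\<^sub>R rot w"
    using n e unfolding vec2_eq
    apply (simp add: field_simps power2_eq_square)
    by algebra
  then show ?thesis by (rule that)
qed

lemma cross_0_parallel:
  assumes "w \<noteq> 0" "cross w y = 0"
  obtains r where "y = r *\<^sub>R w"
proof -
  have n: "(w $ 1)^2 + (w $ 2)^2 \<noteq> 0" using assms(1) by (simp add: vec2_eq)
  have e: "w $ 1 * y $ 2 - w $ 2 * y $ 1 = 0" using assms(2) by (simp add: cross_def)
  let ?r = "(w $ 1 * y $ 1 + w $ 2 * y $ 2) / ((w $ 1)^2 + (w $ 2)^2)"
  have "y = ?r *\<^sub>R w"
    using n e unfolding vec2_eq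
    by (simp add: field_simps power2_eq_square)
  then show ?thesis by (rule that)
qed

lemma tau_id: "cross w m \<le> 0 \<Longrightarrow> tau w k m = m"
  by (simp add: tau_def)

lemma tau_shear: "cross w m \<ge> 0 \<Longrightarrow> tau w k m = m - (k * cross w m) *\<^sub>R w"
  by (simp add: tau_def)

lemma cross_tau [simp]: "cross w (tau w k m) = cross w m"
  by (simp add: tau_def)

lemma tau_tau: "tau w j (tau w k m) = tau w (j + k) m"
  by (simp add: tau_def cross_def algebra_simps)

lemma tau_0 [simp]: "tau w 0 = id"
  by (simp add: tau_def fun_eq_iff)

lemma tau_scale: "c \<ge> 0 \<Longrightarrow> tau w k (c *\<^sub>R m) = c *\<^sub>R tau w k m"
proof -
  assume c: "c \<ge> 0"
  then have "max 0 (c * x) = c * max 0 x" for x :: real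
    by (simp add: max_mult_distrib_left)
  then show ?thesis by (simp add: tau_def scaleR_diff_right mult.assoc mult.left_commute)
qed

section \<open>Slices of a polygon and their change under mutation\<close>

lemma body_iff: "y \<in> body \<phi> \<longleftrightarrow> (\<forall>m. - (m \<bullet> y) \<le> \<phi> m)"
  by (simp add: body_def)

lemma bodyD: "y \<in> body \<phi> \<Longrightarrow> - (m \<bullet> y) \<le> \<phi> m"
  by (simp add: body_def)

lemma convex_body: "convex (body \<phi>)"
proof (rule convexI)
  fix x y and u v :: real
  assume xy: "x \<in> body \<phi>" "y \<in> body \<phi>" and uv: "0 \<le> u" "0 \<le> v" "u + v = 1"
  show "u *\<^sub>R x + v *\<^sub>R y \<in> body \<phi>"
    unfolding body_iff
  proof
    fix m
    have "- (m \<bullet> (u *\<^sub>R x + v *\<^sub>R y)) = u * (- (m \<bullet> x)) + v * (- (m \<bullet> y))"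
      by (simp add: inner_add_right)
    also have "\<dots> \<le> u * \<phi> m + v * \<phi> m"
      using xy uv by (intro add_mono mult_left_mono bodyD) auto
    also have "\<dots> = \<phi> m" using uv by (metis distrib_right mult_1)
    finally show "- (m \<bullet> (u *\<^sub>R x + v *\<^sub>R y)) \<le> \<phi> m" .
  qed
qed

lemma between_in_body:
  assumes "y + a *\<^sub>R d \<in> body \<phi>" "y + c *\<^sub>R d \<in> body \<phi>" "a \<le> b" "b \<le> c"
  shows "y + b *\<^sub>R d \<in> body \<phi>"
proof (cases "a = c")
  case True
  then show ?thesis using assms by (metis order_antisym)
next
  case False
  then have ac: "a < c" using assms by linarith
  let ?u = "(c - b) / (c - a)" and ?v = "(b - a) / (c - a)"
  have "?u + ?v = 1" using ac by (simp add: add_divide_distrib [symmetric])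
  moreover have e: "?u * a + ?v * c = b"
  proof -
    have "?u * a + ?v * c = ((c - b) * a + (b - a) * c) / (c - a)" by (simp add: add_divide_distrib)
    also have "(c - b) * a + (b - a) * c = b * (c - a)" by (simp add: algebra_simps)
    finally show ?thesis using ac by simp
  qed
  ultimately have "?u *\<^sub>R (y + a *\<^sub>R d) + ?v *\<^sub>R (y + c *\<^sub>R d) \<in> body \<phi>"
    using ac assms convexD[OF convex_body] by simp
  moreover have "?u *\<^sub>R (y + a *\<^sub>R d) + ?v *\<^sub>R (y + c *\<^sub>R d) = (?u + ?v) *\<^sub>R y + (?u * a + ?v * c) *\<^sub>R d"
    by (simp only: scaleR_add_right scaleR_add_left scaleR_scaleR ac_simps)
  ultimately show ?thesis using \<open>?u + ?v = 1\<close> e by simp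
qed

text \<open>The slice of the new polygon at height \<open>s = w \<bullet> y\<close> is the old slice, lengthened by \<open>k * s\<close> if
  \<open>s \<ge> 0\<close> and shortened by \<open>k * \<bar>s\<bar>\<close> if \<open>s < 0\<close>.\<close>

lemma body_tau_iff:
  "y \<in> body (\<phi> \<circ> tau w k) \<longleftrightarrow>
     (\<forall>n. cross w n \<le> 0 \<longrightarrow> - (n \<bullet> y) \<le> \<phi> n) \<and>
     (\<forall>n. cross w n \<ge> 0 \<longrightarrow> - (n \<bullet> (y + (k * (w \<bullet> y)) *\<^sub>R rot w)) \<le> \<phi> n)"
  (is "?L \<longleftrightarrow> ?R1 \<and> ?R2")
proof safe
  fix n assume y: ?L
  { assume "cross w n \<le> 0"
    with bodyD[OF y, of n] show "- (n \<bullet> y) \<le> \<phi> n" by (simp add: tau_id) }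
  { assume n: "cross w n \<ge> 0"
    let ?m = "n + (k * cross w n) *\<^sub>R w"
    have "tau w k ?m = n" using n by (simp add: tau_shear)
    with bodyD[OF y, of ?m] show "- (n \<bullet> (y + (k * (w \<bullet> y)) *\<^sub>R rot w)) \<le> \<phi> n"
      by (simp add: inner_add_left inner_add_right inner_rot algebra_simps) }
next
  assume R: ?R1 ?R2
  show ?L unfolding body_iff
  proof
    fix m
    show "- (m \<bullet> y) \<le> (\<phi> \<circ> tau w k) m"
    proof (cases "cross w m \<le> 0")
      case True
      then show ?thesis using R(1) by (simp add: tau_id)
    next
      case False
      then have "cross w (tau w k m) \<ge> 0" by simp
      from R(2)[rule_format, OF this] False show ?thesis
        by (simp add: tau_shear inner_add_right inner_diff_left inner_rot algebra_simps)
    qed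
  qed
qed

text \<open>Where \<open>w \<bullet> y \<ge> 0\<close> slices only grow: the new slice is spanned by
  the old one and its translate against \<open>rot w\<close>, so both copies of \<open>y\<close>
  belong to it.\<close>

lemma body_tau_up:
  assumes "y \<in> body \<phi>" "w \<bullet> y \<ge> 0" "k \<ge> 0"
  shows "y \<in> body (\<phi> \<circ> tau w k)" "y - (k * (w \<bullet> y)) *\<^sub>R rot w \<in> body (\<phi> \<circ> tau w k)"
proof -
  have *: "cross w n \<ge> 0 \<Longrightarrow> - (n \<bullet> y) - k * (w \<bullet> y) * cross w n \<le> \<phi> n" for n
    using bodyD[OF assms(1), of n] assms by (smt (verit) mult_nonneg_nonneg)
  have **: "cross w n \<le> 0 \<Longrightarrow> - (n \<bullet> y) + k * (w \<bullet> y) * cross w n \<le> \<phi> n" for n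
    using bodyD[OF assms(1), of n] assms by (smt (verit) mult_nonneg_nonneg mult_nonneg_nonpos)
  show "y \<in> body (\<phi> \<circ> tau w k)" "y - (k * (w \<bullet> y)) *\<^sub>R rot w \<in> body (\<phi> \<circ> tau w k)"
    unfolding body_tau_iff using assms(1) * ** bodyD[OF assms(1)]
    by (auto simp: inner_add_right inner_diff_right inner_rot)
qed

lemma body_tau_both:
  assumes "y \<in> body \<phi>" "y + (k * (w \<bullet> y)) *\<^sub>R rot w \<in> body \<phi>"
  shows "y \<in> body (\<phi> \<circ> tau w k)"
  unfolding body_tau_iff using assms bodyD by blast

text \<open>A point of the polygon which is extreme in its slice survives the shortening of that slice.\<close>

locale mutation_data =
  fixes \<phi> :: "real ^ 2 \<Rightarrow> real" and w :: "real ^ 2" and k :: real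
  assumes zero: "0 \<in> body \<phi>" and w: "w \<noteq> 0" and pos: "\<phi> w > 0" and k: "k \<ge> 0" and m: "mult_ge \<phi> w k"
begin

text \<open>The hypothesis on the face at height \<open>- \<phi> w\<close> reaches every slice with
  \<open>w \<bullet> y < 0\<close>: shrinking that face towards \<open>0\<close> gives, by
  convexity, a segment of length \<open>k * \<bar>w \<bullet> y\<bar>\<close> in units of
  \<open>rot w\<close> in the slice of \<open>y\<close>. The number \<open>r\<close> is the position
  of \<open>y\<close> relative to its starting point.\<close>

lemma slice:
  assumes "y \<in> body \<phi>" "w \<bullet> y < 0"
  obtains r where "y - r *\<^sub>R rot w \<in> body \<phi>" "y + (- r - k * (w \<bullet> y)) *\<^sub>R rot w \<in> body \<phi>"
proof -
  obtain b where b: "b \<in> body \<phi>" "w \<bullet> b = - \<phi> w" "b + (k * \<phi> w) *\<^sub>R rot w \<in> body \<phi>"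
    using m by (auto simp: mult_ge_def)
  let ?s = "- (w \<bullet> y) / \<phi> w"
  have s: "0 \<le> ?s" "?s \<le> 1"
    using assms pos bodyD[OF assms(1), of w] by (auto simp: field_simps)
  have sc: "?s *\<^sub>R c \<in> body \<phi>" if "c \<in> body \<phi>" for c
    using convexD[OF convex_body that zero, of ?s "1 - ?s"] s by simp
  have "w \<bullet> (y - ?s *\<^sub>R b) = 0"
    using b(2) pos by (simp add: inner_add_right inner_diff_right)
  then obtain r where r: "y - ?s *\<^sub>R b = r *\<^sub>R rot w" using orthogonal_rot[OF w] by metis
  have "y - r *\<^sub>R rot w = ?s *\<^sub>R b" using r by (simp add: algebra_simps)
  then have "y - r *\<^sub>R rot w \<in> body \<phi>" using sc[OF b(1)] by simp
  moreover have "y + (- r - k * (w \<bullet> y)) *\<^sub>R rot w = ?s *\<^sub>R (b + (k * \<phi> w) *\<^sub>R rot w)"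
  proof -
    have "?s * (k * \<phi> w) = - k * (w \<bullet> y)" using pos by simp
    then have "?s *\<^sub>R (b + (k * \<phi> w) *\<^sub>R rot w) = ?s *\<^sub>R b + (- k * (w \<bullet> y)) *\<^sub>R rot w"
      by (simp only: scaleR_add_right scaleR_scaleR)
    also have "?s *\<^sub>R b = y - r *\<^sub>R rot w" using r by (simp add: algebra_simps)
    finally show ?thesis by (simp add: algebra_simps)
  qed
  then have "y + (- r - k * (w \<bullet> y)) *\<^sub>R rot w \<in> body \<phi>" using sc[OF b(3)] by simp
  ultimately show ?thesis by (rule that)
qed

text \<open>With \<open>cross w p < 0\<close>, moving along \<open>rot w\<close> increases
  \<open>- (p \<bullet> y)\<close>, so a maximiser \<open>y\<close> is the last point of its slice
  in that direction. The slice is cut at the other end, and the segment from \<open>slice\<close>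
  ends at or before \<open>y\<close>, which leaves room for the cut.\<close>

lemma body_tau_neg:
  assumes y: "y \<in> body \<phi>" and p: "\<phi> p = - (p \<bullet> y)" "cross w p < 0"
  shows "y \<in> body (\<phi> \<circ> tau w k)"
proof (cases "w \<bullet> y \<ge> 0")
  case True
  then show ?thesis using body_tau_up y k by blast
next
  case False
  then obtain r where r: "y - r *\<^sub>R rot w \<in> body \<phi>" "y + (- r - k * (w \<bullet> y)) *\<^sub>R rot w \<in> body \<phi>"
    using slice y by (metis not_le)
  have "(- r - k * (w \<bullet> y)) * cross w p \<ge> 0"
    using bodyD[OF r(2), of p] p(1) by (simp add: inner_add_right inner_rot)
  then have le: "- r - k * (w \<bullet> y) \<le> 0" using p(2) by (simp add: zero_le_mult_iff)
  have "y + (k * (w \<bullet> y)) *\<^sub>R rot w \<in> body \<phi>"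
    using between_in_body[of y "- r" "rot w" \<phi> 0 "k * (w \<bullet> y)"] r(1) y le False k
    by (simp add: mult_nonneg_nonpos)
  with y show ?thesis by (rule body_tau_both)
qed

text \<open>Mirror image of \<open>body_tau_neg\<close>: here \<open>y\<close> is the first point of
  its slice, and its sheared copy is the point of the new polygon.\<close>

lemma body_tau_pos:
  assumes y: "y \<in> body \<phi>" and p: "\<phi> p = - (p \<bullet> y)" "cross w p > 0"
  shows "y - (k * (w \<bullet> y)) *\<^sub>R rot w \<in> body (\<phi> \<circ> tau w k)"
proof (cases "w \<bullet> y \<ge> 0")
  case True
  then show ?thesis using body_tau_up y k by blast
next
  case False
  then obtain r where r: "y - r *\<^sub>R rot w \<in> body \<phi>" "y + (- r - k * (w \<bullet> y)) *\<^sub>R rot w \<in> body \<phi>"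
    using slice y by (metis not_le)
  have "r * cross w p \<le> 0"
    using bodyD[OF r(1), of p] p(1) by (simp add: inner_diff_right inner_rot)
  then have le: "r \<le> 0" using p(2) by (simp add: mult_le_0_iff)
  have "y + (- (k * (w \<bullet> y))) *\<^sub>R rot w \<in> body \<phi>"
    using between_in_body[of y 0 "rot w" \<phi> "- r - k * (w \<bullet> y)" "- (k * (w \<bullet> y))"] r(2) y le False k
    by (simp add: mult_nonneg_nonpos)
  then show ?thesis
    by (intro body_tau_both) (use y in \<open>simp_all add: inner_diff_right\<close>)
qed

end

context mutation_data
begin

abbreviation "\<psi> \<equiv> \<phi> \<circ> tau w k"

lemma mult_ge_opposite:
  assumes "mult_ge \<phi> (- w) j" "\<phi> (- w) \<ge> 0"
  shows "mult_ge \<psi> (- w) (j + k)"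
proof -
  from assms(1) obtain y where y: "y \<in> body \<phi>" "w \<bullet> y = \<phi> (- w)"
      "y - (j * \<phi> (- w)) *\<^sub>R rot w \<in> body \<phi>"
    by (auto simp: mult_ge_def)
  have "w \<bullet> (y - (j * \<phi> (- w)) *\<^sub>R rot w) = \<phi> (- w)" using y by (simp add: inner_diff_right)
  with body_tau_up(2)[OF y(3), of w k] assms(2) k
  have "y - (j * \<phi> (- w)) *\<^sub>R rot w - (k * \<phi> (- w)) *\<^sub>R rot w \<in> body \<psi>" by simp
  moreover have "y \<in> body \<psi>" using body_tau_up(1)[OF y(1)] y(2) assms(2) k by simp
  ultimately show ?thesis
    unfolding mult_ge_def using y(2) by (intro bexI[of _ y]) (auto simp: tau_id algebra_simps)
qed

lemma mult_ge_same:
  assumes "mult_ge \<phi> w j" "j \<ge> k"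
  shows "mult_ge \<psi> w (j - k)"
proof -
  let ?h = "\<phi> w"
  from assms(1) obtain y where y: "y \<in> body \<phi>" "w \<bullet> y = - ?h" "y + (j * ?h) *\<^sub>R rot w \<in> body \<phi>"
    by (auto simp: mult_ge_def)
  have between: "y + (i * ?h) *\<^sub>R rot w \<in> body \<phi>" if "0 \<le> i" "i \<le> j" for i
    using between_in_body[of y 0 "rot w" \<phi> "j * ?h" "i * ?h"] that y pos by simp
  have in_new: "y + (i * ?h) *\<^sub>R rot w \<in> body \<psi>" if "k \<le> i" "i \<le> j" for i
  proof (rule body_tau_both)
    show "y + (i * ?h) *\<^sub>R rot w \<in> body \<phi>" using between that k by simp
    have "y + (i * ?h) *\<^sub>R rot w + (k * (w \<bullet> (y + (i * ?h) *\<^sub>R rot w))) *\<^sub>R rot w = y + ((i - k) * ?h) *\<^sub>R rot w"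
      using y(2) by (simp add: inner_add_right algebra_simps)
    then show "y + (i * ?h) *\<^sub>R rot w + (k * (w \<bullet> (y + (i * ?h) *\<^sub>R rot w))) *\<^sub>R rot w \<in> body \<phi>"
      using between[of "i - k"] that k by (simp only:)
  qed
  show ?thesis
    unfolding mult_ge_def
  proof (intro bexI conjI)
    show "y + (k * ?h) *\<^sub>R rot w \<in> body \<psi>" using in_new assms(2) by simp
    show "w \<bullet> (y + (k * ?h) *\<^sub>R rot w) = - \<psi> w" using y(2) by (simp add: inner_add_right tau_id)
    show "y + (k * ?h) *\<^sub>R rot w + ((j - k) * \<psi> w) *\<^sub>R rot w \<in> body \<psi>"
      using in_new[of j] assms(2) by (simp add: tau_id algebra_simps)
  qed
qed

text \<open>Both ends of the face of \<open>u\<close> maximise \<open>- (u \<bullet> y)\<close>, so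
  \<open>body_tau_neg\<close> or \<open>body_tau_pos\<close> carries both over. For
  \<open>cross w u > 0\<close> the ends are sheared, and the normal of the sheared face is the
  preimage of \<open>u\<close> under \<open>tau w k\<close>.\<close>

lemma mult_ge_other:
  assumes "mult_ge \<phi> u j" "cross w u \<noteq> 0"
  shows "mult_ge \<psi> (u + (k * max 0 (cross w u)) *\<^sub>R w) j"
proof -
  let ?h = "\<phi> u"
  from assms(1) obtain y where y: "y \<in> body \<phi>" "u \<bullet> y = - ?h" "y + (j * ?h) *\<^sub>R rot u \<in> body \<phi>"
    by (auto simp: mult_ge_def)
  let ?z = "y + (j * ?h) *\<^sub>R rot u"
  have z: "\<phi> u = - (u \<bullet> ?z)" using y(2) by (simp add: inner_add_right)
  show ?thesis
  proof (cases "cross w u < 0")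
    case True
    moreover have "\<phi> u = - (u \<bullet> y)" using y(2) by simp
    ultimately have "y \<in> body \<psi>" "?z \<in> body \<psi>" using body_tau_neg y z by blast+
    then show ?thesis unfolding mult_ge_def using True y(2) by (intro bexI[of _ y]) (simp_all add: tau_id)
  next
    case False
    then have c: "cross w u > 0" using assms(2) by simp
    let ?u = "u + (k * cross w u) *\<^sub>R w"
    have "tau w k ?u = u" using c by (simp add: tau_shear)
    then have \<psi>u: "\<psi> ?u = ?h" by simp
    have yz: "y - (k * (w \<bullet> y)) *\<^sub>R rot w \<in> body \<psi>" "?z - (k * (w \<bullet> ?z)) *\<^sub>R rot w \<in> body \<psi>"
      using body_tau_pos[OF y(1), of u] body_tau_pos[OF y(3) z] y(2) c by simp_all
    have "?z - (k * (w \<bullet> ?z)) *\<^sub>R rot w = y - (k * (w \<bullet> y)) *\<^sub>R rot w + (j * ?h) *\<^sub>R rot ?u"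
      using cross_swap[of u w] by (simp add: inner_add_right inner_rot algebra_simps)
    moreover have "?u \<bullet> (y - (k * (w \<bullet> y)) *\<^sub>R rot w) = - ?h"
      using y(2) by (simp add: inner_add_left inner_diff_right inner_rot algebra_simps)
    ultimately have "mult_ge \<psi> ?u j"
      unfolding mult_ge_def \<psi>u using yz by metis
    then show ?thesis using c by simp
  qed
qed

end

section \<open>Support functions of Fano polygons and multiplicities of their faces\<close>

lemma fan_pos: "fan \<phi> \<Longrightarrow> m \<noteq> 0 \<Longrightarrow> \<phi> m > 0"
  by (simp add: fan_def)

lemma fan_attained:
  assumes "fan \<phi>"
  obtains v where "primitive v" "lat v \<in> body \<phi>" "\<phi> m = - (m \<bullet> lat v)"
proof -
  obtain V where V: "\<forall>v\<in>V. primitive v \<and> lat v \<in> body \<phi>" "\<forall>m. \<exists>v\<in>V. \<phi> m = - (m \<bullet> lat v)"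
    using assms by (auto simp: fan_def)
  obtain v where "v \<in> V" "\<phi> m = - (m \<bullet> lat v)" using V(2) by blast
  then show thesis using V(1) that by auto
qed

lemma fan_scale:
  assumes "fan \<phi>" "c \<ge> 0"
  shows "\<phi> (c *\<^sub>R m) = c * \<phi> m"
proof (rule antisym)
  obtain v where "lat v \<in> body \<phi>" "\<phi> (c *\<^sub>R m) = - (c *\<^sub>R m \<bullet> lat v)" using fan_attained assms by metis
  then show "\<phi> (c *\<^sub>R m) \<le> c * \<phi> m"
    using mult_left_mono[OF bodyD[of "lat v" \<phi> m] assms(2)] by simp
  obtain v' where "lat v' \<in> body \<phi>" "\<phi> m = - (m \<bullet> lat v')" using fan_attained assms by metis
  then show "c * \<phi> m \<le> \<phi> (c *\<^sub>R m)" using bodyD[of "lat v'" \<phi> "c *\<^sub>R m"] by simp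
qed

lemma fan_zero: "fan \<phi> \<Longrightarrow> \<phi> 0 = 0"
  using fan_scale[of \<phi> 0 0] by simp

lemma fan_nonneg: "fan \<phi> \<Longrightarrow> \<phi> m \<ge> 0"
  using fan_pos[of \<phi> m] fan_zero[of \<phi>] by (cases "m = 0") auto

lemma fan_zero_body: "fan \<phi> \<Longrightarrow> 0 \<in> body \<phi>"
  by (simp add: body_iff fan_nonneg)

lemma fan_integral:
  assumes "fan \<phi>"
  obtains h :: int where "\<phi> (lat w) = of_int h"
proof -
  obtain v where "\<phi> (lat w) = - (lat w \<bullet> lat v)" using fan_attained assms by metis
  then have "\<phi> (lat w) = of_int (- (w $ 1 * v $ 1 + w $ 2 * v $ 2))" by (simp add: inner2)
  then show thesis by (rule that)
qed

lemma norm_rot [simp]: "norm (rot a) = norm a"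
  by (simp add: norm_eq_sqrt_inner inner2 algebra_simps)

lemma fan_bounded:
  assumes "fan \<phi>"
  obtains R where "R > 0" "\<And>y. y \<in> body \<phi> \<Longrightarrow> norm y \<le> R"
proof -
  let ?e = "\<lambda>i. axis i 1 :: real ^ 2"
  let ?R = "\<phi> (?e 1) + \<phi> (- ?e 1) + (\<phi> (?e 2) + \<phi> (- ?e 2)) + 1"
  have nn: "\<phi> m \<ge> 0" for m using fan_nonneg assms by blast
  show thesis
  proof
    show "?R > 0" using nn[of "?e 1"] nn[of "- ?e 1"] nn[of "?e 2"] nn[of "- ?e 2"] by linarith
    fix y assume "y \<in> body \<phi>"
    then have *: "- (m \<bullet> y) \<le> \<phi> m" for m by (rule bodyD)
    have "\<bar>y $ i\<bar> \<le> \<phi> (?e i) + \<phi> (- ?e i)" for i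
      using *[of "?e i"] *[of "- ?e i"] nn[of "?e i"] nn[of "- ?e i"]
      by (simp add: inner_axis' abs_le_iff)
    then have "(\<Sum>i\<in>UNIV. \<bar>y $ i\<bar>) \<le> \<phi> (?e 1) + \<phi> (- ?e 1) + (\<phi> (?e 2) + \<phi> (- ?e 2))"
      by (simp add: sum_2 add_mono)
    then show "norm y \<le> ?R" using norm_le_l1_cart[of y] by linarith
  qed
qed

text \<open>The two ends of the segment differ by a vector of norm
  \<open>k * \<phi> w * norm w\<close>, which cannot exceed the diameter. This serves twice: for the
  existence of \<open>node_mult\<close> and for bounding heights in finite mutation type.\<close>

lemma mult_ge_bound:
  assumes "\<And>y. y \<in> body \<phi> \<Longrightarrow> norm y \<le> R" "mult_ge \<phi> w k" "k \<ge> 0" "\<phi> w \<ge> 0"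
  shows "k * \<phi> w * norm w \<le> 2 * R"
proof -
  obtain y where "y \<in> body \<phi>" "y + (k * \<phi> w) *\<^sub>R rot w \<in> body \<phi>"
    using assms by (auto simp: mult_ge_def)
  then have "norm y \<le> R" "norm (y + (k * \<phi> w) *\<^sub>R rot w) \<le> R" using assms(1) by blast+
  moreover have "norm ((k * \<phi> w) *\<^sub>R rot w) \<le> norm (y + (k * \<phi> w) *\<^sub>R rot w) + norm y"
    using norm_triangle_ineq4[of "y + (k * \<phi> w) *\<^sub>R rot w" y] by simp
  moreover have "norm ((k * \<phi> w) *\<^sub>R rot w) = k * \<phi> w * norm w"
    using assms(3,4) by (simp add: abs_mult)
  ultimately show ?thesis by linarith
qed

lemma mult_ge_0: "fan \<phi> \<Longrightarrow> mult_ge \<phi> w 0"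
  unfolding mult_ge_def by (metis fan_attained add.inverse_inverse add.right_neutral mult_zero_left scale_zero_left)

lemma mult_ge_mono:
  assumes "mult_ge \<phi> w k" "0 \<le> j" "j \<le> k" "\<phi> w \<ge> 0"
  shows "mult_ge \<phi> w j"
proof -
  obtain y where y: "y \<in> body \<phi>" "w \<bullet> y = - \<phi> w" "y + (k * \<phi> w) *\<^sub>R rot w \<in> body \<phi>"
    using assms by (auto simp: mult_ge_def)
  then have "y + (j * \<phi> w) *\<^sub>R rot w \<in> body \<phi>"
    using between_in_body[of y 0 "rot w" \<phi> "k * \<phi> w" "j * \<phi> w"] assms by (simp add: mult_right_mono)
  with y show ?thesis by (auto simp: mult_ge_def)
qed

text \<open>On the inner normal of an edge this is the number of nodes at that edge
  (\<open>edge_mult_eq\<close>). It is defined for every direction, with value \<open>0\<close> at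
  primitive directions that carry no edge, so the mutation rules need not speak of edges.\<close>

definition node_mult :: "(real ^ 2 \<Rightarrow> real) \<Rightarrow> real ^ 2 \<Rightarrow> nat" where
  "node_mult \<phi> w = (GREATEST k. mult_ge \<phi> w (real k))"

lemma le_mult_iff:
  assumes "fan \<phi>" "w \<noteq> 0"
  shows "k \<le> node_mult \<phi> w \<longleftrightarrow> mult_ge \<phi> w (real k)"
proof -
  obtain R where R: "\<And>y. y \<in> body \<phi> \<Longrightarrow> norm y \<le> R" using fan_bounded assms by metis
  have pos: "\<phi> w * norm w > 0" using fan_pos assms by simp
  have bd: "j \<le> nat \<lceil>2 * R / (\<phi> w * norm w)\<rceil>" if "mult_ge \<phi> w (real j)" for j
  proof -
    have "real j * (\<phi> w * norm w) \<le> 2 * R"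
      using mult_ge_bound[OF R that] fan_nonneg[OF assms(1)] by (simp add: mult.assoc)
    then have "real j \<le> 2 * R / (\<phi> w * norm w)" using pos by (simp add: pos_le_divide_eq)
    then show ?thesis by linarith
  qed
  have 0: "mult_ge \<phi> w (real 0)" using mult_ge_0 assms by simp
  have "mult_ge \<phi> w (real (node_mult \<phi> w))"
    unfolding node_mult_def by (rule GreatestI_nat[where P = "\<lambda>k. mult_ge \<phi> w (real k)", OF 0]) (use bd in blast)
  moreover have "k \<le> node_mult \<phi> w" if "mult_ge \<phi> w (real k)"
    unfolding node_mult_def by (rule Greatest_le_nat[where P = "\<lambda>k. mult_ge \<phi> w (real k)", OF that]) (use bd in blast)
  ultimately show ?thesis
    using mult_ge_mono fan_nonneg[OF assms(1)] by (metis of_nat_0_le_iff of_nat_mono)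
qed

lemma fan_tau_pos:
  assumes "fan \<phi>" "m \<noteq> 0"
  shows "(\<phi> \<circ> tau w k) m > 0"
proof -
  have "tau w k m \<noteq> 0"
    using assms(2) cross_tau[of w k m] tau_id[of w m k] by force
  then show ?thesis using fan_pos assms(1) by simp
qed

text \<open>A supporting line of the mutated sublevel set at its boundary point on the ray of
  \<open>w\<close> is a point \<open>y\<close> of the dual. Read separately on the two sides of the
  wall, the inequalities for \<open>y\<close> say that \<open>y\<close> and a translate by
  \<open>k * \<phi> w\<close> along the face both lie in \<open>body \<phi>\<close>.\<close>

lemma convex_imp_mult_ge:
  assumes "fan \<phi>" "w \<noteq> 0" "k \<ge> 0" "convex {m. (\<phi> \<circ> tau w k) m \<le> 1}"
  shows "mult_ge \<phi> w k"
proof -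
  let ?\<psi> = "\<phi> \<circ> tau w k" and ?h = "\<phi> w"
  let ?C = "{m. ?\<psi> m \<le> 1}"
  have hom: "?\<psi> (c *\<^sub>R m) = c * ?\<psi> m" if "c \<ge> 0" for c m
    using that fan_scale[OF assms(1)] by (simp add: tau_scale)
  have h: "?h > 0" using fan_pos assms by blast
  have \<psi>w: "?\<psi> w = ?h" by (simp add: tau_id)
  have posc: "?\<psi> m > 0" if "m \<noteq> 0" for m using fan_tau_pos assms(1) that by blast
  let ?S = "{m. ?\<psi> m < 1}"
  \<comment> \<open>The strict sublevel set is the one to be separated, as it misses the boundary
    point \<open>?p\<close>. Any two of its points lie in a common multiple \<open>?t\<close> of
    \<open>?C\<close> with \<open>?t < 1\<close>; the \<open>1/2\<close> keeps \<open>?t\<close>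
    positive.\<close>
  have conv: "convex ?S"
  proof (rule convexI)
    fix x y and u v :: real
    assume xy: "x \<in> ?S" "y \<in> ?S" and uv: "0 \<le> u" "0 \<le> v" "u + v = 1"
    let ?t = "max (1/2) (max (?\<psi> x) (?\<psi> y))"
    have t: "0 < ?t" "?t < 1" "?\<psi> x \<le> ?t" "?\<psi> y \<le> ?t" using xy by auto
    have in_C: "(1 / ?t) *\<^sub>R x \<in> ?C" "(1 / ?t) *\<^sub>R y \<in> ?C"
      using t hom[of "1 / ?t" x] hom[of "1 / ?t" y] by (auto simp del: o_apply simp: divide_le_eq)
    have "u *\<^sub>R ((1 / ?t) *\<^sub>R x) + v *\<^sub>R ((1 / ?t) *\<^sub>R y) \<in> ?C"
      using convexD[OF assms(4) in_C] uv by blast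
    moreover have "u *\<^sub>R ((1 / ?t) *\<^sub>R x) + v *\<^sub>R ((1 / ?t) *\<^sub>R y) = (1 / ?t) *\<^sub>R (u *\<^sub>R x + v *\<^sub>R y)"
      by (simp add: scaleR_add_right mult.commute)
    ultimately have "(1 / ?t) * ?\<psi> (u *\<^sub>R x + v *\<^sub>R y) \<le> 1"
      using hom[of "1 / ?t" "u *\<^sub>R x + v *\<^sub>R y"] t by simp
    then have "?\<psi> (u *\<^sub>R x + v *\<^sub>R y) \<le> ?t" using t(1) by (simp add: field_simps)
    then show "u *\<^sub>R x + v *\<^sub>R y \<in> ?S" using le_less_trans t(2) by blast
  qed
  have "0 \<in> ?S" using fan_zero[OF assms(1)] by (simp add: tau_id)
  let ?p = "(1 / ?h) *\<^sub>R w"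
  have \<psi>p: "?\<psi> ?p = 1" using hom[of "1 / ?h" w] \<psi>w h by simp
  then have "{?p} \<inter> ?S = {}" by auto
  then obtain a b where ab: "a \<noteq> 0" "\<forall>x\<in>{?p}. a \<bullet> x \<le> b" "\<forall>x\<in>?S. b \<le> a \<bullet> x"
    using separating_hyperplane_sets[of "{?p}" ?S] conv \<open>0 \<in> ?S\<close> by (metis convex_singleton empty_iff insertI1)
  have b0: "b \<le> 0" using ab(3) \<open>0 \<in> ?S\<close> by force
  \<comment> \<open>If \<open>b = 0\<close>, a small multiple of \<open>- a\<close> would lie in
    \<open>?S\<close> on the wrong side of the line.\<close>
  have bneg: "b < 0"
  proof (rule ccontr)
    assume "\<not> b < 0"
    then have b: "b = 0" using b0 by simp
    let ?c = "1 / (2 * (?\<psi> (- a)))"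
    have pa: "?\<psi> (- a) > 0" using posc ab(1) by simp
    then have "?\<psi> (?c *\<^sub>R (- a)) = 1 / 2" using hom[of ?c "- a"] by (simp del: scaleR_minus_right)
    then have "?c *\<^sub>R (- a) \<in> ?S" by (simp del: scaleR_minus_right)
    with ab(3) b have "0 \<le> a \<bullet> (?c *\<^sub>R (- a))" by blast
    then have "?c * (a \<bullet> a) \<le> 0" by simp
    moreover have "?c * (a \<bullet> a) > 0" using pa ab(1) by (simp del: o_apply)
    ultimately show False by simp
  qed
  \<comment> \<open>Normalised so that the separating line \<open>a \<bullet> x = b\<close> becomes
    \<open>- (x \<bullet> y) = 1\<close>.\<close>
  define y where "y = (- (1 / b)) *\<^sub>R a"
  have y1: "- (m \<bullet> y) \<le> ?\<psi> m" for m
  proof (rule ccontr)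
    assume "\<not> - (m \<bullet> y) \<le> ?\<psi> m"
    then have lt: "?\<psi> m < - (m \<bullet> y)" by simp
    have m0: "m \<noteq> 0" using lt fan_zero[OF assms(1)] by (auto simp: tau_id)
    define s where "s = - (m \<bullet> y)"
    have s: "s > 0" "?\<psi> m < s" using lt posc[OF m0] by (auto simp: s_def)
    define q where "q = ?\<psi> m / s"
    have q: "0 < q" "q < 1" unfolding q_def using s posc[OF m0] by (auto simp del: o_apply)
    let ?r = "2 / (1 + q)"
    have r: "1 < ?r" "?r * q < 1" using q by (auto simp: field_simps)
    text \<open>\<open>m / s\<close> lies in the open set \<open>?S\<close>, and so does a slightly larger multiple of \<open>m\<close>.\<close>
    have "?r / s \<ge> 0" using s(1) q by simp
    from hom[OF this, of m] have "?\<psi> ((?r / s) *\<^sub>R m) = ?r * q" by (simp add: q_def)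
    then have "(?r / s) *\<^sub>R m \<in> ?S" using r(2) by simp
    then have "b \<le> a \<bullet> ((?r / s) *\<^sub>R m)" using ab(3) by blast
    also have "a \<bullet> m = b * s"
      using bneg by (simp add: s_def y_def inner_commute)
    then have "a \<bullet> ((?r / s) *\<^sub>R m) = ?r * b" using s(1) by simp
    finally have "?r * b \<ge> b" .
    then show False using r(1) bneg by (smt (verit) mult_less_cancel_right2)
  qed
  then have y_body: "y \<in> body ?\<psi>" by (simp add: body_iff)
  have "a \<bullet> ?p \<le> b" using ab(2) by simp
  then have "a \<bullet> w \<le> b * ?h" using h by (simp add: field_simps)
  then have "(a \<bullet> w) / b \<ge> ?h" using bneg by (simp add: neg_le_divide_eq mult.commute)
  then have "- (w \<bullet> y) \<ge> ?h" by (simp add: y_def inner_commute)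
  with y1[of w] \<psi>w have wy: "w \<bullet> y = - ?h" by simp
  have B: "\<And>n. cross w n \<le> 0 \<Longrightarrow> - (n \<bullet> y) \<le> \<phi> n"
    "\<And>n. cross w n \<ge> 0 \<Longrightarrow> - (n \<bullet> y) + k * ?h * cross w n \<le> \<phi> n"
    using y_body unfolding body_tau_iff by (auto simp: wy inner_add_right inner_diff_right inner_rot)
  have "y \<in> body \<phi>"
    unfolding body_iff
  proof
    fix n
    show "- (n \<bullet> y) \<le> \<phi> n"
      using B[of n] assms(3) h by (smt (verit) mult_nonneg_nonneg)
  qed
  moreover have "y - (k * ?h) *\<^sub>R rot w \<in> body \<phi>"
    unfolding body_iff
  proof
    fix n
    show "- (n \<bullet> (y - (k * ?h) *\<^sub>R rot w)) \<le> \<phi> n"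
      using B[of n] assms(3) h
      by (smt (verit) inner_diff_right inner_rot inner_scaleR_right mult_nonneg_nonneg mult_nonneg_nonpos)
  qed
  ultimately show ?thesis
    unfolding mult_ge_def by (intro bexI[of _ "y - (k * ?h) *\<^sub>R rot w"]) (simp_all add: wy inner_diff_right)
qed

section \<open>Fano polygons as support functions\<close>

declare transpose_matrix_vector [simp del]

definition rmat :: "int ^ 2 ^ 2 \<Rightarrow> real ^ 2 ^ 2" where
  "rmat A = (\<chi> i j. of_int (A $ i $ j))"

abbreviation act :: "int ^ 2 ^ 2 \<Rightarrow> real ^ 2 \<Rightarrow> real ^ 2" where
  "act A \<equiv> (*v) (rmat A)"

definition unimodular :: "int ^ 2 ^ 2 \<Rightarrow> bool" where
  "unimodular A \<longleftrightarrow> \<bar>det A\<bar> = 1"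

definition mat2 :: "'a \<Rightarrow> 'a \<Rightarrow> 'a \<Rightarrow> 'a \<Rightarrow> 'a ^ 2 ^ 2" where
  "mat2 a b c d = (\<chi> i j. if i = 1 then if j = 1 then a else b else if j = 1 then c else d)"

text \<open>The adjugate times the determinant, which is the inverse when the determinant is
  \<open>1\<close> or \<open>- 1\<close>.\<close>

definition inv2 :: "int ^ 2 ^ 2 \<Rightarrow> int ^ 2 ^ 2" where
  "inv2 A = mat2 (det A * A $ 2 $ 2) (- det A * A $ 1 $ 2) (- det A * A $ 2 $ 1) (det A * A $ 1 $ 1)"

lemma mat2_nth [simp]:
  "mat2 a b c d $ 1 $ 1 = a" "mat2 a b c d $ 1 $ 2 = b" "mat2 a b c d $ 2 $ 1 = c" "mat2 a b c d $ 2 $ 2 = d"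
  by (simp_all add: mat2_def)

lemma rmat_nth [simp]: "rmat A $ i $ j = of_int (A $ i $ j)"
  by (simp add: rmat_def)

lemma mv_nth [simp]: "((A :: 'a::semiring_1 ^ 2 ^ 2) *v x) $ i = A $ i $ 1 * x $ 1 + A $ i $ 2 * x $ 2"
  by (simp add: matrix_vector_mult_def sum_2)

lemma lat_mv: "lat (A *v v) = act A (lat v)"
  by (simp add: vec2_eq)

lemma mat_eq2: "(A :: 'a ^ 2 ^ 2) = B \<longleftrightarrow>
    A $ 1 $ 1 = B $ 1 $ 1 \<and> A $ 1 $ 2 = B $ 1 $ 2 \<and> A $ 2 $ 1 = B $ 2 $ 1 \<and> A $ 2 $ 2 = B $ 2 $ 2"
  by (auto simp: vec_eq_iff forall_2)

lemma mm_nth [simp]: "((A :: 'a::semiring_1 ^ 2 ^ 2) ** B) $ i $ j = A $ i $ 1 * B $ 1 $ j + A $ i $ 2 * B $ 2 $ j"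
  by (simp add: matrix_matrix_mult_def sum_2)

lemma rmat_mult: "rmat (A ** B) = rmat A ** rmat B"
  by (simp add: mat_eq2)

lemma act_mult: "act (A ** B) m = act A (act B m)"
  by (simp add: rmat_mult matrix_vector_mul_assoc)

lemma rmat_mat: "rmat (mat 1) = mat 1"
  by (simp add: mat_eq2 mat_def)

lemma act_mat [simp]: "act (mat 1) m = m"
  by (simp add: rmat_mat)

lemma unimodular_cases: "unimodular A \<Longrightarrow> det A = 1 \<or> det A = - 1"
  by (auto simp: unimodular_def abs_if split: if_splits)

lemma unimodular_mult: "unimodular A \<Longrightarrow> unimodular B \<Longrightarrow> unimodular (A ** B)"
  by (simp add: unimodular_def det_mul abs_mult)

lemma unimodular_mat [simp]: "unimodular (mat 1)"
  by (simp add: unimodular_def)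

lemma unimodular_transpose [simp]: "unimodular (transpose A) \<longleftrightarrow> unimodular A"
  by (simp add: unimodular_def)

lemma unimodular_mat2: "unimodular (mat2 a b c d) \<longleftrightarrow> \<bar>a * d - b * c\<bar> = 1"
  by (simp add: unimodular_def det_2)

lemma inv2:
  assumes "unimodular A"
  shows "A ** inv2 A = mat 1" "inv2 A ** A = mat 1"
proof -
  have "det A * det A = 1" using unimodular_cases[OF assms] by auto
  then have "det A * (A $ 1 $ 1 * A $ 2 $ 2 - A $ 1 $ 2 * A $ 2 $ 1) = 1" by (simp only: det_2)
  then show "A ** inv2 A = mat 1" "inv2 A ** A = mat 1"
    by (simp_all add: inv2_def mat_eq2 mat_def algebra_simps)
qed

lemma unimodular_inv2 [simp]:
  assumes "unimodular A"
  shows "unimodular (inv2 A)"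
proof -
  have "det A * det (inv2 A) = 1" using inv2(1)[OF assms] by (metis det_I det_mul)
  then show ?thesis using unimodular_cases[OF assms] by (auto simp: unimodular_def)
qed

lemma act_inv2 [simp]:
  assumes "unimodular A"
  shows "act A (act (inv2 A) m) = m" "act (inv2 A) (act A m) = m"
  by (simp_all only: act_mult [symmetric] inv2[OF assms] act_mat)

lemma mv_inv2 [simp]:
  assumes "unimodular A"
  shows "A *v (inv2 A *v x) = x" "inv2 A *v (A *v x) = x"
  using inv2[OF assms] by (simp_all add: matrix_vector_mul_assoc)

lemma invertible_iff_unimodular: "invertible (A :: int ^ 2 ^ 2) \<longleftrightarrow> unimodular A"
proof
  assume "invertible A"
  then obtain B where "A ** B = mat 1" by (auto simp: invertible_def)
  then have "det A * det B = 1" by (metis det_I det_mul)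
  then show "unimodular A" by (auto simp: unimodular_def zmult_eq_1_iff)
next
  assume "unimodular A"
  then show "invertible A" using inv2 by (auto simp: invertible_def)
qed

lemma inner_act: "act A m \<bullet> y = m \<bullet> act (transpose A) y"
  by (simp add: inner2 transpose_def algebra_simps)

lemma primitive_mv:
  assumes "unimodular A" "primitive v"
  shows "primitive (A *v v)"
proof -
  have "c dvd 1" if c: "c dvd (A *v v) $ 1" "c dvd (A *v v) $ 2" for c
  proof -
    have "c dvd (inv2 A *v (A *v v)) $ i" for i using c by simp
    then have "c dvd v $ 1" "c dvd v $ 2" using assms(1) by (simp_all del: mv_nth)
    with assms(2) show ?thesis using coprime_common_divisor unfolding primitive_def by blast
  qed
  then show ?thesis unfolding primitive_def by (intro coprimeI) blast
qed

lemma primitive_mv_iff [simp]: "unimodular A \<Longrightarrow> primitive (A *v v) \<longleftrightarrow> primitive v"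
  using primitive_mv[of A v] primitive_mv[of "inv2 A" "A *v v"] by auto

lemma transpose_inv2:
  assumes "unimodular A"
  shows "act (transpose A) (act (transpose (inv2 A)) y) = y" "act (transpose (inv2 A)) (act (transpose A) y) = y"
  by (simp_all only: act_mult [symmetric] matrix_transpose_mul [symmetric] inv2[OF assms] transpose_mat act_mat)

lemma body_act:
  assumes "unimodular A"
  shows "y \<in> body (\<phi> \<circ> act A) \<longleftrightarrow> act (transpose (inv2 A)) y \<in> body \<phi>"
proof -
  have "y \<in> body (\<phi> \<circ> act A) \<longleftrightarrow> (\<forall>m. - (act A m \<bullet> act (transpose (inv2 A)) y) \<le> \<phi> (act A m))"
    by (simp add: body_iff inner_act transpose_inv2[OF assms])
  also have "\<dots> \<longleftrightarrow> act (transpose (inv2 A)) y \<in> body \<phi>"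
    unfolding body_iff by (metis act_inv2(1)[OF assms])
  finally show ?thesis .
qed

lemma body_act_image:
  assumes "unimodular A"
  shows "body (\<phi> \<circ> act A) = act (transpose A) ` body \<phi>"
proof safe
  fix y assume "y \<in> body (\<phi> \<circ> act A)"
  then show "y \<in> act (transpose A) ` body \<phi>"
    using body_act[OF assms] transpose_inv2(1)[OF assms, of y] by (metis image_eqI)
next
  fix y assume "y \<in> body \<phi>"
  then show "act (transpose A) y \<in> body (\<phi> \<circ> act A)"
    by (simp add: body_act[OF assms] transpose_inv2[OF assms])
qed

lemma fan_act:
  assumes "unimodular A" "fan \<phi>"
  shows "fan (\<phi> \<circ> act A)"
proof -
  obtain V where V: "finite V" "\<And>v. v \<in> V \<Longrightarrow> primitive v" "\<And>v. v \<in> V \<Longrightarrow> lat v \<in> body \<phi>"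
      "\<And>m. \<exists>v\<in>V. \<phi> m = - (m \<bullet> lat v)"
    using assms(2) unfolding fan_def by blast
  have "act A m \<noteq> 0" if "m \<noteq> 0" for m using act_inv2(2)[OF assms(1), of m] that by force
  then have "\<forall>m. m \<noteq> 0 \<longrightarrow> (\<phi> \<circ> act A) m > 0" using fan_pos[OF assms(2)] by simp
  moreover have "\<forall>u\<in>(*v) (transpose A) ` V. primitive u \<and> lat u \<in> body (\<phi> \<circ> act A)"
    using V(2,3) assms(1) by (auto simp: lat_mv body_act transpose_inv2)
  moreover have "\<forall>m. \<exists>u\<in>(*v) (transpose A) ` V. (\<phi> \<circ> act A) m = - (m \<bullet> lat u)"
    using V(4) by (auto simp: lat_mv inner_act[symmetric])
  ultimately show ?thesis unfolding fan_def using V(1) by blast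
qed

lemma cross_act: "cross (act A a) (act A b) = of_int (det A) * cross a b"
  by (simp add: cross_def det_2 algebra_simps)

lemma rot_act: "unimodular A \<Longrightarrow> act (transpose A) (rot (act A w)) = of_int (det A) *\<^sub>R rot w"
  by (simp add: vec2_eq det_2 transpose_def algebra_simps)

lemma mult_ge_act:
  assumes "unimodular A" "mult_ge \<phi> (act A w) k"
  shows "mult_ge (\<phi> \<circ> act A) w k"
proof -
  let ?B = "transpose A" and ?h = "\<phi> (act A w)"
  obtain y where y: "y \<in> body \<phi>" "act A w \<bullet> y = - ?h" "y + (k * ?h) *\<^sub>R rot (act A w) \<in> body \<phi>"
    using assms by (auto simp: mult_ge_def)
  let ?z = "y + (k * ?h) *\<^sub>R rot (act A w)"
  have in_body: "act ?B y \<in> body (\<phi> \<circ> act A)" "act ?B ?z \<in> body (\<phi> \<circ> act A)"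
    using y by (simp_all add: body_act_image[OF assms(1)])
  have h: "w \<bullet> act ?B y = - ?h" "w \<bullet> act ?B ?z = - ?h"
    using y(2) by (simp_all add: inner_act[symmetric] inner_add_right)
  have z: "act ?B ?z = act ?B y + (k * ?h * of_int (det A)) *\<^sub>R rot w"
    by (simp add: matrix_vector_right_distrib matrix_vector_mult_scaleR rot_act[OF assms(1)])
  \<comment> \<open>A reflection reverses \<open>rot\<close>, hence the direction in which the face
    is traversed; for determinant \<open>- 1\<close> its other end is the starting point.\<close>
  consider "det A = 1" | "det A = - 1" using unimodular_cases assms by blast
  then show ?thesis
  proof cases
    case 1
    then show ?thesis unfolding mult_ge_def using in_body h z by (intro bexI[of _ "act ?B y"]) simp_all
  next
    case 2
    then show ?thesis unfolding mult_ge_def using in_body h z by (intro bexI[of _ "act ?B ?z"]) simp_all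
  qed
qed

lemma act_comp_inv2: "unimodular A \<Longrightarrow> (\<phi> \<circ> act A) \<circ> act (inv2 A) = \<phi>"
  by (simp add: fun_eq_iff)

lemma mult_act:
  assumes "unimodular A"
  shows "node_mult (\<phi> \<circ> act A) w = node_mult \<phi> (act A w)"
proof -
  have "mult_ge (\<phi> \<circ> act A) w k \<longleftrightarrow> mult_ge \<phi> (act A w) k" for k
    using mult_ge_act[OF assms, of \<phi> w k] mult_ge_act[of "inv2 A" "\<phi> \<circ> act A" "act A w" k] assms
    by (auto simp: act_comp_inv2)
  then show ?thesis by (simp add: node_mult_def)
qed

section \<open>Correspondence between Fano polygons and support functions\<close>

lemma fan_body_hull:
  assumes fin: "finite V" and V: "\<And>v. v \<in> V \<Longrightarrow> lat v \<in> body \<phi>"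
    and att: "\<And>m. \<exists>v\<in>V. \<phi> m = - (m \<bullet> lat v)"
  shows "body \<phi> = convex hull (lat ` V)"
proof
  show "convex hull (lat ` V) \<subseteq> body \<phi>"
    using V by (intro hull_minimal convex_body) auto
  show "body \<phi> \<subseteq> convex hull (lat ` V)"
  proof
    fix y assume y: "y \<in> body \<phi>"
    show "y \<in> convex hull (lat ` V)"
    proof (rule ccontr)
      assume "y \<notin> convex hull (lat ` V)"
      moreover have "closed (convex hull (lat ` V))"
        using fin by (intro compact_imp_closed finite_imp_compact_convex_hull) auto
      ultimately obtain a b where ab: "a \<bullet> y < b" "\<forall>x\<in>convex hull (lat ` V). b < a \<bullet> x"
        using separating_hyperplane_closed_point convex_convex_hull by metis
      obtain v where v: "v \<in> V" "\<phi> a = - (a \<bullet> lat v)" using att by blast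
      then have "b < a \<bullet> lat v" using ab(2) hull_inc[of "lat v" "lat ` V"] by blast
      with bodyD[OF y, of a] v ab(1) show False by simp
    qed
  qed
qed

text \<open>The minimum of \<open>\<phi>\<close> on the unit circle is positive by compactness, and
  the disc of that radius satisfies all defining inequalities. Continuity comes from convexity, as
  \<open>\<phi>\<close> is a maximum of linear functions.\<close>

lemma fan_ball:
  assumes "fan \<phi>"
  obtains e where "e > 0" "ball 0 e \<subseteq> body \<phi>"
proof -
  obtain V where V: "finite V" "\<And>v. v \<in> V \<Longrightarrow> lat v \<in> body \<phi>" "\<And>m. \<exists>v\<in>V. \<phi> m = - (m \<bullet> lat v)"
    using assms unfolding fan_def by blast
  have sub: "\<phi> (a + b) \<le> \<phi> a + \<phi> b" for a b
  proof -
    obtain v where v: "v \<in> V" "\<phi> (a + b) = - ((a + b) \<bullet> lat v)" using V(3) by blast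
    then show ?thesis
      using bodyD[OF V(2)[OF v(1)], of a] bodyD[OF V(2)[OF v(1)], of b] by (simp add: inner_add_left)
  qed
  have "convex_on UNIV \<phi>"
  proof (rule convex_onI)
    fix t :: real and x y :: "real ^ 2" assume "0 < t" "t < 1"
    then show "\<phi> ((1 - t) *\<^sub>R x + t *\<^sub>R y) \<le> (1 - t) * \<phi> x + t * \<phi> y"
      using sub[of "(1 - t) *\<^sub>R x" "t *\<^sub>R y"] fan_scale[OF assms, of "1 - t" x] fan_scale[OF assms, of t y] by simp
  qed simp
  then have "continuous_on UNIV \<phi>" by (intro convex_on_continuous) auto
  then have "continuous_on (sphere 0 1) \<phi>" using continuous_on_subset by blast
  moreover have "sphere 0 1 \<noteq> ({} :: (real ^ 2) set)" by simp
  ultimately obtain p where p: "p \<in> sphere 0 1" "\<And>x. x \<in> sphere 0 1 \<Longrightarrow> \<phi> p \<le> \<phi> x"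
    using continuous_attains_inf[of "sphere 0 1" \<phi>] by auto
  have "p \<noteq> 0" using p(1) by auto
  then have pp: "\<phi> p > 0" using fan_pos assms by blast
  have "ball 0 (\<phi> p) \<subseteq> body \<phi>"
  proof
    fix y :: "real ^ 2" assume "y \<in> ball 0 (\<phi> p)"
    then have y: "norm y < \<phi> p" by simp
    show "y \<in> body \<phi>"
      unfolding body_iff
    proof
      fix m
      show "- (m \<bullet> y) \<le> \<phi> m"
      proof (cases "m = 0")
        case True
        then show ?thesis using fan_zero[OF assms] by simp
      next
        case False
        have "- (m \<bullet> y) \<le> norm m * norm y" using norm_cauchy_schwarz[of "- m" y] by simp
        also have "\<dots> \<le> norm m * \<phi> p" using y by (intro mult_left_mono) auto
        also have "\<dots> \<le> norm m * \<phi> ((1 / norm m) *\<^sub>R m)" using False by (intro mult_left_mono p(2)) auto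
        also have "\<dots> = \<phi> m" using fan_scale[OF assms, of "1 / norm m" m] False by simp
        finally show ?thesis .
      qed
    qed
  qed
  with pp show thesis by (rule that)
qed

lemma fan_fano_polygon:
  assumes "fan \<phi>"
  shows "fano_polygon (body \<phi>)"
proof -
  obtain V where V: "finite V" "\<And>v. v \<in> V \<Longrightarrow> primitive v" "\<And>v. v \<in> V \<Longrightarrow> lat v \<in> body \<phi>"
      "\<And>m. \<exists>v\<in>V. \<phi> m = - (m \<bullet> lat v)"
    using assms unfolding fan_def by blast
  have hull: "body \<phi> = convex hull (lat ` V)" using V(1,3,4) by (rule fan_body_hull)
  have "polytope (body \<phi>)" unfolding hull using V(1) by (simp add: polytope_convex_hull)
  moreover obtain e where "e > 0" "ball 0 e \<subseteq> body \<phi>" using fan_ball assms by metis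
  then have "0 \<in> interior (body \<phi>)" by (auto simp: mem_interior)
  moreover have "\<exists>v. primitive v \<and> x = lat v" if "x extreme_point_of body \<phi>" for x
    using extreme_point_of_convex_hull[of x "lat ` V"] that V(2) unfolding hull by blast
  ultimately show ?thesis unfolding fano_polygon_def by blast
qed

lemma fano_polygon_fan:
  assumes "fano_polygon P"
  obtains \<phi> where "fan \<phi>" "P = body \<phi>"
proof -
  let ?X = "{x. x extreme_point_of P}"
  define V where "V = {v. lat v extreme_point_of P \<and> primitive v}"
  have P: "polytope P" "0 \<in> interior P" "\<And>x. x extreme_point_of P \<Longrightarrow> \<exists>v. primitive v \<and> x = lat v"
    using assms by (auto simp: fano_polygon_def)
  have latV: "lat ` V = ?X" using P(3) by (auto simp: V_def)
  have "inj lat" by (auto simp: inj_def vec2_eq)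
  moreover have finX: "finite ?X" using P(1) by (intro finite_polyhedron_extreme_points polytope_imp_polyhedron)
  ultimately have finV: "finite V" using latV by (metis finite_imageD inj_on_subset subset_UNIV)
  have hullX: "P = convex hull ?X"
    using Krein_Milman_Minkowski[of P] polytope_imp_compact polytope_imp_convex P(1) by blast
  have "P \<noteq> {}" using P(2) interior_subset by auto
  then have X0: "?X \<noteq> {}" using hullX by auto
  define \<phi> where "\<phi> m = Max ((\<lambda>x. - (m \<bullet> x)) ` ?X)" for m
  have le: "- (m \<bullet> x) \<le> \<phi> m" if "x \<in> ?X" for m x
    unfolding \<phi>_def using finX that by (intro Max_ge) auto
  have att: "\<exists>x\<in>?X. \<phi> m = - (m \<bullet> x)" for m
  proof -
    have "\<phi> m \<in> (\<lambda>x. - (m \<bullet> x)) ` ?X" unfolding \<phi>_def using finX X0 by (intro Max_in) auto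
    then show ?thesis by auto
  qed
  have attV: "\<exists>v\<in>V. \<phi> m = - (m \<bullet> lat v)" for m using att[of m] unfolding latV[symmetric] by blast
  have inb: "lat v \<in> body \<phi>" if "v \<in> V" for v using le that by (auto simp: body_iff V_def)
  have PB: "P = body \<phi>" using fan_body_hull[OF finV inb attV] hullX latV by simp
  have "\<phi> m > 0" if "m \<noteq> 0" for m
  proof -
    obtain e where e: "e > 0" "ball 0 e \<subseteq> P" using P(2) by (auto simp: mem_interior)
    let ?y = "(- (e / (2 * norm m))) *\<^sub>R m"
    have "norm ?y = e / 2" using that e(1) by simp
    then have "?y \<in> ball 0 e" using e(1) by (simp only: mem_ball_0)
    then have "?y \<in> body \<phi>" using e PB by blast
    from bodyD[OF this, of m] have "(e / (2 * norm m)) * (m \<bullet> m) \<le> \<phi> m" by simp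
    moreover have "(e / (2 * norm m)) * (m \<bullet> m) > 0" using that e(1) by simp
    ultimately show ?thesis by linarith
  qed
  moreover have "\<forall>v\<in>V. primitive v \<and> lat v \<in> body \<phi>" using inb by (simp add: V_def)
  ultimately have "fan \<phi>" unfolding fan_def using finV attV by blast
  then show thesis using PB by (rule that)
qed

lemma body_inject:
  assumes "fan \<phi>" "fan \<psi>" "body \<phi> = body \<psi>"
  shows "\<phi> = \<psi>"
proof
  fix m
  obtain v where "lat v \<in> body \<phi>" "\<phi> m = - (m \<bullet> lat v)" using fan_attained assms(1) by metis
  moreover obtain v' where "lat v' \<in> body \<psi>" "\<psi> m = - (m \<bullet> lat v')" using fan_attained assms(2) by metis
  ultimately show "\<phi> m = \<psi> m"
    using bodyD[of "lat v" \<psi> m] bodyD[of "lat v'" \<phi> m] assms(3) by auto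
qed

lemma polar_dual_body:
  assumes "fan \<phi>"
  shows "polar_dual (body \<phi>) = {m. \<phi> m \<le> 1}"
proof safe
  fix m assume "m \<in> polar_dual (body \<phi>)"
  moreover obtain v where "lat v \<in> body \<phi>" "\<phi> m = - (m \<bullet> lat v)" using fan_attained assms by metis
  ultimately show "\<phi> m \<le> 1" by (auto simp: polar_dual_def)
next
  fix m assume "\<phi> m \<le> 1"
  then show "m \<in> polar_dual (body \<phi>)"
    unfolding polar_dual_def using bodyD[of _ \<phi> m] by fastforce
qed

lemma polar_dual_sublevel:
  assumes pos: "\<And>m. m \<noteq> 0 \<Longrightarrow> \<psi> m > 0" and hom: "\<And>c m. c \<ge> 0 \<Longrightarrow> \<psi> (c *\<^sub>R m) = c * \<psi> m"
  shows "polar_dual {m. \<psi> m \<le> 1} = body \<psi>"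
proof safe
  fix y assume y: "y \<in> polar_dual {m. \<psi> m \<le> 1}"
  show "y \<in> body \<psi>"
    unfolding body_iff
  proof
    fix m
    show "- (m \<bullet> y) \<le> \<psi> m"
    proof (cases "m = 0")
      case True
      then show ?thesis using hom[of 0 0] by simp
    next
      case False
      let ?m = "(1 / \<psi> m) *\<^sub>R m"
      have "\<psi> ?m = 1" using hom[of "1 / \<psi> m" m] pos[OF False] by simp
      then have "?m \<in> {m. \<psi> m \<le> 1}" by simp
      then have "y \<bullet> ?m \<ge> -1" using y unfolding polar_dual_def by blast
      then have "-1 \<le> (y \<bullet> m) / \<psi> m" by simp
      then show ?thesis using pos[OF False] by (simp add: pos_le_divide_eq inner_commute)
    qed
  qed
next
  fix y assume y: "y \<in> body \<psi>"
  have "-1 \<le> y \<bullet> m" if "\<psi> m \<le> 1" for m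
    using bodyD[OF y, of m] that by (simp add: inner_commute)
  then show "y \<in> polar_dual {m. \<psi> m \<le> 1}" by (simp add: polar_dual_def)
qed

section \<open>Reduction of arbitrary weights and factors to a primitive weight\<close>

lemma mut_map_inverse:
  assumes "lat w \<bullet> lat f = 0"
  shows "mut_map w f (mut_map (- w) f m) = m" "mut_map (- w) f (mut_map w f m) = m"
proof -
  have n: "lat (- w) = - lat w" by (simp add: vec2_eq)
  show "mut_map w f (mut_map (- w) f m) = m" "mut_map (- w) f (mut_map w f m) = m"
    by (simp_all add: mut_map_def n inner_add_left inner_diff_left assms)
qed

lemma mut_map_image:
  assumes "lat w \<bullet> lat f = 0"
  shows "mut_map w f ` {m. \<phi> m \<le> 1} = {m. (\<phi> \<circ> mut_map (- w) f) m \<le> (1::real)}"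
proof safe
  fix m assume "\<phi> m \<le> 1"
  then show "(\<phi> \<circ> mut_map (- w) f) (mut_map w f m) \<le> 1" by (simp add: mut_map_inverse[OF assms])
next
  fix m assume "(\<phi> \<circ> mut_map (- w) f) m \<le> 1"
  then show "m \<in> mut_map w f ` {m. \<phi> m \<le> 1}"
    by (intro image_eqI[of _ _ "mut_map (- w) f m"]) (simp_all add: mut_map_inverse[OF assms])
qed

definition irot :: "int ^ 2 \<Rightarrow> int ^ 2" where
  "irot w = vector [- (w $ 2), w $ 1]"

lemma irot_nth [simp]: "irot a $ 1 = - (a $ 2)" "irot a $ 2 = a $ 1"
  by (simp_all add: irot_def)

lemma primitive_multiple:
  fixes w :: "int ^ 2"
  assumes "w \<noteq> 0"
  obtains c w0 where "c > 0" "primitive w0" "w = c *s w0"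
proof -
  let ?c = "gcd (w $ 1) (w $ 2)"
  have c: "?c > 0" using assms by (auto simp: vec2_eq gcd_pos_int)
  let ?w = "vector [w $ 1 div ?c, w $ 2 div ?c] :: int ^ 2"
  have "coprime (w $ 1 div ?c) (w $ 2 div ?c)" using assms by (intro div_gcd_coprime) (auto simp: vec2_eq)
  then have "primitive ?w" by (simp add: primitive_def)
  moreover have "w = ?c *s ?w" by (simp add: vec2_eq)
  ultimately show thesis using c by (intro that)
qed

lemma primitive_nonzero: "primitive w \<Longrightarrow> w \<noteq> 0"
  by (auto simp: primitive_def)

lemma primitive_orthogonal:
  fixes w f :: "int ^ 2"
  assumes "primitive w" "w $ 1 * f $ 1 + w $ 2 * f $ 2 = 0"
  obtains d where "f = d *s irot w"
proof -
  have cop: "coprime (w $ 1) (w $ 2)" using assms(1) by (simp add: primitive_def)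
  obtain x y where xy: "w $ 1 * x + w $ 2 * y = 1"
    using bezout_int[of "w $ 1" "w $ 2"] cop by (auto simp: mult.commute)
  \<comment> \<open>The vector with entries \<open>- y, x\<close> pairs to \<open>1\<close> with
    \<open>irot w\<close>, so its pairing with \<open>f\<close> is the only possible
    coefficient.\<close>
  define d where "d = x * f $ 2 - y * f $ 1"
  have "f $ 1 = (w $ 1 * x + w $ 2 * y) * f $ 1" "f $ 2 = (w $ 1 * x + w $ 2 * y) * f $ 2"
    using xy by simp_all
  then have "f $ 1 = x * (w $ 1 * f $ 1 + w $ 2 * f $ 2) - d * w $ 2"
      "f $ 2 = y * (w $ 1 * f $ 1 + w $ 2 * f $ 2) + d * w $ 1"
    by (simp_all add: d_def algebra_simps)
  then have "f $ 1 = - d * w $ 2" "f $ 2 = d * w $ 1" unfolding assms(2) by simp_all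
  then have "f = d *s irot w" by (simp add: vec2_eq)
  then show thesis by (rule that)
qed

text \<open>The transvection fixing \<open>w\<close>: the linear map with which
  \<open>tau (lat w) (- k)\<close> agrees on the half-plane
  \<open>cross (lat w) m \<ge> 0\<close>.\<close>

definition shear :: "int ^ 2 \<Rightarrow> int \<Rightarrow> int ^ 2 ^ 2" where
  "shear w k = mat2 (1 - k * w $ 1 * w $ 2) (k * w $ 1 * w $ 1) (- k * w $ 2 * w $ 2) (1 + k * w $ 1 * w $ 2)"

lemma act_shear: "act (shear w k) m = m + (of_int k * cross (lat w) m) *\<^sub>R lat w"
  by (simp add: vec2_eq shear_def cross_def algebra_simps)

lemma unimodular_shear [simp]: "unimodular (shear w k)"
  by (simp add: shear_def unimodular_mat2 algebra_simps)

lemma max_0_mult: "c \<ge> 0 \<Longrightarrow> max 0 (c * x) = c * max 0 (x :: real)"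
  by (simp add: max_mult_distrib_left)

text \<open>Reversing the sign of the factor changes the mutation by a shear only.\<close>

lemma mut_map_tau:
  fixes w f :: "int ^ 2"
  assumes "w \<noteq> 0" "f \<noteq> 0" "lat w \<bullet> lat f = 0"
  obtains w0 k A where "primitive w0" "k \<ge> (1::nat)" "unimodular A"
    "mut_map (- w) f = tau (lat w0) (real k) \<circ> act A"
proof -
  obtain c w0 where c: "c > 0" "primitive w0" "w = c *s w0" using primitive_multiple assms(1) by blast
  have "real_of_int c * real_of_int (w0 $ 1 * f $ 1 + w0 $ 2 * f $ 2) = 0"
    using assms(3) by (simp add: c(3) inner2 algebra_simps)
  then have "w0 $ 1 * f $ 1 + w0 $ 2 * f $ 2 = 0" using c(1) by (simp del: of_int_add of_int_mult)
  then obtain d where d: "f = d *s irot w0" using primitive_orthogonal c(2) by blast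
  have d0: "d \<noteq> 0" using assms(2) d by (auto simp: vec2_eq)
  let ?w = "lat w0"
  have lw: "lat (- w) = (- of_int c) *\<^sub>R ?w" by (simp add: c(3) vec2_eq)
  have lf: "m \<bullet> lat f = of_int d * cross ?w m" for m by (simp add: d inner2 cross_def algebra_simps)
  have mm: "mut_map (- w) f m = m - (of_int c * max 0 (of_int d * cross ?w m)) *\<^sub>R ?w" for m
    by (simp add: mut_map_def lw lf)
  show thesis
  proof (cases "d > 0")
    case True
    let ?k = "nat (c * d)"
    have k: "real ?k = of_int c * of_int d" using True c(1) by simp
    have "mut_map (- w) f = tau ?w (real ?k) \<circ> act (mat 1)"
      using True unfolding fun_eq_iff mm k tau_def by (simp add: max_0_mult mult.assoc)
    moreover have "?k \<ge> 1" using True c(1) by (simp add: nat_le_iff Suc_le_eq)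
    ultimately show thesis using that c(2) unimodular_mat by blast
  next
    case False
    then have d: "d < 0" using d0 by simp
    let ?k = "nat (c * - d)"
    have k: "real ?k = of_int c * - of_int d" using d c(1) by (simp add: mult_nonneg_nonpos mult_less_0_iff)
    have "mut_map (- w) f = tau ?w (real ?k) \<circ> act (shear w0 (c * - d))"
    proof
      fix m
      \<comment> \<open>The identity \<open>max 0 (- x) = max 0 x - x\<close> moves the break to the
        standard side at the cost of a linear term, which becomes the shear.\<close>
      have key: "max 0 (of_int d * x) = - of_int d * max 0 x - (- of_int d) * x" for x :: real
      proof -
        have "max 0 (of_int d * x) = max 0 ((- of_int d) * - x)" by simp
        also have "\<dots> = (- of_int d) * max 0 (- x)" using d by (intro max_0_mult) simp
        also have "max 0 (- x) = max 0 x - x" by simp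
        finally show ?thesis by (simp add: algebra_simps)
      qed
      then show "mut_map (- w) f m = (tau ?w (real ?k) \<circ> act (shear w0 (c * - d))) m"
        unfolding o_apply mm tau_def act_shear k key by (simp add: algebra_simps)
    qed
    moreover have "?k \<ge> 1" using d c(1) by (simp add: Suc_le_eq mult_less_0_iff)
    ultimately show thesis using that c(2) unimodular_shear by blast
  qed
qed

section \<open>Mutation steps\<close>

lemma cross_lat: "cross (lat a) (lat b) = of_int (wedge a b)"
  by (simp add: cross_def wedge_def)

lemma lat_simps [simp]: "lat 0 = 0" "lat (- v) = - lat v" "lat (a + b) = lat a + lat b" "lat (c *s v) = of_int c *\<^sub>R lat v"
  by (simp_all add: vec2_eq)

lemma lat_eq_0_iff [simp]: "lat v = 0 \<longleftrightarrow> v = 0"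
  by (simp add: vec2_eq)

lemma lat_inject [simp]: "lat v = lat u \<longleftrightarrow> v = u"
  by (simp add: vec2_eq)

lemma primitive_uminus [simp]: "primitive (- w) \<longleftrightarrow> primitive w"
  by (simp add: primitive_def)

text \<open>A vertex that is extreme for a direction on one side of the wall stays, one extreme for
  a direction on the other side is sheared. The candidates are therefore \<open>V\<close> and its
  sheared copy, as far as they lie in the new polygon; an integral shear preserves
  primitivity.\<close>

lemma fan_tau:
  fixes w :: "int ^ 2" and k :: nat
  assumes fan: "fan \<phi>" and w: "w \<noteq> 0" and node_mult: "mult_ge \<phi> (lat w) (real k)"
  shows "fan (\<phi> \<circ> tau (lat w) (real k))"
proof -
  let ?w = "lat w" and ?k = "real k" and ?\<psi> = "\<phi> \<circ> tau (lat w) (real k)"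
  have w0: "?w \<noteq> 0" using w by (simp add: vec2_eq)
  interpret mutation_data \<phi> ?w ?k
    using fan_zero_body fan_pos fan w0 node_mult by unfold_locales auto
  obtain V where V: "finite V" "\<And>v. v \<in> V \<Longrightarrow> primitive v" "\<And>v. v \<in> V \<Longrightarrow> lat v \<in> body \<phi>"
      "\<And>m. \<exists>v\<in>V. \<phi> m = - (m \<bullet> lat v)"
    using fan unfolding fan_def by blast
  \<comment> \<open>The transformation of \<open>N\<close> dual to the linear part of
    \<open>tau\<close> on the half-plane \<open>cross ?w m > 0\<close>.\<close>
  define sh where "sh = (*v) (shear (irot w) (int k))"
  have lat_sh: "lat (sh v) = lat v - (?k * (?w \<bullet> lat v)) *\<^sub>R rot ?w" for v
    unfolding sh_def lat_mv act_shear by (simp add: vec2_eq cross_def inner2 algebra_simps)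
  have prim_sh: "primitive (sh v)" if "primitive v" for v
    unfolding sh_def using that by simp
  let ?V = "{u \<in> V \<union> sh ` V. lat u \<in> body ?\<psi>}"
  have finV: "finite ?V" using V(1) by simp
  have neg: "\<exists>v\<in>?V. ?\<psi> m = - (m \<bullet> lat v)" if "cross ?w m < 0" for m
  proof -
    obtain v where v: "v \<in> V" "\<phi> m = - (m \<bullet> lat v)" using V(4) by blast
    then have "lat v \<in> body ?\<psi>" using body_tau_neg V(3) that by blast
    then show ?thesis using v that by (intro bexI[of _ v]) (auto simp: tau_id)
  qed
  have "\<exists>v\<in>?V. ?\<psi> m = - (m \<bullet> lat v)" for m
  proof -
    consider "cross ?w m < 0" | "cross ?w m > 0" | "cross ?w m = 0" by linarith
    then show ?thesis
    proof cases
      case 1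
      then show ?thesis by (rule neg)
    next
      case 2
      let ?n = "tau ?w ?k m"
      obtain v where v: "v \<in> V" "\<phi> ?n = - (?n \<bullet> lat v)" using V(4) by blast
      then have "lat (sh v) \<in> body ?\<psi>"
        unfolding lat_sh using body_tau_pos V(3) 2 by simp
      moreover have "?n \<bullet> lat v = m \<bullet> lat (sh v)"
        using 2 by (simp add: lat_sh tau_shear inner_diff_left inner_diff_right inner_rot)
      ultimately show ?thesis using v by (intro bexI[of _ "sh v"]) auto
    next
      case 3
      text \<open>On the wall, approximate by points where \<open>neg\<close> applies.\<close>
      obtain v0 where v0: "v0 \<in> V" "\<phi> m = - (m \<bullet> lat v0)" using V(4) by blast
      show ?thesis
      proof (rule ccontr)
        assume no: "\<not> ?thesis"
        have \<psi>m: "?\<psi> m = \<phi> m" using 3 by (simp add: tau_id)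
        let ?m = "\<lambda>\<epsilon>. m - \<epsilon> *\<^sub>R rot ?w"
        have "\<forall>\<^sub>F \<epsilon> in at_right 0. - (?m \<epsilon> \<bullet> lat v) < - (?m \<epsilon> \<bullet> lat v0)" if "v \<in> ?V" for v
        proof -
          have "- (m \<bullet> lat v) \<le> ?\<psi> m" using that bodyD by blast
          moreover have "?\<psi> m \<noteq> - (m \<bullet> lat v)" using no that by blast
          ultimately have lt: "- (m \<bullet> lat v) + m \<bullet> lat v0 < 0" using v0(2) \<psi>m by linarith
          have "((\<lambda>\<epsilon>. - (?m \<epsilon> \<bullet> lat v) + ?m \<epsilon> \<bullet> lat v0) \<longlongrightarrow> - (?m 0 \<bullet> lat v) + ?m 0 \<bullet> lat v0) (at_right 0)"
            by (intro tendsto_intros)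
          then have "\<forall>\<^sub>F \<epsilon> in at_right 0. - (?m \<epsilon> \<bullet> lat v) + ?m \<epsilon> \<bullet> lat v0 < 0"
            using lt by (intro order_tendstoD(2)) auto
          then show ?thesis by eventually_elim simp
        qed
        then have "\<forall>\<^sub>F \<epsilon> in at_right 0. \<forall>v\<in>?V. - (?m \<epsilon> \<bullet> lat v) < - (?m \<epsilon> \<bullet> lat v0)"
          by (intro eventually_ball_finite finV) blast
        moreover have "\<forall>\<^sub>F \<epsilon> in at_right (0::real). \<epsilon> > 0" by (rule eventually_at_right_less)
        ultimately have "\<forall>\<^sub>F \<epsilon> in at_right (0::real). False"
        proof eventually_elim
          case (elim \<epsilon>)
          have "cross ?w (rot ?w) > 0"
            using w0 inner_rot[of "rot ?w" ?w] inner_gt_zero_iff[of "rot ?w"] by (auto simp: vec2_eq)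
          then have c: "cross ?w (?m \<epsilon>) < 0" using elim(2) 3 by simp
          then obtain v where v: "v \<in> ?V" "?\<psi> (?m \<epsilon>) = - (?m \<epsilon> \<bullet> lat v)" using neg by blast
          have "?\<psi> (?m \<epsilon>) = \<phi> (?m \<epsilon>)" using c by (simp add: tau_id)
          moreover have "\<phi> (?m \<epsilon>) \<ge> - (?m \<epsilon> \<bullet> lat v0)" using V(3) v0(1) bodyD by blast
          moreover have "- (?m \<epsilon> \<bullet> lat v) < - (?m \<epsilon> \<bullet> lat v0)" using elim(1) v(1) by (rule bspec)
          ultimately show False using v(2) by linarith
        qed
        then show False by (simp add: trivial_limit_at_right_real)
      qed
    qed
  qed
  moreover have "\<forall>v\<in>?V. primitive v \<and> lat v \<in> body ?\<psi>" using V(2) prim_sh by blast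
  ultimately show ?thesis
    unfolding fan_def using finV fan_tau_pos[OF fan] by blast
qed

text \<open>Both maps break along the same line and the breaks cancel. Mutating at \<open>w\<close>
  and then at \<open>- w\<close> is thus a change of basis, which makes mutation reversible up to
  \<open>GL(2, Z)\<close>.\<close>

lemma tau_tau_uminus: "tau (lat w) (real k) \<circ> tau (- lat w) (real k) = act (shear w (- int k))"
proof
  fix m
  have m: "max 0 (- c) = max 0 c - c" for c :: real by simp
  show "(tau (lat w) (real k) \<circ> tau (- lat w) (real k)) m = act (shear w (- int k)) m"
    by (simp add: tau_def act_shear m algebra_simps)
qed

text \<open>The inverse of \<open>tau (lat w) (real k)\<close> on lattice vectors: the mutated
  support function has at \<open>mutate w k u\<close> the height that the old one has at
  \<open>u\<close>.\<close>

definition mutate :: "int ^ 2 \<Rightarrow> nat \<Rightarrow> int ^ 2 \<Rightarrow> int ^ 2" where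
  "mutate w k u = u + (int k * max 0 (wedge w u)) *s w"

lemma lat_mutate: "lat (mutate w k u) = lat u + (real k * max 0 (cross (lat w) (lat u))) *\<^sub>R lat w"
  by (simp add: mutate_def cross_lat of_int_max)

abbreviation mutated :: "(real ^ 2 \<Rightarrow> real) \<Rightarrow> int ^ 2 \<Rightarrow> nat \<Rightarrow> real ^ 2 \<Rightarrow> real" where
  "mutated \<phi> w k \<equiv> \<phi> \<circ> tau (lat w) (real k)"

context
  fixes \<phi> :: "real ^ 2 \<Rightarrow> real" and w :: "int ^ 2" and k :: nat
  assumes fan: "fan \<phi>" and prim: "primitive w" and k: "k \<le> node_mult \<phi> (lat w)"
begin

lemma w_nonzero: "w \<noteq> 0" "lat w \<noteq> 0" "- lat w \<noteq> 0"
  using primitive_nonzero[OF prim] by auto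

lemma mult_ge_k: "mult_ge \<phi> (lat w) (real k)"
  using k le_mult_iff[OF fan w_nonzero(2)] by simp

lemma fan_mutation: "fan (mutated \<phi> w k)"
  using fan_tau fan w_nonzero(1) mult_ge_k by blast

lemma mutation_data_forward: "mutation_data \<phi> (lat w) (real k)"
  using fan fan_zero_body fan_pos w_nonzero mult_ge_k by unfold_locales auto

lemma mult_opposite_ge: "node_mult \<phi> (- lat w) + k \<le> node_mult (mutated \<phi> w k) (- lat w)"
proof -
  have "mult_ge \<phi> (- lat w) (real (node_mult \<phi> (- lat w)))"
    using le_mult_iff[OF fan w_nonzero(3)] by blast
  then have "mult_ge (mutated \<phi> w k) (- lat w) (real (node_mult \<phi> (- lat w) + k))"
    using mutation_data.mult_ge_opposite[OF mutation_data_forward] fan_nonneg[OF fan] by simp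
  then show ?thesis using le_mult_iff[OF fan_mutation w_nonzero(3)] by blast
qed

lemma mult_same_ge: "node_mult \<phi> (lat w) - k \<le> node_mult (mutated \<phi> w k) (lat w)"
proof -
  have "mult_ge \<phi> (lat w) (real (node_mult \<phi> (lat w)))"
    using le_mult_iff[OF fan w_nonzero(2)] by blast
  then have "mult_ge (mutated \<phi> w k) (lat w) (real (node_mult \<phi> (lat w)) - real k)"
    using mutation_data.mult_ge_same[OF mutation_data_forward] k by simp
  then show ?thesis using le_mult_iff[OF fan_mutation w_nonzero(2)] k by (metis of_nat_diff)
qed

lemma mutate_nonzero:
  assumes "wedge w u \<noteq> 0"
  shows "lat (mutate w k u) \<noteq> 0" "lat u \<noteq> 0"
proof -
  have "wedge w (mutate w k u) = wedge w u" by (simp add: mutate_def wedge_def algebra_simps)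
  then have "mutate w k u \<noteq> 0" "u \<noteq> 0" using assms by (auto simp: wedge_def)
  then show "lat (mutate w k u) \<noteq> 0" "lat u \<noteq> 0" by auto
qed

lemma mult_other_ge:
  assumes "wedge w u \<noteq> 0"
  shows "node_mult \<phi> (lat u) \<le> node_mult (mutated \<phi> w k) (lat (mutate w k u))"
proof -
  have "mult_ge \<phi> (lat u) (real (node_mult \<phi> (lat u)))"
    using le_mult_iff[OF fan mutate_nonzero(2)[OF assms]] by blast
  then have "mult_ge (mutated \<phi> w k) (lat (mutate w k u)) (real (node_mult \<phi> (lat u)))"
    unfolding lat_mutate by (rule mutation_data.mult_ge_other[OF mutation_data_forward]) (simp add: cross_lat assms)
  then show ?thesis using le_mult_iff[OF fan_mutation mutate_nonzero(1)[OF assms]] by blast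
qed

lemma k_le_opposite: "k \<le> node_mult (mutated \<phi> w k) (lat (- w))"
  using mult_opposite_ge by simp

lemma mutation_back: "mutated \<phi> w k \<circ> tau (lat (- w)) (real k) = \<phi> \<circ> act (shear w (- int k))"
  using tau_tau_uminus[of w k] by (simp add: comp_assoc)

end

context
  fixes \<phi> :: "real ^ 2 \<Rightarrow> real" and w :: "int ^ 2" and k :: nat
  assumes fan: "fan \<phi>" and prim: "primitive w" and k: "k \<le> node_mult \<phi> (lat w)"
begin

lemmas backward = fan_mutation[OF fan prim k] primitive_uminus[THEN iffD2, OF prim] k_le_opposite[OF fan prim k]

lemma mult_back: "node_mult (mutated \<phi> w k \<circ> tau (lat (- w)) (real k)) u = node_mult \<phi> (u - (real k * cross (lat w) u) *\<^sub>R lat w)"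
  unfolding mutation_back[OF fan prim k] by (simp add: mult_act act_shear)

text \<open>Only lower bounds are transported directly. The upper bound is the same transport
  applied to the mutation back at \<open>- w\<close>, which returns \<open>\<phi>\<close> up to a
  shear that fixes \<open>w\<close>; \<open>mult_same\<close> and \<open>mult_other\<close> are
  obtained likewise.\<close>

lemma mult_opposite: "node_mult (mutated \<phi> w k) (- lat w) = node_mult \<phi> (- lat w) + k"
  using mult_opposite_ge[OF fan prim k] mult_same_ge[OF backward, unfolded mult_back] by simp

lemma mult_same: "node_mult (mutated \<phi> w k) (lat w) = node_mult \<phi> (lat w) - k"
  using mult_same_ge[OF fan prim k] mult_opposite_ge[OF backward, unfolded mult_back] by simp

lemma mult_other:
  assumes "wedge w u \<noteq> 0"
  shows "node_mult (mutated \<phi> w k) (lat (mutate w k u)) = node_mult \<phi> (lat u)"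
proof (rule antisym)
  let ?u = "mutate w k u"
  have w: "wedge w ?u = wedge w u" by (simp add: mutate_def wedge_def algebra_simps)
  then have "wedge (- w) ?u \<noteq> 0" using assms by (simp add: wedge_def)
  from mult_other_ge[OF backward this, unfolded mult_back]
  have *: "node_mult (mutated \<phi> w k) (lat ?u)
      \<le> node_mult \<phi> (lat (mutate (- w) k ?u) - (real k * cross (lat w) (lat (mutate (- w) k ?u))) *\<^sub>R lat w)" .
  have m: "max 0 (- c) = max 0 c - c" for c :: int by simp
  have wm: "wedge (- w) ?u = - wedge w u" using w by (simp add: wedge_def)
  \<comment> \<open>Going forth and back yields not \<open>u\<close> but a shear of it, the one that
    is undone in \<open>mult_back\<close>.\<close>
  have "mutate (- w) k ?u = u + (int k * wedge w u) *s w"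
    unfolding mutate_def[of "- w"] wm m by (simp add: mutate_def vec2_eq algebra_simps)
  then have "lat (mutate (- w) k ?u) - (real k * cross (lat w) (lat (mutate (- w) k ?u))) *\<^sub>R lat w = lat u"
    by (simp add: cross_lat)
  with * show "node_mult (mutated \<phi> w k) (lat ?u) \<le> node_mult \<phi> (lat u)" by simp
  show "node_mult \<phi> (lat u) \<le> node_mult (mutated \<phi> w k) (lat ?u)" by (rule mult_other_ge[OF fan prim k assms])
qed

end

section \<open>Moves on support functions and their agreement with polygon mutations\<close>

definition fstep :: "(real ^ 2 \<Rightarrow> real) \<Rightarrow> (real ^ 2 \<Rightarrow> real) \<Rightarrow> bool" where
  "fstep \<phi> \<psi> \<longleftrightarrow>
     (\<exists>w k. primitive w \<and> k \<le> node_mult \<phi> (lat w) \<and> \<psi> = \<phi> \<circ> tau (lat w) (real k)) \<or>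
     (\<exists>A. unimodular A \<and> \<psi> = \<phi> \<circ> act A)"

lemma fstep_tau: "primitive w \<Longrightarrow> k \<le> node_mult \<phi> (lat w) \<Longrightarrow> fstep \<phi> (\<phi> \<circ> tau (lat w) (real k))"
  unfolding fstep_def by blast

lemma fstep_act: "unimodular A \<Longrightarrow> fstep \<phi> (\<phi> \<circ> act A)"
  unfolding fstep_def by blast

lemma fan_fstep: "fstep \<phi> \<psi> \<Longrightarrow> fan \<phi> \<Longrightarrow> fan \<psi>"
  unfolding fstep_def using fan_mutation fan_act by blast

lemma fan_fsteps: "fstep\<^sup>*\<^sup>* \<phi> \<psi> \<Longrightarrow> fan \<phi> \<Longrightarrow> fan \<psi>"
  by (induction rule: rtranclp_induct) (auto intro: fan_fstep)

lemma fstep_sym: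
  assumes "fstep \<phi> \<psi>" "fan \<phi>"
  shows "fstep\<^sup>*\<^sup>* \<psi> \<phi>"
proof -
  from assms(1) consider
      (tau) w k where "primitive w" "k \<le> node_mult \<phi> (lat w)" "\<psi> = \<phi> \<circ> tau (lat w) (real k)"
    | (act) A where "unimodular A" "\<psi> = \<phi> \<circ> act A"
    unfolding fstep_def by blast
  then show ?thesis
  proof cases
    case (tau w k)
    note w = tau(1,2) and \<psi> = tau(3)
    let ?\<xi> = "\<phi> \<circ> act (shear w (- int k))"
    have "fstep \<psi> (\<psi> \<circ> tau (lat (- w)) (real k))"
      using k_le_opposite[OF assms(2) w] w(1) unfolding \<psi> by (intro fstep_tau) auto
    moreover have "\<psi> \<circ> tau (lat (- w)) (real k) = ?\<xi>"
      unfolding \<psi> by (rule mutation_back[OF assms(2) w])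
    moreover have "fstep ?\<xi> (?\<xi> \<circ> act (inv2 (shear w (- int k))))" by (intro fstep_act) simp
    moreover have "?\<xi> \<circ> act (inv2 (shear w (- int k))) = \<phi>" by (intro act_comp_inv2) simp
    ultimately show ?thesis by (metis converse_rtranclp_into_rtranclp rtranclp.rtrancl_refl)
  next
    case (act A)
    note A = act
    have "fstep \<psi> (\<psi> \<circ> act (inv2 A))" using A by (intro fstep_act) simp
    then show ?thesis using A by (simp add: act_comp_inv2)
  qed
qed

lemma fsteps_sym:
  assumes "fstep\<^sup>*\<^sup>* \<phi> \<psi>" "fan \<phi>"
  shows "fstep\<^sup>*\<^sup>* \<psi> \<phi>"
  using assms(1)
proof (induction rule: rtranclp_induct)
  case (step \<psi> \<xi>)
  have "fstep\<^sup>*\<^sup>* \<xi> \<psi>" using fstep_sym[OF step(2)] fan_fsteps[OF step(1) assms(2)] .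
  then show ?case using step.IH by (rule rtranclp_trans)
qed simp

lemma act_image_eq: "(\<lambda>x. (\<chi> i j. of_int (A $ i $ j)) *v x) ` P = act A ` P"
  by (simp add: rmat_def)

lemma GL_equivalent_iff: "GL_equivalent P P' \<longleftrightarrow> (\<exists>A. unimodular A \<and> P' = act A ` P)"
  unfolding GL_equivalent_def act_image_eq invertible_iff_unimodular ..

lemma GL_equivalent_body: "GL_equivalent (body \<phi>) P' \<longleftrightarrow> (\<exists>A. unimodular A \<and> P' = body (\<phi> \<circ> act A))"
  unfolding GL_equivalent_iff
  by (metis body_act_image unimodular_transpose transpose_transpose)

lemma convex_polar_dual: "convex (polar_dual P)"
proof -
  have "polar_dual P = (\<Inter>v\<in>P. {m. m \<bullet> v \<ge> -1})" by (auto simp: polar_dual_def)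
  moreover have "convex {m. m \<bullet> v \<ge> -1}" for v :: "real ^ 2"
    using convex_halfspace_ge[where a = v and b = "-1"] by (simp add: inner_commute)
  ultimately show ?thesis by (simp add: convex_INT)
qed

lemma fstep_polygon_step:
  assumes "fstep \<phi> \<psi>" "fan \<phi>"
  shows "polygon_step (body \<phi>) (body \<psi>)"
proof -
  from assms(1) consider
      (tau) w k where "primitive w" "k \<le> node_mult \<phi> (lat w)" "\<psi> = \<phi> \<circ> tau (lat w) (real k)"
    | (act) A where "unimodular A" "\<psi> = \<phi> \<circ> act A"
    unfolding fstep_def by blast
  then show ?thesis
  proof cases
    case (tau w k)
    note w = tau(1,2) and \<psi> = tau(3)
    have fan: "fan \<psi>" using fan_mutation[OF assms(2) w] \<psi> by simp
    let ?w = "int k *s w" and ?f = "irot w"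
    have f: "m \<bullet> lat ?f = cross (lat w) m" for m by (simp add: inner2 cross_def)
    have 0: "lat ?w \<bullet> lat ?f = 0" by (simp add: f)
    have "mut_map (- ?w) ?f = tau (lat w) (real k)"
      by (auto simp: mut_map_def f tau_def)
    then have im: "mut_map ?w ?f ` polar_dual (body \<phi>) = {m. \<psi> m \<le> 1}"
      unfolding polar_dual_body[OF assms(2)] \<psi> by (simp only: mut_map_image[OF 0])
    then have im': "mut_map ?w ?f ` polar_dual (body \<phi>) = polar_dual (body \<psi>)"
      by (simp only: polar_dual_body[OF fan])
    have "admits_mutation (body \<phi>) ?w ?f"
      unfolding admits_mutation_def im' using 0 convex_polar_dual by blast
    moreover have "polygon_mutation ?w ?f (body \<phi>) = body \<psi>"
      unfolding polygon_mutation_def im using fan_pos[OF fan] fan_scale[OF fan] by (rule polar_dual_sublevel)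
    ultimately show ?thesis unfolding polygon_step_def by metis
  next
    case (act A)
    then show ?thesis unfolding polygon_step_def GL_equivalent_body by blast
  qed
qed

lemma polygon_step_fstep:
  assumes "polygon_step (body \<phi>) P'" "fan \<phi>"
  obtains \<psi> where "fstep\<^sup>*\<^sup>* \<phi> \<psi>" "P' = body \<psi>"
proof -
  from assms(1) consider
      (mut) w f where "admits_mutation (body \<phi>) w f" "P' = polygon_mutation w f (body \<phi>)"
    | (GL) "GL_equivalent (body \<phi>) P'"
    unfolding polygon_step_def by blast
  then show thesis
  proof cases
    case GL
    then show thesis using that fstep_act unfolding GL_equivalent_body by blast
  next
    case mut
    have 0: "lat w \<bullet> lat f = 0" using mut(1) by (simp add: admits_mutation_def)
    have im: "mut_map w f ` polar_dual (body \<phi>) = {m. (\<phi> \<circ> mut_map (- w) f) m \<le> 1}"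
      unfolding polar_dual_body[OF assms(2)] by (rule mut_map_image[OF 0])
    show thesis
    \<comment> \<open>The definition of a mutation allows a zero weight or factor; such a mutation
      changes nothing and has no primitive direction.\<close>
    proof (cases "w = 0 \<or> f = 0")
      case True
      then have "mut_map (- w) f = id" by (auto simp: mut_map_def fun_eq_iff)
      then have "P' = body \<phi>"
        unfolding mut(2) polygon_mutation_def im
        using polar_dual_sublevel[OF fan_pos[OF assms(2)] fan_scale[OF assms(2)]] by simp
      then show thesis using that by blast
    next
      case False
      then obtain w0 k A where A: "primitive w0" "k \<ge> (1::nat)" "unimodular A"
          "mut_map (- w) f = tau (lat w0) (real k) \<circ> act A"
        using mut_map_tau 0 by blast
      let ?\<xi> = "\<phi> \<circ> tau (lat w0) (real k)"
      have w0: "lat w0 \<noteq> 0" using primitive_nonzero A(1) by simp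
      \<comment> \<open>The linear part \<open>A\<close> is split off so that convexity is known for
        a set to which \<open>convex_imp_mult_ge\<close> applies.\<close>
      have "{m. ?\<xi> m \<le> 1} = act A ` {m. (\<phi> \<circ> mut_map (- w) f) m \<le> 1}"
      proof safe
        fix m assume "?\<xi> m \<le> 1"
        then show "m \<in> act A ` {m. (\<phi> \<circ> mut_map (- w) f) m \<le> 1}"
          by (intro image_eqI[of _ _ "act (inv2 A) m"]) (simp_all add: A)
      qed (simp add: A)
      moreover have "convex {m. (\<phi> \<circ> mut_map (- w) f) m \<le> 1}"
        using mut(1) unfolding admits_mutation_def im by blast
      ultimately have "convex {m. ?\<xi> m \<le> 1}"
        by (simp add: convex_linear_image del: o_apply)
      then have "mult_ge \<phi> (lat w0) (real k)"
        by (intro convex_imp_mult_ge assms(2) w0) auto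
      then have k: "k \<le> node_mult \<phi> (lat w0)" using le_mult_iff assms(2) w0 by blast
      let ?\<psi> = "?\<xi> \<circ> act A"
      have "fstep \<phi> ?\<xi>" using A(1) k by (rule fstep_tau)
      moreover have "fstep ?\<xi> ?\<psi>" using A(3) by (rule fstep_act)
      ultimately have steps: "fstep\<^sup>*\<^sup>* \<phi> ?\<psi>" by simp
      have fan: "fan ?\<psi>" using fan_fsteps[OF steps assms(2)] .
      have "P' = body ?\<psi>"
        unfolding mut(2) polygon_mutation_def im A(4) comp_assoc[symmetric]
        using fan_pos[OF fan] fan_scale[OF fan] by (rule polar_dual_sublevel)
      with steps show thesis by (rule that)
    qed
  qed
qed

lemma polygon_mutation_equivalent_body:
  assumes "fan \<phi>"
  shows "polygon_mutation_equivalent (body \<phi>) P' \<longleftrightarrow> (\<exists>\<psi>. fstep\<^sup>*\<^sup>* \<phi> \<psi> \<and> P' = body \<psi>)"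
proof
  assume "polygon_mutation_equivalent (body \<phi>) P'"
  then show "\<exists>\<psi>. fstep\<^sup>*\<^sup>* \<phi> \<psi> \<and> P' = body \<psi>"
    unfolding polygon_mutation_equivalent_def
  proof (induction rule: rtranclp_induct)
    case (step P1 P2)
    then obtain \<psi> where \<psi>: "fstep\<^sup>*\<^sup>* \<phi> \<psi>" "P1 = body \<psi>" by blast
    obtain \<xi> where "fstep\<^sup>*\<^sup>* \<psi> \<xi>" "P2 = body \<xi>"
      using polygon_step_fstep[of \<psi> P2] step(2) \<psi> fan_fsteps assms by blast
    then show ?case using rtranclp_trans[OF \<psi>(1)] by blast
  qed auto
next
  assume "\<exists>\<psi>. fstep\<^sup>*\<^sup>* \<phi> \<psi> \<and> P' = body \<psi>"
  then obtain \<psi> where \<psi>: "fstep\<^sup>*\<^sup>* \<phi> \<psi>" "P' = body \<psi>" by blast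
  from \<psi>(1) have "polygon_step\<^sup>*\<^sup>* (body \<phi>) (body \<psi>)"
  proof (induction rule: rtranclp_induct)
    case (step \<xi> \<xi>')
    then have "polygon_step (body \<xi>) (body \<xi>')" using fstep_polygon_step fan_fsteps assms by blast
    with step.IH show ?case by simp
  qed simp
  then show "polygon_mutation_equivalent (body \<phi>) P'" by (simp add: polygon_mutation_equivalent_def \<psi>(2))
qed

text \<open>Members of \<open>\<Phi>\<close> may be unreachable, so any finite list of candidates
  that covers the mutation class proves finiteness.\<close>

definition fin_type :: "(real ^ 2 \<Rightarrow> real) \<Rightarrow> bool" where
  "fin_type \<phi> \<longleftrightarrow>
     (\<exists>\<Phi>. finite \<Phi> \<and> (\<forall>\<psi>. fstep\<^sup>*\<^sup>* \<phi> \<psi> \<longrightarrow> (\<exists>\<xi>\<in>\<Phi>. \<exists>A. unimodular A \<and> \<psi> = \<xi> \<circ> act A)))"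

lemma finite_mutation_type_iff:
  assumes "fan \<phi>"
  shows "finite_mutation_type (body \<phi>) \<longleftrightarrow> fin_type \<phi>"
proof -
  let ?S = "{P'. fano_polygon P' \<and> polygon_mutation_equivalent (body \<phi>) P'}"
  let ?R = "{(P', P''). GL_equivalent P' P''}"
  have S: "?S = {body \<psi> | \<psi>. fstep\<^sup>*\<^sup>* \<phi> \<psi>}"
    unfolding polygon_mutation_equivalent_body[OF assms]
    using fan_fsteps[OF _ assms] fan_fano_polygon by auto
  have cls: "?R `` {body \<psi>} = {body (\<psi> \<circ> act A) | A. unimodular A}" for \<psi>
    using GL_equivalent_body by blast
  show ?thesis
    unfolding finite_mutation_type_def fin_type_def
  proof
    assume fin: "finite (?S // ?R)"
    define r where "r c = (SOME \<xi>. fan \<xi> \<and> body \<xi> \<in> c)" for c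
    show "\<exists>\<Phi>. finite \<Phi> \<and> (\<forall>\<psi>. fstep\<^sup>*\<^sup>* \<phi> \<psi> \<longrightarrow> (\<exists>\<xi>\<in>\<Phi>. \<exists>A. unimodular A \<and> \<psi> = \<xi> \<circ> act A))"
    proof (intro exI[of _ "r ` (?S // ?R)"] conjI allI impI)
      show "finite (r ` (?S // ?R))" using fin by simp
      fix \<psi> assume \<psi>: "fstep\<^sup>*\<^sup>* \<phi> \<psi>"
      have fan: "fan \<psi>" using fan_fsteps \<psi> assms by blast
      let ?c = "?R `` {body \<psi>}"
      have "?c \<in> ?S // ?R" unfolding S using \<psi> by (intro quotientI) blast
      moreover have "body (\<psi> \<circ> act (mat 1)) \<in> ?c" unfolding cls using unimodular_mat by blast
      then have "fan \<psi> \<and> body \<psi> \<in> ?c" using fan by (simp add: comp_def)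
      then have "fan (r ?c) \<and> body (r ?c) \<in> ?c"
        unfolding r_def by (rule someI[where P = "\<lambda>\<xi>. fan \<xi> \<and> body \<xi> \<in> ?c"])
      then have r: "fan (r ?c)" "body (r ?c) \<in> ?c" by blast+
      then obtain A where A: "unimodular A" "body (r ?c) = body (\<psi> \<circ> act A)" unfolding cls by blast
      then have "r ?c = \<psi> \<circ> act A" using body_inject r(1) fan_act fan by blast
      then have "\<psi> = r ?c \<circ> act (inv2 A)" using A(1) by (simp add: act_comp_inv2)
      moreover have "unimodular (inv2 A)" using A(1) by simp
      ultimately show "\<exists>\<xi>\<in>r ` (?S // ?R). \<exists>A. unimodular A \<and> \<psi> = \<xi> \<circ> act A" by blast
    qed
  next
    assume "\<exists>\<Phi>. finite \<Phi> \<and> (\<forall>\<psi>. fstep\<^sup>*\<^sup>* \<phi> \<psi> \<longrightarrow> (\<exists>\<xi>\<in>\<Phi>. \<exists>A. unimodular A \<and> \<psi> = \<xi> \<circ> act A))"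
    then obtain \<Phi> where \<Phi>: "finite \<Phi>" "\<And>\<psi>. fstep\<^sup>*\<^sup>* \<phi> \<psi> \<Longrightarrow> \<exists>\<xi>\<in>\<Phi>. \<exists>A. unimodular A \<and> \<psi> = \<xi> \<circ> act A"
      by blast
    have "?S // ?R \<subseteq> (\<lambda>\<xi>. {body (\<xi> \<circ> act A) | A. unimodular A}) ` \<Phi>"
    proof
      fix c assume "c \<in> ?S // ?R"
      then obtain \<psi> where \<psi>: "fstep\<^sup>*\<^sup>* \<phi> \<psi>" "c = ?R `` {body \<psi>}" unfolding S by (auto elim!: quotientE)
      obtain \<xi> A where A: "\<xi> \<in> \<Phi>" "unimodular A" "\<psi> = \<xi> \<circ> act A" using \<Phi>(2)[OF \<psi>(1)] by blast
      have c: "\<psi> \<circ> act B = \<xi> \<circ> act (A ** B)" for B by (simp add: A(3) fun_eq_iff act_mult)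
      have c': "\<xi> \<circ> act B = \<psi> \<circ> act (inv2 A ** B)" for B by (simp add: A(2,3) fun_eq_iff act_mult)
      have "c = {body (\<xi> \<circ> act A) | A. unimodular A}"
        unfolding \<psi>(2) cls
      proof safe
        fix B assume "unimodular B"
        then show "\<exists>A. body (\<psi> \<circ> act B) = body (\<xi> \<circ> act A) \<and> unimodular A"
          using c A(2) unimodular_mult by metis
      next
        fix B assume "unimodular B"
        then show "\<exists>A. body (\<xi> \<circ> act B) = body (\<psi> \<circ> act A) \<and> unimodular A"
          using c' A(2) unimodular_mult unimodular_inv2 by metis
      qed
      then show "c \<in> (\<lambda>\<xi>. {body (\<xi> \<circ> act A) | A. unimodular A}) ` \<Phi>" using A(1) by blast
    qed
    then show "finite (?S // ?R)" using \<Phi>(1) finite_surj by blast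
  qed
qed

lemma fin_type_fsteps:
  assumes "fin_type \<psi>" "fstep\<^sup>*\<^sup>* \<phi> \<psi>" "fan \<phi>"
  shows "fin_type \<phi>"
proof -
  have "fstep\<^sup>*\<^sup>* \<psi> \<xi>" if "fstep\<^sup>*\<^sup>* \<phi> \<xi>" for \<xi>
    using fsteps_sym[OF assms(2,3)] that by (rule rtranclp_trans)
  then show ?thesis using assms(1) unfolding fin_type_def by meson
qed

lemma norm_lat_ge_1:
  assumes "v \<noteq> 0"
  shows "norm (lat v) \<ge> 1"
proof -
  have "v $ 1 * v $ 1 + v $ 2 * v $ 2 > 0"
    using assms by (simp add: vec2_eq sum_squares_gt_zero_iff)
  then have "v $ 1 * v $ 1 + v $ 2 * v $ 2 \<ge> 1" by linarith
  then have "real_of_int (v $ 1 * v $ 1 + v $ 2 * v $ 2) \<ge> 1" by linarith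
  then show ?thesis by (simp add: norm_eq_sqrt_inner inner2)
qed

text \<open>An edge with a node is at least as long, in lattice units, as it is high, and nonzero
  lattice vectors have norm at least \<open>1\<close>; so heights are bounded by the diameters of
  finitely many representatives. The restriction to directions with a node is essential: over all
  primitive \<open>w\<close> the values \<open>\<psi> (lat w)\<close> are unbounded already for one
  polygon.\<close>

lemma fin_type_heights_bounded:
  assumes "fin_type \<phi>" "fan \<phi>"
  obtains B where "\<And>\<psi> w. fstep\<^sup>*\<^sup>* \<phi> \<psi> \<Longrightarrow> primitive w \<Longrightarrow> node_mult \<psi> (lat w) \<ge> 1 \<Longrightarrow> \<psi> (lat w) \<le> B"
proof -
  obtain \<Phi> where \<Phi>: "finite \<Phi>" "\<And>\<psi>. fstep\<^sup>*\<^sup>* \<phi> \<psi> \<Longrightarrow> \<exists>\<xi>\<in>\<Phi>. \<exists>A. unimodular A \<and> \<psi> = \<xi> \<circ> act A"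
    using assms(1) unfolding fin_type_def by blast
  have "\<exists>R. fan \<xi> \<longrightarrow> (\<forall>y\<in>body \<xi>. norm y \<le> R)" for \<xi>
    using fan_bounded by metis
  then obtain R where R: "\<And>\<xi> y. fan \<xi> \<Longrightarrow> y \<in> body \<xi> \<Longrightarrow> norm y \<le> R \<xi>" by metis
  show thesis
  proof
    fix \<psi> w assume \<psi>: "fstep\<^sup>*\<^sup>* \<phi> \<psi>" and w: "primitive w" "node_mult \<psi> (lat w) \<ge> 1"
    obtain \<xi> A where A: "\<xi> \<in> \<Phi>" "unimodular A" "\<psi> = \<xi> \<circ> act A" using \<Phi>(2) \<psi> by blast
    have "\<psi> \<circ> act (inv2 A) = \<xi>" using A by (simp add: act_comp_inv2)
    then have fan: "fan \<xi>" using fan_act[of "inv2 A" \<psi>] fan_fsteps[OF \<psi> assms(2)] A(2) by simp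
    let ?u = "A *v w"
    have u: "lat ?u \<noteq> 0" using primitive_mv[OF A(2) w(1)] primitive_nonzero by simp
    have "1 \<le> node_mult \<xi> (lat ?u)" using w(2) A by (simp add: mult_act lat_mv)
    then have "mult_ge \<xi> (lat ?u) 1" using le_mult_iff[OF fan u, of 1] by simp
    then have "1 * \<xi> (lat ?u) * norm (lat ?u) \<le> 2 * R \<xi>"
      using R[OF fan] fan_nonneg[OF fan] by (intro mult_ge_bound) auto
    moreover have "\<xi> (lat ?u) * 1 \<le> \<xi> (lat ?u) * norm (lat ?u)"
      using u fan_nonneg[OF fan] by (intro mult_left_mono norm_lat_ge_1) auto
    moreover have "R \<xi> \<le> Max (R ` \<Phi>)" using \<Phi>(1) A(1) by simp
    ultimately show "\<psi> (lat w) \<le> 2 * Max (R ` \<Phi>)" by (simp add: A(3) lat_mv)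
  qed
qed

section \<open>Infinite mutation type\<close>

lemma wedge_swap: "wedge a b = - wedge b a"
  by (simp add: wedge_def)

lemma wedge_simps [simp]:
  "wedge a a = 0" "wedge (- a) b = - wedge a b" "wedge a (- b) = - wedge a b"
  "wedge (a - b) c = wedge a c - wedge b c" "wedge a (b - c) = wedge a b - wedge a c"
  "wedge (a + b) c = wedge a c + wedge b c" "wedge a (b + c) = wedge a b + wedge a c"
  "wedge (n *s a) b = n * wedge a b" "wedge a (n *s b) = n * wedge a b"
  by (simp_all add: wedge_def algebra_simps)

lemma primitive_parallel:
  assumes "primitive u" "primitive w" "wedge u w = 0"
  shows "w = u \<or> w = - u"
proof -
  have "(u $ 1) * (- w $ 2) + u $ 2 * w $ 1 = 0" using assms(3) by (simp add: wedge_def algebra_simps)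
  then obtain d where d: "vector [- w $ 2, w $ 1] = d *s irot u"
    using primitive_orthogonal[OF assms(1), of "vector [- w $ 2, w $ 1]"] by auto
  then have w: "w = d *s u" by (simp add: vec2_eq)
  have "d dvd 1" using assms(2) unfolding w primitive_def by (auto simp: coprime_mult_left_iff coprime_mult_right_iff)
  then show ?thesis using w by (auto simp: zdvd1_eq abs_if vec2_eq split: if_splits)
qed

lemma mutate_nonpos: "wedge w u \<le> 0 \<Longrightarrow> mutate w k u = u"
  by (simp add: mutate_def)

lemma wedge_mutate [simp]: "wedge w (mutate w k u) = wedge w u"
  by (simp add: mutate_def)

lemma primitive_mutate [simp]: "primitive (mutate w k u) \<longleftrightarrow> primitive u"
proof (cases "wedge w u \<le> 0")
  case False
  then have "mutate w k u = shear w (int k) *v u"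
    by (simp add: vec2_eq mutate_def shear_def wedge_def algebra_simps)
  then show ?thesis by simp
qed (simp add: mutate_nonpos)

text \<open>For \<open>wedge u v < 0\<close> a mutation at \<open>u\<close> leaves \<open>v\<close>
  in place, and \<open>wedge v (- u) = wedge u v\<close>, so the lemma applies again to the pair
  \<open>v, - u\<close>. The point \<open>p\<close> is followed to its sheared copy in the
  lengthened slice; its value \<open>lat u \<bullet> p\<close> becomes a lower bound for the height
  in direction \<open>- u\<close>.\<close>

lemma pair_step:
  assumes fan: "fan \<phi>" and prim: "primitive u" "primitive v" and neg: "wedge u v < 0"
    and a: "a \<le> node_mult \<phi> (lat u)" and b: "b \<le> node_mult \<phi> (lat v)"
    and p: "p \<in> body \<phi>" "lat u \<bullet> p \<ge> 0"
  defines "\<psi> \<equiv> mutated \<phi> u a"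
  obtains p' where "fstep \<phi> \<psi>" "fan \<psi>" "b \<le> node_mult \<psi> (lat v)" "a \<le> node_mult \<psi> (lat (- u))" "p' \<in> body \<psi>"
    "lat v \<bullet> p' = lat v \<bullet> p - real a * of_int (wedge u v) * (lat u \<bullet> p)" "lat (- u) \<bullet> p' = - (lat u \<bullet> p)"
    "\<psi> (lat (- u)) \<ge> lat u \<bullet> p"
proof
  let ?p = "p - (real a * (lat u \<bullet> p)) *\<^sub>R rot (lat u)"
  show "fstep \<phi> \<psi>" unfolding \<psi>_def using prim(1) a by (rule fstep_tau)
  show fan': "fan \<psi>" unfolding \<psi>_def using fan prim(1) a by (rule fan_mutation)
  show "b \<le> node_mult \<psi> (lat v)"
    using mult_other[OF fan prim(1) a, of v] neg b by (simp add: \<psi>_def mutate_nonpos)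
  show "a \<le> node_mult \<psi> (lat (- u))" using mult_opposite[OF fan prim(1) a] by (simp add: \<psi>_def)
  show p': "?p \<in> body \<psi>" unfolding \<psi>_def using body_tau_up(2) p by simp
  show "lat v \<bullet> ?p = lat v \<bullet> p - real a * of_int (wedge u v) * (lat u \<bullet> p)"
    by (simp add: inner_diff_right inner_rot cross_lat)
  show "lat (- u) \<bullet> ?p = - (lat u \<bullet> p)" by (simp add: inner_diff_right)
  show "\<psi> (lat (- u)) \<ge> lat u \<bullet> p" using bodyD[OF p', of "lat (- u)"] by (simp add: inner_diff_right)
qed

text \<open>Two mutations act on the pair \<open>s, t\<close> of values of \<open>u\<close> and
  \<open>v\<close> at the point by a matrix of determinant \<open>1\<close> and trace
  \<open>A * B - 2\<close>; the bound \<open>4\<close> is where it ceases to be elliptic. At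
  \<open>A * B = 4\<close> the functional \<open>A * s + 2 * t\<close> is invariant, which is why it
  is the one to control.\<close>

lemma not_fin_type_pair_neg:
  assumes fan: "fan \<phi>" and prim: "primitive u" "primitive v" and neg: "wedge u v < 0"
    and large: "(wedge u v)\<^sup>2 * int (node_mult \<phi> (lat u)) * int (node_mult \<phi> (lat v)) \<ge> 4"
  shows "\<not> fin_type \<phi>"
proof
  assume "fin_type \<phi>"
  then obtain H where H: "\<And>\<psi> w. fstep\<^sup>*\<^sup>* \<phi> \<psi> \<Longrightarrow> primitive w \<Longrightarrow> node_mult \<psi> (lat w) \<ge> 1 \<Longrightarrow> \<psi> (lat w) \<le> H"
    using fin_type_heights_bounded fan by metis
  define a where "a = node_mult \<phi> (lat u)"
  define b where "b = node_mult \<phi> (lat v)"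
  define d where "d = real_of_int (- wedge u v)"
  define A where "A = d * real a"
  define B where "B = d * real b"
  have d: "d \<ge> 1" using neg by (simp add: d_def)
  have "real_of_int ((wedge u v)\<^sup>2 * int a * int b) \<ge> 4" using large unfolding a_def b_def by linarith
  then have AB: "A * B \<ge> 4" by (simp add: A_def B_def d_def power2_eq_square algebra_simps)
  have "a \<noteq> 0" "b \<noteq> 0" by (intro notI; use large in \<open>simp add: a_def b_def\<close>)+
  then have A: "A \<ge> 1" and B: "B \<ge> 1"
    using d mult_mono[of 1 d 1 "real a"] mult_mono[of 1 d 1 "real b"] by (auto simp: A_def B_def)
  \<comment> \<open>A direction in which \<open>u\<close> and \<open>v\<close> take the same
    positive value \<open>d\<close>; scaled by \<open>c\<close> it fits into a disc inside the
    polygon.\<close>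
  let ?x = "rot (lat v) - rot (lat u)"
  have ux: "lat u \<bullet> ?x = d" "lat v \<bullet> ?x = d"
    using wedge_swap[of v u] by (simp_all add: inner_diff_right inner_rot cross_lat d_def)
  obtain e where e: "e > 0" "ball 0 e \<subseteq> body \<phi>" using fan_ball fan by metis
  define N where "N = norm ?x + 1"
  have N: "N > 0" unfolding N_def using norm_ge_zero[of ?x] by linarith
  define c where "c = e / (2 * N)"
  have c: "c > 0" using e(1) N by (simp add: c_def)
  have "c * norm ?x < e"
  proof -
    have "c * norm ?x \<le> c * N" using c by (simp add: N_def)
    also have "\<dots> = e / 2" using N by (simp add: c_def)
    also have "\<dots> < e" using e(1) by simp
    finally show ?thesis .
  qed
  then have p0: "c *\<^sub>R ?x \<in> body \<phi>" using e(2) c by (simp add: subset_iff)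
  define \<delta> where "\<delta> = A * (c * d) + 2 * (c * d)"
  have \<delta>: "\<delta> > 0" unfolding \<delta>_def using A c d by (simp add: add_pos_pos)
  text \<open>With \<open>s = u \<bullet> p\<close> and \<open>t = v \<bullet> p\<close>, the quantity \<open>A * s + 2 * t\<close> does not decrease under two
    mutations, while \<open>s\<close> increases by at least \<open>B * \<delta> / 2\<close>.\<close>
  have "\<exists>\<psi> u' v' p. fstep\<^sup>*\<^sup>* \<phi> \<psi> \<and> fan \<psi> \<and> primitive u' \<and> primitive v' \<and> wedge u' v' = wedge u v \<and>
      a \<le> node_mult \<psi> (lat u') \<and> b \<le> node_mult \<psi> (lat v') \<and> p \<in> body \<psi> \<and>
      lat u' \<bullet> p \<ge> real n * (B * \<delta> / 2) \<and> A * (lat u' \<bullet> p) + 2 * (lat v' \<bullet> p) \<ge> \<delta>" for n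
  proof (induction n)
    case 0
    have "c * d \<ge> 0" using c d by simp
    then show ?case
      using fan prim p0 unfolding \<delta>_def a_def b_def
      by - (rule exI[of _ \<phi>], rule exI[of _ u], rule exI[of _ v], rule exI[of _ "c *\<^sub>R ?x"], simp add: ux)
  next
    case (Suc n)
    then obtain \<psi> u' v' p where I: "fstep\<^sup>*\<^sup>* \<phi> \<psi>" "fan \<psi>" "primitive u'" "primitive v'" "wedge u' v' = wedge u v"
      "a \<le> node_mult \<psi> (lat u')" "b \<le> node_mult \<psi> (lat v')" "p \<in> body \<psi>"
      "lat u' \<bullet> p \<ge> real n * (B * \<delta> / 2)" "A * (lat u' \<bullet> p) + 2 * (lat v' \<bullet> p) \<ge> \<delta>" by blast
    define s where "s = lat u' \<bullet> p"
    define t where "t = lat v' \<bullet> p"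
    have "real n * (B * \<delta> / 2) \<ge> 0" using B \<delta> by simp
    then have s0: "s \<ge> 0" using I(9) by (simp add: s_def)
    have neg': "wedge u' v' < 0" using I(5) neg by simp
    obtain p1 where p1: "fstep \<psi> (mutated \<psi> u' a)" "fan (mutated \<psi> u' a)" "b \<le> node_mult (mutated \<psi> u' a) (lat v')"
      "a \<le> node_mult (mutated \<psi> u' a) (lat (- u'))" "p1 \<in> body (mutated \<psi> u' a)"
      "lat v' \<bullet> p1 = lat v' \<bullet> p - real a * of_int (wedge u' v') * (lat u' \<bullet> p)" "lat (- u') \<bullet> p1 = - (lat u' \<bullet> p)"
      using pair_step[OF I(2-4) neg' I(6-8)] s0 unfolding s_def by blast
    have v1: "lat v' \<bullet> p1 = t + A * s" using p1(6) I(5) by (simp add: s_def t_def A_def d_def)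
    \<comment> \<open>The value \<open>t\<close> may be negative, but the bound on
      \<open>A * s + 2 * t\<close> still makes \<open>t + A * s\<close> nonnegative, as the second
      mutation requires.\<close>
    have half: "2 * (t + A * s) = (A * s + 2 * t) + A * s" by simp
    have "A * s \<ge> 0" using A s0 by simp
    then have ts: "t + A * s \<ge> 0" using I(10) \<delta> half by (simp add: s_def t_def)
    have neg1: "wedge v' (- u') < 0" using neg' wedge_swap[of v' u'] by simp
    let ?\<psi>1 = "mutated \<psi> u' a"
    obtain p2 where p2: "fstep ?\<psi>1 (mutated ?\<psi>1 v' b)" "fan (mutated ?\<psi>1 v' b)"
      "a \<le> node_mult (mutated ?\<psi>1 v' b) (lat (- u'))" "b \<le> node_mult (mutated ?\<psi>1 v' b) (lat (- v'))"
      "p2 \<in> body (mutated ?\<psi>1 v' b)"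
      "lat (- u') \<bullet> p2 = lat (- u') \<bullet> p1 - real b * of_int (wedge v' (- u')) * (lat v' \<bullet> p1)"
      "lat (- v') \<bullet> p2 = - (lat v' \<bullet> p1)"
      using pair_step[OF p1(2) I(4) _ neg1 p1(3,4,5)] I(3) ts v1 by auto
    have s2: "lat (- u') \<bullet> p2 = - s + B * (t + A * s)"
      unfolding p2(6) p1(7) v1 using I(5) wedge_swap[of v' u'] by (simp add: s_def B_def d_def algebra_simps)
    have t2: "lat (- v') \<bullet> p2 = - (t + A * s)" using p2(7) v1 by simp
    have G: "A * s + 2 * t \<ge> \<delta>" using I(10) by (simp add: s_def t_def)
    have AB2: "(A * B / 2 - 2) * s \<ge> 0" using AB s0 by (intro mult_nonneg_nonneg) auto
    have "(- s + B * (t + A * s)) = s + B / 2 * (A * s + 2 * t) + (A * B / 2 - 2) * s"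
      by (simp add: field_simps)
    moreover have "B / 2 * (A * s + 2 * t) \<ge> B / 2 * \<delta>" using G B by (intro mult_left_mono) auto
    moreover have "real (Suc n) * (B * \<delta> / 2) = real n * (B * \<delta> / 2) + B / 2 * \<delta>"
      by (simp add: field_simps)
    ultimately have grow: "- s + B * (t + A * s) \<ge> real (Suc n) * (B * \<delta> / 2)"
      using AB2 I(9) unfolding s_def[symmetric] by linarith
    have "A * (- s + B * (t + A * s)) + 2 * (- (t + A * s)) =
        (A * B / 2 - 1) * (A * s + 2 * t) + A * ((A * B / 2 - 2) * s)"
      by (simp add: field_simps)
    moreover have "(A * B / 2 - 1) * (A * s + 2 * t) \<ge> 1 * \<delta>" using G AB \<delta> by (intro mult_mono) auto
    moreover have "A * ((A * B / 2 - 2) * s) \<ge> 0" by (rule mult_nonneg_nonneg) (use A AB2 in linarith)+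
    ultimately have keep: "A * (- s + B * (t + A * s)) + 2 * (- (t + A * s)) \<ge> \<delta>" by linarith
    have "fstep\<^sup>*\<^sup>* \<phi> (mutated ?\<psi>1 v' b)" using I(1) p1(1) p2(1) by (meson rtranclp.rtrancl_into_rtrancl)
    moreover have "primitive (- u')" "primitive (- v')" "wedge (- u') (- v') = wedge u v"
      using I(3-5) by simp_all
    moreover have "real (Suc n) * (B * \<delta> / 2) \<le> lat (- u') \<bullet> p2" unfolding s2 by (rule grow)
    moreover have "\<delta> \<le> A * (lat (- u') \<bullet> p2) + 2 * (lat (- v') \<bullet> p2)" unfolding s2 t2 by (rule keep)
    ultimately show ?case using p2(2-5) by blast
  qed
  note grow = this
  obtain n where n: "real n * (B * \<delta> / 2) > H"
    using reals_Archimedean3[of "B * \<delta> / 2"] B \<delta> by auto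
  obtain \<psi> u' v' p where I: "fstep\<^sup>*\<^sup>* \<phi> \<psi>" "fan \<psi>" "primitive u'" "primitive v'" "wedge u' v' = wedge u v"
      "a \<le> node_mult \<psi> (lat u')" "b \<le> node_mult \<psi> (lat v')" "p \<in> body \<psi>"
      "lat u' \<bullet> p \<ge> real n * (B * \<delta> / 2)" using grow[of n] by blast
  have "real n * (B * \<delta> / 2) \<ge> 0" using B \<delta> by simp
  then have "lat u' \<bullet> p \<ge> 0" using I(9) by simp
  moreover have "wedge u' v' < 0" using I(5) neg by simp
  \<comment> \<open>One more mutation at \<open>u'\<close> turns the value at \<open>p\<close> into
    a lower bound for the height in a direction that carries at least \<open>a > 0\<close>
    nodes.\<close>
  ultimately obtain p' where "fstep \<psi> (mutated \<psi> u' a)" "a \<le> node_mult (mutated \<psi> u' a) (lat (- u'))"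
      "mutated \<psi> u' a (lat (- u')) \<ge> lat u' \<bullet> p"
    using pair_step[OF I(2-4) _ I(6-8)] by metis
  moreover have "fstep\<^sup>*\<^sup>* \<phi> (mutated \<psi> u' a)" using I(1) calculation(1) by simp
  ultimately have "lat u' \<bullet> p \<le> H"
    using H[of "mutated \<psi> u' a" "- u'"] I(3) \<open>a \<noteq> 0\<close> by fastforce
  then show False using I(9) n by linarith
qed

lemma fin_type_imp_small:
  assumes "fan \<phi>" "fin_type \<phi>" "primitive u" "primitive v"
  shows "(wedge u v)\<^sup>2 * int (node_mult \<phi> (lat u)) * int (node_mult \<phi> (lat v)) \<le> 3"
proof -
  consider "wedge u v < 0" | "wedge v u < 0" | "wedge u v = 0" using wedge_swap[of u v] by linarith
  then show ?thesis
  proof cases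
    case 1
    then show ?thesis using not_fin_type_pair_neg[OF assms(1,3,4)] assms(2) by force
  next
    case 2
    then have "\<not> (wedge v u)\<^sup>2 * int (node_mult \<phi> (lat v)) * int (node_mult \<phi> (lat u)) \<ge> 4"
      using not_fin_type_pair_neg[OF assms(1,4,3)] assms(2) by blast
    then show ?thesis using wedge_swap[of u v] by (simp add: ac_simps)
  qed simp
qed

section \<open>Families of normals\<close>

text \<open>A polygon mutation that moves a single node. The index set keeps nodes with equal
  normals apart: those parallel to \<open>x v\<close> stay where they are, since
  \<open>mutate\<close> fixes them.\<close>

definition family_mutation :: "'v \<Rightarrow> ('v \<Rightarrow> int ^ 2) \<Rightarrow> 'v \<Rightarrow> int ^ 2" where
  "family_mutation v x i = (if i = v then - x v else mutate (x v) 1 (x i))"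

definition family_step :: "'v set \<Rightarrow> ('v \<Rightarrow> int ^ 2) \<Rightarrow> ('v \<Rightarrow> int ^ 2) \<Rightarrow> bool" where
  "family_step V x y \<longleftrightarrow> (\<exists>v\<in>V. y = family_mutation v x)"

definition occurrences :: "'v set \<Rightarrow> ('v \<Rightarrow> int ^ 2) \<Rightarrow> int ^ 2 \<Rightarrow> nat" where
  "occurrences V x w = card {i \<in> V. x i = w}"

definition small :: "'v set \<Rightarrow> ('v \<Rightarrow> int ^ 2) \<Rightarrow> bool" where
  "small V x \<longleftrightarrow> (\<forall>i\<in>V. primitive (x i)) \<and>
     (\<forall>u w. (wedge u w)\<^sup>2 * int (occurrences V x u) * int (occurrences V x w) \<le> 3)"

text \<open>The leaves are parallel only up to sign, so arrows may point towards the centre and away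
  from it: every orientation of a star with one, two or three leaves is included.\<close>

definition star :: "'v set \<Rightarrow> ('v \<Rightarrow> int ^ 2) \<Rightarrow> 'v \<Rightarrow> bool" where
  "star V x c \<longleftrightarrow> c \<in> V \<and> card V \<in> {2, 3, 4} \<and> (\<forall>i\<in>V - {c}. \<bar>wedge (x c) (x i)\<bar> = 1) \<and>
     (\<forall>i\<in>V - {c}. \<forall>j\<in>V - {c}. wedge (x i) (x j) = 0)"

lemma family_stepI: "v \<in> V \<Longrightarrow> family_step V x (family_mutation v x)"
  by (auto simp: family_step_def)

lemma family_mutation_same [simp]: "family_mutation v x v = - x v"
  by (simp add: family_mutation_def)

lemma family_mutation_other: "i \<noteq> v \<Longrightarrow> family_mutation v x i = mutate (x v) 1 (x i)"
  by (simp add: family_mutation_def)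

lemma mutate_nonneg: "wedge w u \<ge> 0 \<Longrightarrow> mutate w k u = u + (int k * wedge w u) *s w"
  by (simp add: mutate_def)

lemma occurrences_pos: "finite V \<Longrightarrow> i \<in> V \<Longrightarrow> x i = u \<Longrightarrow> occurrences V x u \<ge> 1"
  unfolding occurrences_def using card_gt_0_iff[of "{i \<in> V. x i = u}"] by fastforce

lemma occurrences_ge:
  assumes "finite V" "\<And>k. k \<in> V \<Longrightarrow> x k = u \<Longrightarrow> y k = u'" "i \<in> V" "x i \<noteq> u" "y i = u'"
  shows "occurrences V x u + 1 \<le> occurrences V y u'"
proof -
  have "insert i {k \<in> V. x k = u} \<subseteq> {k \<in> V. y k = u'}" using assms by auto
  then have "card (insert i {k \<in> V. x k = u}) \<le> card {k \<in> V. y k = u'}"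
    using assms(1) by (intro card_mono) auto
  then show ?thesis using assms(1,4) by (simp add: occurrences_def)
qed

lemma small_wedge:
  assumes "finite V" "small V x" "i \<in> V" "j \<in> V"
  shows "\<bar>wedge (x i) (x j)\<bar> \<le> 1"
proof (rule ccontr)
  assume "\<not> \<bar>wedge (x i) (x j)\<bar> \<le> 1"
  then have "\<bar>wedge (x i) (x j)\<bar> \<ge> 2" by simp
  then have "2\<^sup>2 \<le> \<bar>wedge (x i) (x j)\<bar>\<^sup>2" by (intro power_mono) auto
  then have sq: "(wedge (x i) (x j))\<^sup>2 \<ge> 4" by simp
  have "int (occurrences V x (x i)) \<ge> 1" "int (occurrences V x (x j)) \<ge> 1"
    using occurrences_pos[OF assms(1)] assms(3,4) by (metis of_nat_1 of_nat_le_iff)+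
  with sq have "(wedge (x i) (x j))\<^sup>2 * int (occurrences V x (x i)) * int (occurrences V x (x j)) \<ge> 4 * 1 * 1"
    by (intro mult_mono) auto
  moreover have "(wedge (x i) (x j))\<^sup>2 * int (occurrences V x (x i)) * int (occurrences V x (x j)) \<le> 3"
    using assms(2) by (simp add: small_def)
  ultimately show False by linarith
qed

text \<open>The linear relation among three vectors of a plane. It turns conditions on arrows into
  equalities of normals.\<close>

lemma pluecker: "wedge v w *s u - wedge u w *s v + wedge u v *s w = 0"
  by (simp add: vec2_eq wedge_def algebra_simps)

text \<open>Both assumptions range over the whole mutation class of \<open>y\<close>. From an
  unwanted configuration a few mutations produce either one more occurrence of a normal, against
  \<open>max\<close>, or a pair of normals violating \<open>small\<close>.\<close>

locale extremal_family =
  fixes V :: "'v set" and y :: "'v \<Rightarrow> int ^ 2" and u :: "int ^ 2"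
  assumes finV: "finite V"
    and small: "\<And>z. (family_step V)\<^sup>*\<^sup>* y z \<Longrightarrow> small V z"
    and max: "\<And>z w. (family_step V)\<^sup>*\<^sup>* y z \<Longrightarrow> occurrences V z w \<le> occurrences V y u"
    and u: "\<exists>k\<in>V. y k = u"
begin

lemma small_y: "small V y"
  by (rule small) simp

lemma primitive_y: "i \<in> V \<Longrightarrow> primitive (y i)"
  using small_y by (simp add: small_def)

lemma primitive_u: "primitive u"
  using u primitive_y by blast

lemma step1: "i \<in> V \<Longrightarrow> (family_step V)\<^sup>*\<^sup>* y (family_mutation i y)"
  by (intro r_into_rtranclp family_stepI)

lemma step2:
  assumes "i \<in> V" "j \<in> V"
  shows "(family_step V)\<^sup>*\<^sup>* y (family_mutation j (family_mutation i y))"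
  using step1[OF assms(1)] family_stepI[OF assms(2), of "family_mutation i y"] by simp

lemma wedge_y: "i \<in> V \<Longrightarrow> j \<in> V \<Longrightarrow> \<bar>wedge (y i) (y j)\<bar> \<le> 1"
  by (rule small_wedge[OF finV small_y])

lemma wedge_step1:
  assumes "i \<in> V" "j \<in> V" "k \<in> V"
  shows "\<bar>wedge (family_mutation i y j) (family_mutation i y k)\<bar> \<le> 1"
  using small_wedge[OF finV small[OF step1]] assms by blast

lemma uminus_neq: "primitive w \<Longrightarrow> - w \<noteq> w"
  using primitive_nonzero[of w] by (auto simp: vec2_eq)

text \<open>Mutating at a node \<open>- u\<close> turns it into a further \<open>u\<close> and does
  not move the nodes already at \<open>u\<close>.\<close>

lemma no_opposite:
  assumes "i \<in> V"
  shows "y i \<noteq> - u"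
proof
  assume i: "y i = - u"
  have "occurrences V y u + 1 \<le> occurrences V (family_mutation i y) u"
  proof (rule occurrences_ge[OF finV _ assms])
    show "family_mutation i y k = u" if "y k = u" for k
      using that i uminus_neq[OF primitive_u] by (auto simp: family_mutation_def mutate_nonpos)
  qed (use i uminus_neq[OF primitive_u] in auto)
  then show False using max[OF step1[OF assms], of u] by linarith
qed

text \<open>An acyclic triangle acquires a double arrow when its middle vertex \<open>j\<close> is
  mutated.\<close>

lemma no_acyclic:
  assumes "i \<in> V" "j \<in> V" "k \<in> V" "wedge (y i) (y j) = 1" "wedge (y j) (y k) = 1" "wedge (y i) (y k) = 1"
  shows False
proof -
  have "i \<noteq> j" "k \<noteq> j" using assms(4,5) by auto
  moreover have "wedge (y j) (y i) = - 1" using assms(4) wedge_swap[of "y j"] by simp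
  ultimately have "wedge (family_mutation j y i) (family_mutation j y k) = 2"
    using assms by (simp add: family_mutation_other mutate_nonpos mutate_nonneg)
  then show False using wedge_step1[OF assms(2,1,3)] by simp
qed

lemma different_sides:
  assumes "i \<in> V" "j \<in> V" "wedge u (y i) = 1" "wedge u (y j) = - 1"
  shows False
proof -
  obtain k where k: "k \<in> V" "y k = u" using u by blast
  have ij: "i \<noteq> j" using assms by auto
  have wji: "wedge (y j) u = 1" "wedge (y i) u = - 1" using assms wedge_swap[of u] by simp_all
  let ?r = "wedge (y i) (y j)"
  have r: "?r *s u + y i + y j = 0"
    using pluecker[of "y i" "y j" u] assms(3,4) by (simp add: vec2_eq)
  consider "?r = - 1" | "?r = 0" | "?r = 1" using wedge_y[OF assms(1,2)] by linarith
  then show False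
  proof cases
    \<comment> \<open>The normals \<open>y j\<close>, \<open>u\<close>, \<open>y i\<close>, in this
      order, form an acyclic triangle.\<close>
    case 1
    then show False
      using no_acyclic[OF assms(2) k(1) assms(1)] k(2) assms(3) wji wedge_swap[of "y j" "y i"] by simp
  next
    \<comment> \<open>Here \<open>y j = - y i\<close>. Mutating at \<open>j\<close> gives at least
      two nodes at \<open>y i\<close>; by maximality \<open>u\<close> occurs at least twice as well,
      and its copies move to \<open>u + y j\<close>, which has wedge product \<open>1\<close> with
      \<open>y i\<close>. Now \<open>2 * 2 > 3\<close>.\<close>
    case 2
    then have opp: "y j = - y i" using r by (simp add: vec2_eq)
    let ?z = "family_mutation j y"
    have "?z i = y i" using ij opp by (simp add: family_mutation_other mutate_nonpos)
    moreover have "?z j = y i" using opp by simp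
    ultimately have "{i, j} \<subseteq> {l \<in> V. ?z l = y i}" using assms by auto
    then have "card {i, j} \<le> occurrences V ?z (y i)"
      unfolding occurrences_def using finV by (intro card_mono) auto
    then have c2: "occurrences V ?z (y i) \<ge> 2" using ij by simp
    have "?z l = u + y j" if "y l = u" for l
      using that wji(1) by (auto simp: family_mutation_def mutate_nonneg)
    then have "{l \<in> V. y l = u} \<subseteq> {l \<in> V. ?z l = u + y j}" by auto
    then have ca: "occurrences V y u \<le> occurrences V ?z (u + y j)"
      unfolding occurrences_def using finV by (intro card_mono) auto
    have "2 \<le> occurrences V y u" using c2 max[OF step1[OF assms(2)], of "y i"] by linarith
    with ca have "int (occurrences V ?z (u + y j)) \<ge> 2" by linarith
    moreover have "int (occurrences V ?z (y i)) \<ge> 2" using c2 by linarith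
    moreover have w1: "wedge (u + y j) (y i) = 1" using assms(3) opp by simp
    ultimately have "1 * int (occurrences V ?z (u + y j)) * int (occurrences V ?z (y i)) \<ge> 1 * 2 * 2"
      by (intro mult_mono) auto
    moreover have "(wedge (u + y j) (y i))\<^sup>2 * int (occurrences V ?z (u + y j)) * int (occurrences V ?z (y i)) \<le> 3"
      using small[OF step1[OF assms(2)]] unfolding small_def by blast
    ultimately show False unfolding w1 by simp
  next
    \<comment> \<open>An oriented triangle: mutating at \<open>j\<close> moves all copies of
      \<open>u\<close> to \<open>- y i\<close>, and mutating at \<open>i\<close> then adds one
      more.\<close>
    case 3
    let ?z = "family_mutation j y"
    let ?z' = "family_mutation i ?z"
    have e: "u + y j = - y i" using r 3 by (simp add: vec2_eq)
    have zi: "?z i = y i"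
      using ij 3 wedge_swap[of "y j" "y i"] by (simp add: family_mutation_other mutate_nonpos)
    have zu: "?z l = - y i" if "y l = u" for l
      using that wji(1) e by (auto simp: family_mutation_def mutate_nonneg)
    have "occurrences V y u + 1 \<le> occurrences V ?z' (- y i)"
    proof (rule occurrences_ge[OF finV _ assms(1)])
      show "?z' l = - y i" if "y l = u" for l
        using zu[OF that] zi by (auto simp: family_mutation_def[of i] mutate_nonpos)
      show "y i \<noteq> u" using assms(3) by auto
      show "?z' i = - y i" using zi by simp
    qed
    then show False using max[OF step2[OF assms(2,1)], of "- y i"] by linarith
  qed
qed

text \<open>If \<open>y i\<close> and \<open>y j\<close> had a nonzero wedge product, they would
  form an acyclic triangle with \<open>u\<close>; if it is zero, the relation
  \<open>pluecker\<close> reduces to equality.\<close>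

lemma same_side:
  assumes "i \<in> V" "j \<in> V" "wedge u (y i) = p" "wedge u (y j) = p" "p = 1 \<or> p = - 1"
  shows "y i = y j"
proof -
  obtain k where k: "k \<in> V" "y k = u" using u by blast
  let ?r = "wedge (y i) (y j)"
  have r: "?r *s u - p *s y i + p *s y j = 0"
    using pluecker[of "y i" "y j" u] assms(3,4) by simp
  have sw: "wedge (y i) u = - p" "wedge (y j) u = - p" "wedge (y j) (y i) = - ?r"
    using assms(3,4) wedge_swap[of _ u] wedge_swap[of "y j" "y i"] by simp_all
  consider "?r = - 1" | "?r = 0" | "?r = 1" using wedge_y[OF assms(1,2)] by linarith
  then show ?thesis
  proof cases
    case 1
    then show ?thesis
      using assms(5) no_acyclic[OF k(1) assms(2,1)] no_acyclic[OF assms(2,1) k(1)] k(2) assms(3,4) sw by auto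
  next
    case 2
    then show ?thesis using r assms(5) by (auto simp: vec2_eq)
  next
    case 3
    then show ?thesis
      using assms(5) no_acyclic[OF k(1) assms(1,2)] no_acyclic[OF assms(1,2) k(1)] k(2) assms(3,4) sw by auto
  qed
qed

lemma all_equal:
  assumes "i \<in> V" "j \<in> V" "wedge u (y i) \<noteq> 0" "wedge u (y j) \<noteq> 0"
  shows "y i = y j"
proof -
  obtain k where k: "k \<in> V" "y k = u" using u by blast
  have "wedge u (y i) \<in> {1, - 1}" "wedge u (y j) \<in> {1, - 1}"
    using wedge_y[OF k(1) assms(1)] wedge_y[OF k(1) assms(2)] k(2) assms(3,4) by auto
  then show ?thesis
    using same_side[OF assms(1,2)] different_sides[OF assms(1,2)] different_sides[OF assms(2,1)] by auto
qed

lemma parallel_or_star: "(\<forall>i\<in>V. \<forall>j\<in>V. wedge (y i) (y j) = 0) \<or> (\<exists>c. star V y c)"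
proof (cases "\<exists>c\<in>V. wedge u (y c) \<noteq> 0")
  case False
  then have "y i = u" if "i \<in> V" for i
    using primitive_parallel[OF primitive_u primitive_y[OF that]] no_opposite[OF that] that by auto
  then show ?thesis by simp
next
  case True
  then obtain c where c: "c \<in> V" "wedge u (y c) \<noteq> 0" by blast
  obtain k where k: "k \<in> V" "y k = u" using u by blast
  have wc: "\<bar>wedge u (y c)\<bar> = 1" using wedge_y[OF k(1) c(1)] c(2) unfolding k(2) by linarith
  have dich: "y i = u \<or> y i = y c" if "i \<in> V" for i
    using primitive_parallel[OF primitive_u primitive_y[OF that]] no_opposite[OF that] all_equal[OF that c(1) _ c(2)]
    by auto
  have uc: "u \<noteq> y c" using c(2) by auto
  let ?a = "occurrences V y u" and ?b = "occurrences V y (y c)"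
  have "V = {i \<in> V. y i = u} \<union> {i \<in> V. y i = y c}" using dich by auto
  then have "card V = card ({i \<in> V. y i = u} \<union> {i \<in> V. y i = y c})" by simp
  also have "\<dots> = ?a + ?b"
    unfolding occurrences_def using finV uc by (intro card_Un_disjoint) auto
  finally have cardV: "card V = ?a + ?b" .
  have a: "?a \<ge> 1" and b: "?b \<ge> 1" using occurrences_pos[OF finV] k c by auto
  have ba: "?b \<le> ?a" by (rule max) simp
  have "(wedge u (y c))\<^sup>2 * int ?a * int ?b \<le> 3" using small_y unfolding small_def by blast
  moreover have "(wedge u (y c))\<^sup>2 = 1" using wc by (metis one_power2 power2_abs)
  ultimately have "int (?a * ?b) \<le> 3" by simp
  then have ab: "?a * ?b \<le> 3" by linarith
  \<comment> \<open>Maximality gives \<open>?b \<le> ?a\<close>, so \<open>?a * ?b \<le> 3\<close>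
    leaves a single node at \<open>y c\<close>: the most frequent normal \<open>u\<close> belongs to
    the leaves.\<close>
  have b1: "?b = 1"
  proof (rule ccontr)
    assume "?b \<noteq> 1"
    then have "2 * 2 \<le> ?a * ?b" using b ba by (intro mult_mono) auto
    then show False using ab by simp
  qed
  then have "card {i \<in> V. y i = y c} = 1" by (simp add: occurrences_def)
  then obtain c' where "{i \<in> V. y i = y c} = {c'}" by (auto simp: card_1_singleton_iff)
  then have c': "i = c'" if "i \<in> V" "y i = y c" for i using that by blast
  have "i = c" if "i \<in> V" "y i = y c" for i using c'[OF that] c'[OF c(1) refl] by simp
  then have leaves: "y i = u" if "i \<in> V - {c}" for i using dich that by blast
  have "card V \<in> {2, 3, 4}" using cardV b1 a ab by auto
  moreover have "\<bar>wedge (y c) u\<bar> = 1" using wc wedge_swap[of u] by simp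
  ultimately have "star V y c" unfolding star_def using c(1) leaves by simp
  then show ?thesis by blast
qed

end

lemma reachable_parallel_or_star:
  assumes "finite V" "\<And>y. (family_step V)\<^sup>*\<^sup>* x y \<Longrightarrow> small V y"
  obtains y where "(family_step V)\<^sup>*\<^sup>* x y" "(\<forall>i\<in>V. \<forall>j\<in>V. wedge (y i) (y j) = 0) \<or> (\<exists>c. star V y c)"
proof (cases "V = {}")
  case True
  then show thesis using that[of x] by simp
next
  case False
  let ?P = "\<lambda>n. \<exists>y u. (family_step V)\<^sup>*\<^sup>* x y \<and> occurrences V y u = n"
  have bd: "n \<le> card V" if "?P n" for n
    using that assms(1) by (auto simp: occurrences_def intro: card_mono)
  have ex: "?P (occurrences V x u)" for u by blast
  define n where "n = (GREATEST n. ?P n)"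
  have n: "?P n" unfolding n_def by (rule GreatestI_nat[where P = ?P, OF ex]) (use bd in blast)
  have max: "m \<le> n" if "?P m" for m unfolding n_def by (rule Greatest_le_nat[where P = ?P, OF that]) (use bd in blast)
  obtain y u where y: "(family_step V)\<^sup>*\<^sup>* x y" "occurrences V y u = n" using n by blast
  obtain i where "i \<in> V" using False by blast
  then have "occurrences V x (x i) \<ge> 1" using assms(1) by (intro occurrences_pos) simp_all
  then have "n \<ge> 1" using max[OF ex[of "x i"]] by linarith
  then have "{i \<in> V. y i = u} \<noteq> {}" using y(2) unfolding occurrences_def by (metis card.empty not_one_le_zero)
  then have u: "\<exists>k\<in>V. y k = u" by blast
  interpret extremal_family V y u
  proof
    fix z w assume "(family_step V)\<^sup>*\<^sup>* y z"
    then have "(family_step V)\<^sup>*\<^sup>* x z" using y(1) by simp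
    then show "small V z" by (rule assms(2))
    have "?P (occurrences V z w)" using \<open>(family_step V)\<^sup>*\<^sup>* x z\<close> by blast
    then show "occurrences V z w \<le> occurrences V y u" unfolding y(2) by (rule max)
  qed (use assms(1) u in auto)
  show thesis using y(1) parallel_or_star by (rule that)
qed

section \<open>Finite mutation type\<close>

text \<open>The bridge between quivers and polygons: the family lists each primitive normal as often
  as it has nodes, so that quiver mutations lift to polygon mutations.\<close>

definition realizes :: "(real ^ 2 \<Rightarrow> real) \<Rightarrow> 'v set \<Rightarrow> ('v \<Rightarrow> int ^ 2) \<Rightarrow> bool" where
  "realizes \<phi> V x \<longleftrightarrow> finite V \<and> (\<forall>i\<in>V. primitive (x i)) \<and>
     (\<forall>w. primitive w \<longrightarrow> occurrences V x w = node_mult \<phi> (lat w))"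

lemma mutate_eq_iff: "mutate w k u = u' \<longleftrightarrow> u = u' - (int k * max 0 (wedge w u')) *s w"
  by (auto simp: mutate_def)

lemma mutate_parallel [simp]:
  "mutate w k w = w" "mutate w k (- w) = - w" "mutate (- w) k w = w" "mutate (- w) k (- w) = - w"
  by (simp_all add: mutate_def)

lemma realizes_step:
  assumes fan: "fan \<phi>" and real: "realizes \<phi> V x" and v: "v \<in> V"
  shows "realizes (mutated \<phi> (x v) 1) V (family_mutation v x)" "1 \<le> node_mult \<phi> (lat (x v))" "primitive (x v)"
proof -
  let ?w = "x v" and ?y = "family_mutation v x"
  have V: "finite V" "\<And>i. i \<in> V \<Longrightarrow> primitive (x i)" "\<And>w. primitive w \<Longrightarrow> occurrences V x w = node_mult \<phi> (lat w)"
    using real by (auto simp: realizes_def)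
  show prim: "primitive ?w" using V(2) v by blast
  have neq: "- ?w \<noteq> ?w" using primitive_nonzero[OF prim] by (auto simp: vec2_eq)
  show k: "1 \<le> node_mult \<phi> (lat ?w)" using occurrences_pos[OF V(1) v, of x ?w] V(3)[OF prim] by simp
  have "occurrences V ?y w = node_mult (mutated \<phi> ?w 1) (lat w)" if w: "primitive w" for w
  proof -
    consider "w = ?w" | "w = - ?w" | "wedge ?w w \<noteq> 0"
      using primitive_parallel[OF prim w] by blast
    then show ?thesis
    proof cases
      case 1
      have "{i \<in> V. ?y i = w} = {i \<in> V. x i = ?w} - {v}"
        using neq by (auto simp: 1 family_mutation_def mutate_eq_iff)
      then show ?thesis
        unfolding 1 mult_same[OF fan prim k] V(3)[OF prim, symmetric] occurrences_def using V(1) v by simp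
    next
      case 2
      have "{i \<in> V. ?y i = w} = insert v {i \<in> V. x i = - ?w}"
        using v by (auto simp: 2 family_mutation_def mutate_eq_iff)
      moreover have "occurrences V x (- ?w) = node_mult \<phi> (- lat ?w)" using V(3)[of "- ?w"] prim by simp
      ultimately show ?thesis
        using mult_opposite[OF fan prim k] neq V(1) by (simp add: 2 occurrences_def)
    next
      case 3
      let ?u = "w - max 0 (wedge ?w w) *s ?w"
      have u: "mutate ?w 1 ?u = w" "wedge ?w ?u = wedge ?w w" by (simp_all add: mutate_eq_iff)
      have "primitive ?u" using w u(1) primitive_mutate by metis
      have ne: "w \<noteq> - ?w" "- ?w \<noteq> w" "?w \<noteq> ?u" using 3 u(2) by (auto, metis wedge_simps(1))
      have "{i \<in> V. ?y i = w} = {i \<in> V. x i = ?u}"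
        using ne by (auto simp: family_mutation_def mutate_eq_iff)
      then have "occurrences V ?y w = node_mult \<phi> (lat ?u)"
        using V(3)[OF \<open>primitive ?u\<close>] by (simp add: occurrences_def)
      then show ?thesis using mult_other[OF fan prim k, of ?u] u 3 by simp
    qed
  qed
  moreover have "primitive (?y i)" if "i \<in> V" for i
    using V(2) that prim by (simp add: family_mutation_def)
  ultimately show "realizes (mutated \<phi> ?w 1) V ?y" using V(1) by (simp add: realizes_def)
qed

lemma realizes_steps:
  assumes "(family_step V)\<^sup>*\<^sup>* x y" "fan \<phi>" "realizes \<phi> V x"
  obtains \<psi> where "fstep\<^sup>*\<^sup>* \<phi> \<psi>" "fan \<psi>" "realizes \<psi> V y"
proof -
  from assms(1) have "\<exists>\<psi>. fstep\<^sup>*\<^sup>* \<phi> \<psi> \<and> fan \<psi> \<and> realizes \<psi> V y"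
  proof (induction rule: rtranclp_induct)
    case base
    then show ?case using assms by blast
  next
    case (step y z)
    then obtain \<psi> where \<psi>: "fstep\<^sup>*\<^sup>* \<phi> \<psi>" "fan \<psi>" "realizes \<psi> V y" by blast
    obtain v where v: "v \<in> V" "z = family_mutation v y" using step(2) by (auto simp: family_step_def)
    note r = realizes_step[OF \<psi>(2,3) v(1)]
    have "fstep \<psi> (mutated \<psi> (y v) 1)" using r(3,2) by (rule fstep_tau)
    then have "fstep\<^sup>*\<^sup>* \<phi> (mutated \<psi> (y v) 1)" using \<psi>(1) by simp
    then show ?case using r(1) v(2) fan_fsteps assms(2) by blast
  qed
  then show thesis using that by blast
qed

lemma fin_type_small:
  assumes "fan \<phi>" "fin_type \<phi>" "realizes \<phi> V x"
  shows "small V x"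
  unfolding small_def
proof (intro conjI allI ballI)
  show "primitive (x i)" if "i \<in> V" for i using assms(3) that by (simp add: realizes_def)
  fix u w
  show "(wedge u w)\<^sup>2 * int (occurrences V x u) * int (occurrences V x w) \<le> 3"
  proof (cases "primitive u \<and> primitive w")
    case True
    then show ?thesis using fin_type_imp_small[OF assms(1,2)] assms(3) by (simp add: realizes_def)
  next
    case False
    have "occurrences V x u = 0" if "\<not> primitive u" for u
      using that assms(3) by (auto simp: realizes_def occurrences_def)
    then show ?thesis using False by auto
  qed
qed

lemma fin_type_reachable:
  assumes "fan \<phi>" "fin_type \<phi>" "fstep\<^sup>*\<^sup>* \<phi> \<psi>"
  shows "fin_type \<psi>"
  using fin_type_fsteps[OF assms(2)] fsteps_sym[OF assms(3,1)] fan_fsteps[OF assms(3,1)] by blast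

text \<open>Checking single nodes suffices: \<open>k\<close> nodes at one normal are mutated one
  after another, and a change of basis can be moved past a mutation.\<close>

lemma fin_type_closed:
  assumes fan: "fan \<phi>" "\<phi> \<in> G" and finG: "finite G"
    and closed: "\<And>\<xi> w. \<xi> \<in> G \<Longrightarrow> fan \<xi> \<Longrightarrow> primitive w \<Longrightarrow> 1 \<le> node_mult \<xi> (lat w) \<Longrightarrow>
      \<exists>\<xi>'\<in>G. \<exists>A. unimodular A \<and> mutated \<xi> w 1 = \<xi>' \<circ> act A"
  shows "fin_type \<phi>"
proof -
  let ?R = "\<lambda>\<psi>. \<exists>\<xi>\<in>G. \<exists>A. unimodular A \<and> \<psi> = \<xi> \<circ> act A"
  have R_act: "?R (\<psi> \<circ> act B)" if \<psi>: "?R \<psi>" "unimodular B" for \<psi> B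
  proof -
    obtain \<xi> A where A: "\<xi> \<in> G" "unimodular A" "\<psi> = \<xi> \<circ> act A" using \<psi>(1) by blast
    have "\<psi> \<circ> act B = \<xi> \<circ> act (A ** B)" by (simp add: A(3) fun_eq_iff act_mult)
    then show ?thesis using A \<psi>(2) unimodular_mult by blast
  qed
  \<comment> \<open>For determinant \<open>- 1\<close> the sign of \<open>cross\<close> flips and
    the break of \<open>tau\<close> appears on the opposite side; a shear corrects this.\<close>
  have conj: "\<exists>B. unimodular B \<and> act A \<circ> tau (lat w) 1 = tau (lat (A *v w)) 1 \<circ> act B"
    if "unimodular A" for A w
  proof (cases "det A = 1")
    case True
    have "act A (tau (lat w) 1 m) = tau (lat (A *v w)) 1 (act A m)" for m
      unfolding tau_def lat_mv cross_act True
      by (simp add: matrix_vector_mult_diff_distrib matrix_vector_mult_scaleR)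
    then show ?thesis using that by (intro exI[of _ A]) (simp add: fun_eq_iff)
  next
    case False
    then have d: "det A = - 1" using unimodular_cases that by blast
    have m: "max 0 (- c) = max 0 c - c" for c :: real by simp
    have "act A (tau (lat w) 1 m) = tau (lat (A *v w)) 1 (act (shear (A *v w) 1 ** A) m)" for m
      unfolding tau_def act_mult act_shear
      by (simp add: lat_mv cross_act d m matrix_vector_mult_diff_distrib matrix_vector_mult_scaleR algebra_simps)
    then show ?thesis
      using unimodular_mult[OF unimodular_shear that] by (intro exI[of _ "shear (A *v w) 1 ** A"]) (simp add: fun_eq_iff)
  qed
  have R1: "?R (mutated \<psi> w 1)" if \<psi>: "?R \<psi>" "fan \<psi>" and w: "primitive w" "1 \<le> node_mult \<psi> (lat w)" for \<psi> w
  proof -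
    obtain \<xi> A where A: "\<xi> \<in> G" "unimodular A" "\<psi> = \<xi> \<circ> act A" using \<psi> by blast
    have fan_xi: "fan \<xi>" using fan_act[of "inv2 A" \<psi>] A \<psi>(2) by (simp add: act_comp_inv2)
    obtain B where B: "unimodular B" "act A \<circ> tau (lat w) 1 = tau (lat (A *v w)) 1 \<circ> act B"
      using conj A(2) by blast
    have "1 \<le> node_mult \<xi> (lat (A *v w))" using w(2) A by (simp add: mult_act lat_mv)
    then have "?R (mutated \<xi> (A *v w) 1)" using closed[OF A(1) fan_xi] w(1) A(2) by simp
    then have "?R (mutated \<xi> (A *v w) 1 \<circ> act B)" using R_act B(1) by blast
    moreover have "mutated \<psi> w 1 = mutated \<xi> (A *v w) 1 \<circ> act B"
      using B(2) by (simp add: A(3) comp_assoc)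
    ultimately show ?thesis by simp
  qed
  have Rk: "?R (mutated \<psi> w k)" if \<psi>: "?R \<psi>" "fan \<psi>" and w: "primitive w" "k \<le> node_mult \<psi> (lat w)" for \<psi> w k
    using w(2)
  proof (induction k)
    case 0
    then show ?case using \<psi>(1) by (simp add: comp_def id_def)
  next
    case (Suc k)
    then have k: "k \<le> node_mult \<psi> (lat w)" by simp
    have "1 \<le> node_mult (mutated \<psi> w k) (lat w)" using mult_same[OF \<psi>(2) w(1) k] Suc(2) by simp
    then have "?R (mutated (mutated \<psi> w k) w 1)"
      using R1 Suc.IH[OF k] fan_mutation[OF \<psi>(2) w(1) k] w(1) by blast
    moreover have "mutated (mutated \<psi> w k) w 1 = mutated \<psi> w (Suc k)"
      by (simp add: fun_eq_iff tau_tau add.commute)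
    ultimately show ?case by (simp only:)
  qed
  have "?R \<psi> \<and> fan \<psi>" if "fstep\<^sup>*\<^sup>* \<phi> \<psi>" for \<psi>
    using that
  proof (induction rule: rtranclp_induct)
    case base
    have "\<phi> = \<phi> \<circ> act (mat 1)" by (simp add: fun_eq_iff)
    then show ?case using fan unimodular_mat by blast
  next
    case (step \<psi> \<psi>')
    then have "fan \<psi>'" using fan_fstep by blast
    moreover have "?R \<psi>'" using step Rk R_act unfolding fstep_def by blast
    ultimately show ?case by blast
  qed
  then show ?thesis unfolding fin_type_def using finG by blast
qed

text \<open>An upper bound limits which mutations are possible, which is what finiteness needs, and
  it passes to larger multisets. Hence one list of seeds also handles the smaller stars.\<close>

definition bounded_by :: "(real ^ 2 \<Rightarrow> real) \<Rightarrow> (int ^ 2) multiset \<Rightarrow> bool" where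
  "bounded_by \<phi> M \<longleftrightarrow> (\<forall>w. primitive w \<longrightarrow> node_mult \<phi> (lat w) \<le> count M w)"

definition mutate_mset :: "int ^ 2 \<Rightarrow> (int ^ 2) multiset \<Rightarrow> (int ^ 2) multiset" where
  "mutate_mset w M = image_mset (mutate w 1) (M - {#w#}) + {#- w#}"

lemma inj_mutate: "inj (mutate w k)"
proof (rule injI)
  fix a b assume e: "mutate w k a = mutate w k b"
  then have "wedge w a = wedge w b" by (metis wedge_mutate)
  then show "a = b" using e by (simp add: mutate_def)
qed

lemma count_image_mset_inj: "inj f \<Longrightarrow> count (image_mset f M) (f x) = count M x"
  by (induction M) (auto dest: injD)

lemma bounded_by_mutate:
  assumes fan: "fan \<phi>" and b: "bounded_by \<phi> M" and prim: "primitive w" and k: "1 \<le> node_mult \<phi> (lat w)"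
  shows "bounded_by (mutated \<phi> w 1) (mutate_mset w M)"
  unfolding bounded_by_def
proof (intro allI impI)
  fix w' assume w': "primitive w'"
  have neq: "- w \<noteq> w" using primitive_nonzero[OF prim] by (auto simp: vec2_eq)
  note cnt = count_image_mset_inj[OF inj_mutate[of w 1]]
  consider "w' = w" | "w' = - w" | "wedge w w' \<noteq> 0" using primitive_parallel[OF prim w'] by blast
  then show "node_mult (mutated \<phi> w 1) (lat w') \<le> count (mutate_mset w M) w'"
  proof cases
    case 1
    have "node_mult \<phi> (lat w) \<le> count M w" using b prim by (simp add: bounded_by_def)
    then show ?thesis
      using mult_same[OF fan prim k] cnt[of "M - {#w#}" w] neq by (simp add: 1 mutate_mset_def)
  next
    case 2
    have "node_mult \<phi> (- lat w) \<le> count M (- w)" using b[unfolded bounded_by_def, rule_format, of "- w"] prim by simp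
    then show ?thesis
      using mult_opposite[OF fan prim k] cnt[of "M - {#w#}" "- w"] neq by (simp add: 2 mutate_mset_def)
  next
    case 3
    let ?u = "w' - max 0 (wedge w w') *s w"
    have u: "mutate w 1 ?u = w'" "wedge w ?u = wedge w w'" by (simp_all add: mutate_eq_iff)
    have "primitive ?u" using w' u(1) primitive_mutate by metis
    then have "node_mult \<phi> (lat ?u) \<le> count M ?u" using b by (simp add: bounded_by_def)
    moreover have "?u \<noteq> w" "w' \<noteq> - w" using 3 u(2) by (metis wedge_simps(1), auto)
    then have "count (mutate_mset w M) w' = count M ?u"
      using cnt[of "M - {#w#}" ?u] u(1) by (simp add: mutate_mset_def)
    moreover have "node_mult (mutated \<phi> w 1) (lat w') = node_mult \<phi> (lat ?u)"
      using mult_other[OF fan prim k, of ?u] u 3 by simp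
    ultimately show ?thesis by simp
  qed
qed

lemma bounded_by_act:
  assumes "unimodular A" "bounded_by (\<phi> \<circ> act A) M"
  shows "bounded_by \<phi> (image_mset ((*v) A) M)"
  unfolding bounded_by_def
proof (intro allI impI)
  fix w assume "primitive w"
  let ?u = "inv2 A *v w"
  have "inj ((*v) A)" using mv_inv2(2)[OF assms(1)] by (metis injI)
  then have "count (image_mset ((*v) A) M) (A *v ?u) = count M ?u" by (rule count_image_mset_inj)
  moreover have "node_mult (\<phi> \<circ> act A) (lat ?u) \<le> count M ?u"
    using assms \<open>primitive w\<close> by (simp add: bounded_by_def)
  ultimately show "node_mult \<phi> (lat w) \<le> count (image_mset ((*v) A) M) w"
    using assms(1) by (simp add: mult_act lat_mv[symmetric] del: mv_nth)
qed

lemma bounded_by_mono: "bounded_by \<phi> M \<Longrightarrow> M \<subseteq># N \<Longrightarrow> bounded_by \<phi> N"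
  unfolding bounded_by_def by (meson mset_subset_eq_count order_trans)

text \<open>The index \<open>j\<close> of \<open>\<Psi> j\<close> counts the nodes at
  \<open>w\<close> out of \<open>a + b\<close>. Mutating at \<open>w\<close> lowers it, mutating at
  \<open>- w\<close> raises it up to a shear that fixes \<open>w\<close>, so at most
  \<open>a + b + 1\<close> functions occur. The bound \<open>N j\<close> in \<open>?G\<close> keeps
  \<open>j\<close> within its range.\<close>

lemma fin_type_parallel:
  assumes fan: "fan \<phi>" and w: "primitive w"
    and par: "\<And>u. primitive u \<Longrightarrow> 1 \<le> node_mult \<phi> (lat u) \<Longrightarrow> u = w \<or> u = - w"
  shows "fin_type \<phi>"
proof -
  define a where "a = node_mult \<phi> (lat w)"
  define b where "b = node_mult \<phi> (- lat w)"
  define N where "N j = replicate_mset j w + replicate_mset (a + b - j) (- w)" for j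
  define \<Psi> where "\<Psi> j = \<phi> \<circ> tau (lat w) (real a - real j)" for j
  let ?G = "{\<xi>. \<exists>j\<in>{..a + b}. \<xi> = \<Psi> j \<and> bounded_by \<xi> (N j)}"
  have neq: "- w \<noteq> w" using primitive_nonzero[OF w] by (auto simp: vec2_eq)
  show ?thesis
  proof (rule fin_type_closed[OF fan, of ?G])
    have "node_mult \<phi> (lat u) \<le> count (N a) u" if "primitive u" for u
    proof (cases "1 \<le> node_mult \<phi> (lat u)")
      case True
      then have "u = w \<or> u = - w" using par that by blast
      then show ?thesis using neq by (auto simp: N_def a_def b_def)
    next
      case False
      then show ?thesis by simp
    qed
    then have "bounded_by \<phi> (N a)" by (simp add: bounded_by_def)
    then show "\<phi> \<in> ?G" by (intro CollectI bexI[of _ a]) (simp_all add: \<Psi>_def comp_def id_def)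
    show "finite ?G" by (rule finite_subset[of _ "\<Psi> ` {..a + b}"]) auto
  next
    fix \<xi> u assume "\<xi> \<in> ?G" and fan_xi: "fan \<xi>" and u: "primitive u" "1 \<le> node_mult \<xi> (lat u)"
    then obtain j where j: "j \<le> a + b" "\<xi> = \<Psi> j" "bounded_by \<xi> (N j)" by blast
    have "1 \<le> count (N j) u" using j(3) u by (metis bounded_by_def order_trans)
    then have "u \<in># N j" by (metis count_greater_eq_one_iff)
    then have "u = w \<and> 1 \<le> j \<or> u = - w \<and> 1 \<le> a + b - j" by (auto simp: N_def split: if_splits)
    then show "\<exists>\<xi>'\<in>?G. \<exists>A. unimodular A \<and> mutated \<xi> u 1 = \<xi>' \<circ> act A"
    proof
      assume uw: "u = w \<and> 1 \<le> j"
      have "mutate_mset w (N j) = N (j - 1)"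
      proof -
        have "N j - {#w#} = replicate_mset (j - 1) w + replicate_mset (a + b - j) (- w)"
          using uw by (cases j) (simp_all add: N_def)
        then have "mutate_mset w (N j) = replicate_mset (j - 1) w + replicate_mset (Suc (a + b - j)) (- w)"
          by (simp add: mutate_mset_def)
        moreover have "Suc (a + b - j) = a + b - (j - 1)" using uw j(1) by simp
        ultimately show ?thesis by (simp only: N_def)
      qed
      then have bd: "bounded_by (mutated \<xi> u 1) (N (j - 1))"
        using bounded_by_mutate[OF fan_xi j(3) u] uw by simp
      have "mutated \<xi> u 1 = \<Psi> (j - 1)"
        using uw by (auto simp: j(2) \<Psi>_def fun_eq_iff tau_tau of_nat_diff algebra_simps)
      with bd have "\<Psi> (j - 1) \<in> ?G" using j(1) by (intro CollectI bexI[of _ "j - 1"]) simp_all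
      moreover have "mutated \<xi> u 1 = \<Psi> (j - 1) \<circ> act (mat 1)"
        using \<open>mutated \<xi> u 1 = \<Psi> (j - 1)\<close> by (simp add: fun_eq_iff)
      ultimately show ?thesis using unimodular_mat by blast
    next
      assume uw: "u = - w \<and> 1 \<le> a + b - j"
      let ?S = "shear w (- 1)"
      have N: "mutate_mset (- w) (N j) = N (j + 1)"
      proof -
        have "a + b - j = Suc (a + b - (j + 1))" using uw by linarith
        then have "replicate_mset (a + b - j) (- w) = add_mset (- w) (replicate_mset (a + b - (j + 1)) (- w))"
          by (simp only: replicate_mset_Suc)
        then have "N j - {#- w#} = replicate_mset j w + replicate_mset (a + b - (j + 1)) (- w)"
          by (simp add: N_def)
        then show ?thesis by (simp add: mutate_mset_def N_def)
      qed
      have "\<Psi> j = \<Psi> (j + 1) \<circ> tau (lat w) (real 1)"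
        by (auto simp: \<Psi>_def fun_eq_iff tau_tau algebra_simps)
      then have e: "mutated \<xi> u 1 = \<Psi> (j + 1) \<circ> act ?S"
        using uw tau_tau_uminus[of w 1] by (simp add: j(2) comp_assoc)
      have "bounded_by (\<Psi> (j + 1) \<circ> act ?S) (N (j + 1))"
        using bounded_by_mutate[OF fan_xi j(3) u] uw N e by simp
      then have "bounded_by (\<Psi> (j + 1)) (image_mset ((*v) ?S) (N (j + 1)))"
        by (rule bounded_by_act[OF unimodular_shear])
      moreover have "?S *v w = w" "?S *v (- w) = - w"
        by (simp_all add: vec2_eq shear_def algebra_simps)
      ultimately have "bounded_by (\<Psi> (j + 1)) (N (j + 1))" by (simp add: N_def)
      moreover have "j + 1 \<le> a + b" using uw by linarith
      ultimately have "\<Psi> (j + 1) \<in> ?G" by (intro CollectI bexI[of _ "j + 1"]) simp_all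
      with e show ?thesis using unimodular_shear by blast
    qed
  qed
qed

section \<open>Piecewise linear periodicity for a star with three leaves\<close>

definition ivec :: "int \<Rightarrow> int \<Rightarrow> int ^ 2" where
  "ivec a b = vector [a, b]"

lemma ivec_nth [simp]: "ivec a b $ 1 = a" "ivec a b $ 2 = b"
  by (simp_all add: ivec_def)

text \<open>\<open>S0\<close> below is a star with three equal leaves. \<open>sigma1\<close> mutates all leaves of it and \<open>sigma2\<close> its centre,
  followed by the change of basis that restores \<open>S0\<close>; they generate a dihedral group of order 8.
  \<open>Y1\<close>, \<open>Y2\<close>, \<open>Y3\<close> lead from \<open>S0\<close> to the seeds \<open>S1\<close>, \<open>S2\<close> (two oriented triangles with a common
  edge) and \<open>S3\<close> (an oriented square). The matrices in the identities \<open>PL_\<close> are determined by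
  the requirement that they carry the mutated seed to \<open>S0\<close>, \<open>S1\<close> or \<open>S2\<close>.\<close>

definition sigma1 :: "real ^ 2 \<Rightarrow> real ^ 2" where
  "sigma1 m = vector [3 * min 0 (m $ 2) - m $ 1, m $ 2]"

definition sigma2 :: "real ^ 2 \<Rightarrow> real ^ 2" where
  "sigma2 m = vector [m $ 1, min 0 (m $ 1) - m $ 2]"

lemma sigma_nth [simp]:
  "sigma1 m $ 1 = 3 * min 0 (m $ 2) - m $ 1" "sigma1 m $ 2 = m $ 2"
  "sigma2 m $ 1 = m $ 1" "sigma2 m $ 2 = min 0 (m $ 1) - m $ 2"
  by (simp_all add: sigma1_def sigma2_def)

abbreviation tau1 :: "int \<Rightarrow> int \<Rightarrow> real ^ 2 \<Rightarrow> real ^ 2" where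
  "tau1 a b \<equiv> tau (lat (ivec a b)) 1"

lemma tau1_nth [simp]:
  "tau1 a b m $ 1 = m $ 1 - max 0 (a * m $ 2 - b * m $ 1) * a"
  "tau1 a b m $ 2 = m $ 2 - max 0 (a * m $ 2 - b * m $ 1) * b"
  by (simp_all add: tau_def cross_def)

definition Y1 :: "real ^ 2 \<Rightarrow> real ^ 2" where "Y1 = tau1 1 0"
definition Y2 :: "real ^ 2 \<Rightarrow> real ^ 2" where "Y2 = Y1 \<circ> tau1 1 1"
definition Y3 :: "real ^ 2 \<Rightarrow> real ^ 2" where "Y3 = Y2 \<circ> tau1 1 0"

lemmas PL_simps = fun_eq_iff vec2_eq Y1_def Y2_def Y3_def

lemma sigma1_sigma1: "sigma1 \<circ> sigma1 = id"
  by (simp add: PL_simps)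

lemma sigma2_sigma2: "sigma2 \<circ> sigma2 = id"
  by (simp add: PL_simps)

text \<open>For two involutions this says that the fourth power of
  \<open>sigma2 \<circ> sigma1\<close> is \<open>id\<close>. The factor \<open>3\<close> in
  \<open>sigma1\<close> is the number of leaves mutated at once.\<close>

lemma sigma_period: "sigma2 \<circ> sigma1 \<circ> sigma2 \<circ> sigma1 = sigma1 \<circ> sigma2 \<circ> sigma1 \<circ> sigma2"
proof
  fix m
  show "(sigma2 \<circ> sigma1 \<circ> sigma2 \<circ> sigma1) m = (sigma1 \<circ> sigma2 \<circ> sigma1 \<circ> sigma2) m"
    by (simp add: vec2_eq) (smt (verit))
qed

lemma PL_0_2: "tau1 0 1 = sigma2 \<circ> act (mat2 1 0 0 (-1))"
  by (auto simp: PL_simps min_def max_def)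

lemma PL_1_m: "Y1 \<circ> tau1 (-1) 0 = act (mat2 1 (-1) 0 1)"
  by (auto simp: PL_simps min_def max_def)

lemma PL_1_1: "Y1 \<circ> tau1 1 0 = sigma1 \<circ> Y1 \<circ> act (mat2 (-1) 3 0 1)"
  by (auto simp: PL_simps min_def max_def)

lemma PL_2_a: "Y2 \<circ> tau1 (-1) (-1) = Y1 \<circ> act (mat2 2 (-1) 1 0)"
  by (auto simp: PL_simps min_def max_def)

lemma PL_2_b: "Y2 \<circ> tau1 0 1 = sigma2 \<circ> Y1 \<circ> act (mat2 1 (-1) 0 (-1))"
  by (auto simp: PL_simps min_def max_def)

lemma PL_3_a: "Y3 \<circ> tau1 (-1) (-1) = sigma1 \<circ> Y2 \<circ> act (mat2 1 0 1 (-1))"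
  by (auto simp: PL_simps min_def max_def)

lemma PL_3_b: "Y3 \<circ> tau1 (-1) 0 = Y2 \<circ> act (mat2 1 (-1) 0 1)"
  by (auto simp: PL_simps min_def max_def)

lemma PL_3_c: "Y3 \<circ> tau1 1 0 = sigma1 \<circ> sigma2 \<circ> sigma1 \<circ> Y2 \<circ> act (mat2 (-1) 2 0 1)"
  by (auto simp: PL_simps min_def max_def)

lemma PL_3_d: "Y3 \<circ> tau1 1 1 = sigma2 \<circ> sigma1 \<circ> Y2 \<circ> act (mat2 0 (-1) 1 (-1))"
  by (auto simp: PL_simps min_def max_def)

definition octagon :: "(real ^ 2 \<Rightarrow> real ^ 2) set" where
  "octagon = {id, sigma1, sigma2, sigma1 \<circ> sigma2, sigma2 \<circ> sigma1, sigma1 \<circ> sigma2 \<circ> sigma1,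
     sigma2 \<circ> sigma1 \<circ> sigma2, sigma1 \<circ> sigma2 \<circ> sigma1 \<circ> sigma2}"

text \<open>Only multiplication on the right occurs, because a mutation changes the innermost map.
  The two words of length four agree by \<open>sigma_period\<close>, and \<open>p\<close> shortens
  the word of length five.\<close>

lemma octagon_closed:
  assumes "g \<in> octagon"
  shows "g \<circ> sigma1 \<in> octagon" "g \<circ> sigma2 \<in> octagon"
proof -
  have c1: "f \<circ> sigma1 \<circ> sigma1 = f" and c2: "f \<circ> sigma2 \<circ> sigma2 = f" for f :: "real ^ 2 \<Rightarrow> real ^ 2"
    by (simp_all add: comp_assoc sigma1_sigma1 sigma2_sigma2)
  have p: "sigma1 \<circ> sigma2 \<circ> sigma1 \<circ> sigma2 \<circ> sigma1 = sigma2 \<circ> sigma1 \<circ> sigma2"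
    using c1[of "sigma2 \<circ> sigma1 \<circ> sigma2"] by (simp only: sigma_period)
  show "g \<circ> sigma1 \<in> octagon"
    using assms unfolding octagon_def
    by (elim insertE emptyE) (simp_all only: id_comp c1 p sigma1_sigma1 sigma_period insert_iff simp_thms)
  show "g \<circ> sigma2 \<in> octagon"
    using assms unfolding octagon_def
    by (elim insertE emptyE) (simp_all only: id_comp c2 sigma2_sigma2 insert_iff simp_thms)
qed

definition S0 :: "(int ^ 2) multiset" where "S0 = {#ivec 1 0, ivec 1 0, ivec 1 0, ivec 0 1#}"
definition S1 :: "(int ^ 2) multiset" where "S1 = {#ivec 1 0, ivec 1 0, ivec (-1) 0, ivec 1 1#}"
definition S2 :: "(int ^ 2) multiset" where "S2 = {#ivec 1 0, ivec 1 0, ivec 0 1, ivec (-1) (-1)#}"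
definition S3 :: "(int ^ 2) multiset" where "S3 = {#ivec 1 0, ivec (-1) 0, ivec 1 1, ivec (-1) (-1)#}"

text \<open>Each function is stored with the bound on its nodes, so that only mutations at members
  of the respective seed have to be considered. The base \<open>\<phi>\<close> may be any
  function.\<close>

definition star_orbit :: "(real ^ 2 \<Rightarrow> real) \<Rightarrow> (real ^ 2 \<Rightarrow> real) set" where
  "star_orbit \<phi> = (\<Union>g\<in>octagon.
     {\<xi>. \<xi> = \<phi> \<circ> g \<and> bounded_by \<xi> S0} \<union> {\<xi>. \<xi> = \<phi> \<circ> g \<circ> Y1 \<and> bounded_by \<xi> S1} \<union>
     {\<xi>. \<xi> = \<phi> \<circ> g \<circ> Y2 \<and> bounded_by \<xi> S2} \<union> {\<xi>. \<xi> = \<phi> \<circ> g \<circ> Y3 \<and> bounded_by \<xi> S3})"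

lemma finite_star_orbit: "finite (star_orbit \<phi>)"
  unfolding star_orbit_def octagon_def by (intro finite_UN_I) auto

lemma mutate_ivec: "mutate (ivec a b) k (ivec c d) =
    ivec (c + int k * max 0 (a * d - b * c) * a) (d + int k * max 0 (a * d - b * c) * b)"
  by (simp add: vec2_eq mutate_def wedge_def)

lemma uminus_ivec: "- ivec a b = ivec (- a) (- b)"
  by (simp add: vec2_eq)

lemma mat2_ivec: "mat2 a b c d *v ivec x y = ivec (a * x + b * y) (c * x + d * y)"
  by (simp add: vec2_eq)

lemma ivec_eq: "ivec a b = ivec c d \<longleftrightarrow> a = c \<and> b = d"
  by (simp add: vec2_eq)

lemmas mset_simps = mutate_mset_def mutate_ivec uminus_ivec mat2_ivec ivec_eq S0_def S1_def S2_def S3_def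

lemma star_orbit_closed:
  assumes xi: "\<xi> \<in> star_orbit \<phi>" and fan: "fan \<xi>" and w: "primitive w" "1 \<le> node_mult \<xi> (lat w)"
  shows "\<exists>\<xi>'\<in>star_orbit \<phi>. \<exists>A. unimodular A \<and> mutated \<xi> w 1 = \<xi>' \<circ> act A"
proof -
  obtain g where g: "g \<in> octagon" and cases:
    "\<xi> = \<phi> \<circ> g \<and> bounded_by \<xi> S0 \<or> \<xi> = \<phi> \<circ> g \<circ> Y1 \<and> bounded_by \<xi> S1 \<or>
     \<xi> = \<phi> \<circ> g \<circ> Y2 \<and> bounded_by \<xi> S2 \<or> \<xi> = \<phi> \<circ> g \<circ> Y3 \<and> bounded_by \<xi> S3"
    using xi unfolding star_orbit_def by blast
  have in_S: "w \<in># S" if "bounded_by \<xi> S" for S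
    using that w unfolding bounded_by_def by (metis count_greater_eq_one_iff order_trans)
  \<comment> \<open>\<open>h\<close> and \<open>Y\<close> name the target and \<open>A\<close> is
    the basis in which the mutated seed becomes \<open>S'\<close>; the node bound of the target
    follows from \<open>bounded_by_mutate\<close> and \<open>bounded_by_act\<close>.\<close>
  have step: "\<exists>\<xi>'\<in>star_orbit \<phi>. \<exists>A. unimodular A \<and> mutated \<xi> w 1 = \<xi>' \<circ> act A"
    if "bounded_by \<xi> S" "unimodular A" "image_mset ((*v) A) (mutate_mset w S) = S'"
      "h \<in> octagon" "(Y, S') \<in> {(id, S0), (Y1, S1), (Y2, S2), (Y3, S3)}" "mutated \<xi> w 1 = \<phi> \<circ> h \<circ> Y \<circ> act A"
    for S A S' h Y
  proof -
    have "bounded_by (\<phi> \<circ> h \<circ> Y) S'"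
      using bounded_by_act[OF that(2)] bounded_by_mutate[OF fan that(1) w] that(3,6) by metis
    then have "\<phi> \<circ> h \<circ> Y \<in> star_orbit \<phi>"
      unfolding star_orbit_def using that(4,5) by auto
    then show ?thesis using that(2,6) by blast
  qed
  have act1: "f \<circ> act (mat 1) = f" for f :: "real ^ 2 \<Rightarrow> real" by (simp add: fun_eq_iff)
  note oct = g octagon_closed[OF g]
  show ?thesis using cases
  proof (elim disjE conjE)
    assume xi: "\<xi> = \<phi> \<circ> g" and b: "bounded_by \<xi> S0"
    from in_S[OF b] consider "w = ivec 1 0" | "w = ivec 0 1" by (auto simp: S0_def)
    then show ?thesis
    proof cases
      case 1
      show ?thesis
        by (rule step[OF b unimodular_mat, where h = g and Y = Y1 and S' = S1])
          (use g in \<open>simp_all add: 1 xi Y1_def act1 mset_simps\<close>)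
    next
      case 2
      have "tau (lat w) 1 = sigma2 \<circ> act (mat2 1 0 0 (-1))" unfolding 2 by (rule PL_0_2)
      then show ?thesis
        by (intro step[OF b, where h = "g \<circ> sigma2" and Y = id and S' = S0])
          (use oct in \<open>simp_all add: 2 xi comp_assoc unimodular_mat2 mset_simps\<close>)
    qed
  next
    assume xi: "\<xi> = \<phi> \<circ> g \<circ> Y1" and b: "bounded_by \<xi> S1"
    from in_S[OF b] consider "w = ivec 1 0" | "w = ivec (-1) 0" | "w = ivec 1 1" by (auto simp: S1_def)
    then show ?thesis
    proof cases
      \<comment> \<open>Two mutated leaves out of three amount to all three mutated and one mutated
        back, so the seed is \<open>S1\<close> again behind a \<open>sigma1\<close>.\<close>
      case 1
      show ?thesis
        by (rule step[OF b, where h = "g \<circ> sigma1" and Y = Y1 and S' = S1 and A = "mat2 (-1) 3 0 1"])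
          (use oct PL_1_1 in \<open>simp_all add: 1 xi comp_assoc unimodular_mat2 mset_simps\<close>)
    next
      case 2
      show ?thesis
        by (rule step[OF b, where h = g and Y = id and S' = S0 and A = "mat2 1 (-1) 0 1"])
          (use oct PL_1_m in \<open>simp_all add: 2 xi comp_assoc unimodular_mat2 mset_simps\<close>)
    next
      case 3
      show ?thesis
        by (rule step[OF b unimodular_mat, where h = g and Y = Y2 and S' = S2])
          (use oct in \<open>simp_all add: 3 xi Y2_def act1 comp_assoc mset_simps\<close>)
    qed
  next
    assume xi: "\<xi> = \<phi> \<circ> g \<circ> Y2" and b: "bounded_by \<xi> S2"
    from in_S[OF b] consider "w = ivec 1 0" | "w = ivec 0 1" | "w = ivec (-1) (-1)" by (auto simp: S2_def)
    then show ?thesis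
    proof cases
      case 1
      show ?thesis
        by (rule step[OF b unimodular_mat, where h = g and Y = Y3 and S' = S3])
          (use oct in \<open>simp_all add: 1 xi Y3_def act1 comp_assoc mset_simps\<close>)
    next
      case 2
      show ?thesis
        by (rule step[OF b, where h = "g \<circ> sigma2" and Y = Y1 and S' = S1 and A = "mat2 1 (-1) 0 (-1)"])
          (use oct PL_2_b in \<open>simp_all add: 2 xi comp_assoc unimodular_mat2 mset_simps\<close>)
    next
      case 3
      show ?thesis
        by (rule step[OF b, where h = g and Y = Y1 and S' = S1 and A = "mat2 2 (-1) 1 0"])
          (use oct PL_2_a in \<open>simp_all add: 3 xi comp_assoc unimodular_mat2 mset_simps\<close>)
    qed
  next
    assume xi: "\<xi> = \<phi> \<circ> g \<circ> Y3" and b: "bounded_by \<xi> S3"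
    from in_S[OF b] consider "w = ivec 1 0" | "w = ivec (-1) 0" | "w = ivec 1 1" | "w = ivec (-1) (-1)"
      by (auto simp: S3_def)
    then show ?thesis
    proof cases
      \<comment> \<open>By the symmetry of the square each of its four nodes leads to
        \<open>S2\<close>; the cases differ in the octagon element and the basis.\<close>
      case 1
      have "g \<circ> sigma1 \<circ> sigma2 \<circ> sigma1 \<in> octagon" using g octagon_closed by blast
      then show ?thesis
        by (intro step[OF b, where h = "g \<circ> sigma1 \<circ> sigma2 \<circ> sigma1" and Y = Y2 and S' = S2 and A = "mat2 (-1) 2 0 1"])
          (use PL_3_c in \<open>simp_all add: 1 xi comp_assoc unimodular_mat2 mset_simps\<close>)
    next
      case 2
      show ?thesis
        by (rule step[OF b, where h = g and Y = Y2 and S' = S2 and A = "mat2 1 (-1) 0 1"])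
          (use oct PL_3_b in \<open>simp_all add: 2 xi comp_assoc unimodular_mat2 mset_simps\<close>)
    next
      case 3
      have "g \<circ> sigma2 \<circ> sigma1 \<in> octagon" using g octagon_closed by blast
      then show ?thesis
        by (intro step[OF b, where h = "g \<circ> sigma2 \<circ> sigma1" and Y = Y2 and S' = S2 and A = "mat2 0 (-1) 1 (-1)"])
          (use PL_3_d in \<open>simp_all add: 3 xi comp_assoc unimodular_mat2 mset_simps\<close>)
    next
      case 4
      show ?thesis
        by (rule step[OF b, where h = "g \<circ> sigma1" and Y = Y2 and S' = S2 and A = "mat2 1 0 1 (-1)"])
          (use oct PL_3_a in \<open>simp_all add: 4 xi comp_assoc unimodular_mat2 mset_simps\<close>)
    qed
  qed
qed

lemma fin_type_S0:
  assumes "fan \<phi>" "bounded_by \<phi> S0"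
  shows "fin_type \<phi>"
proof (rule fin_type_closed[OF assms(1) _ finite_star_orbit star_orbit_closed])
  show "\<phi> \<in> star_orbit \<phi>" using assms(2) unfolding star_orbit_def octagon_def by simp
qed

text \<open>The leaf mutation that leads from \<open>S0\<close> to \<open>S1\<close> cannot simply
  be undone, since the node at \<open>ivec (-1) 0\<close> is only bounded from above and may be
  missing. The formal inverse, \<open>tau\<close> with exponent \<open>- 1\<close>, still serves as
  the base of \<open>star_orbit\<close>.\<close>

lemma fin_type_S1:
  assumes "fan \<phi>" "bounded_by \<phi> S1"
  shows "fin_type \<phi>"
proof (rule fin_type_closed[OF assms(1) _ finite_star_orbit star_orbit_closed])
  let ?\<xi> = "\<phi> \<circ> tau (lat (ivec 1 0)) (- 1)"
  have "?\<xi> \<circ> id \<circ> Y1 = \<phi>" by (simp add: fun_eq_iff Y1_def tau_tau)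
  then show "\<phi> \<in> star_orbit ?\<xi>" using assms(2) unfolding star_orbit_def octagon_def by auto
qed

lemma basis_change:
  assumes "\<bar>wedge c l\<bar> = 1" "\<bar>wedge c' l'\<bar> = 1"
  obtains A where "unimodular A" "A *v c = c'" "A *v l = l'"
proof -
  let ?m = "\<lambda>c l :: int ^ 2. mat2 (c $ 1) (l $ 1) (c $ 2) (l $ 2)"
  have um: "unimodular (?m c l)" "unimodular (?m c' l')"
    using assms by (simp_all add: unimodular_mat2 wedge_def algebra_simps)
  have c: "?m c l *v ivec 1 0 = c" "?m c l *v ivec 0 1 = l" for c l by (simp_all add: vec2_eq)
  let ?A = "?m c' l' ** inv2 (?m c l)"
  have "inv2 (?m c l) *v c = ivec 1 0" "inv2 (?m c l) *v l = ivec 0 1"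
    using mv_inv2(2)[OF um(1)] c[of c l] by metis+
  then have "?A *v c = c'" "?A *v l = l'"
    by (simp_all only: matrix_vector_mul_assoc [symmetric] c)
  moreover have "unimodular ?A" using um unimodular_mult by simp
  ultimately show thesis using that by blast
qed

lemma fin_type_bounded_act:
  assumes "fan \<phi>" "bounded_by \<phi> M" "unimodular A" "image_mset ((*v) A) M \<subseteq># S0 \<or> image_mset ((*v) A) M \<subseteq># S1"
  shows "fin_type \<phi>"
proof -
  let ?\<xi> = "\<phi> \<circ> act (inv2 A)"
  have e: "?\<xi> \<circ> act A = \<phi>" using assms(3) by (simp add: fun_eq_iff)
  have fan: "fan ?\<xi>" using assms(1,3) by (intro fan_act) simp_all
  have "bounded_by ?\<xi> (image_mset ((*v) A) M)" using bounded_by_act[OF assms(3), of ?\<xi> M] e assms(2) by simp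
  then have "bounded_by ?\<xi> S0 \<or> bounded_by ?\<xi> S1" using assms(4) bounded_by_mono by blast
  then have "fin_type ?\<xi>" using fin_type_S0 fin_type_S1 fan by blast
  moreover have "fstep \<phi> ?\<xi>" using assms(3) by (intro fstep_act) simp
  ultimately show ?thesis using fin_type_fsteps assms(1) by blast
qed

text \<open>Leaves at \<open>l\<close> and \<open>- l\<close> look like a star some of whose leaves
  have been mutated. After exchanging \<open>l\<close> and \<open>- l\<close> if necessary at most
  one leaf is at \<open>- l\<close>, which is a part of \<open>S0\<close> or \<open>S1\<close>. The
  sign of \<open>wedge c l\<close> is absorbed by the determinant of the basis change.\<close>

lemma fin_type_star:
  assumes fan: "fan \<phi>" and wd: "\<bar>wedge c l\<bar> = 1" and pq: "p + q \<le> 3"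
    and b: "bounded_by \<phi> (add_mset c (replicate_mset p l + replicate_mset q (- l)))"
  shows "fin_type \<phi>"
proof -
  have main: "fin_type \<phi>" if m: "\<bar>wedge c l\<bar> = 1" "p + q \<le> 3" "q \<le> p"
    "bounded_by \<phi> (add_mset c (replicate_mset p l + replicate_mset q (- l)))" for l p q
  proof (cases "q = 0")
    case True
    obtain A where A: "unimodular A" "A *v c = ivec 0 1" "A *v l = ivec 1 0"
      using basis_change[OF m(1), of "ivec 0 1" "ivec 1 0"] by (auto simp: wedge_def)
    have "replicate_mset p (ivec 1 0) \<subseteq># replicate_mset 3 (ivec 1 0)"
      using m(2) by (intro mset_subset_eqI) auto
    then have "add_mset (ivec 0 1) (replicate_mset p (ivec 1 0)) \<subseteq># add_mset (ivec 0 1) (replicate_mset 3 (ivec 1 0))"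
      by simp
    moreover have "add_mset (ivec 0 1) (replicate_mset 3 (ivec 1 0)) = S0" by (simp add: S0_def numeral_3_eq_3)
    ultimately show ?thesis
      using fin_type_bounded_act[OF fan m(4) A(1)] A True by simp
  next
    case False
    then have q: "q = 1" "p \<le> 2" using m(2,3) by auto
    obtain A where A: "unimodular A" "A *v c = ivec 1 1" "A *v l = ivec 1 0"
      using basis_change[OF m(1), of "ivec 1 1" "ivec 1 0"] by (auto simp: wedge_def)
    have "A *v (- l) = ivec (-1) 0" using A(3) by (simp add: vec2_eq)
    moreover have "replicate_mset p (ivec 1 0) \<subseteq># replicate_mset 2 (ivec 1 0)"
      using q(2) by (intro mset_subset_eqI) auto
    then have "add_mset (ivec 1 1) (add_mset (ivec (-1) 0) (replicate_mset p (ivec 1 0)))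
        \<subseteq># add_mset (ivec 1 1) (add_mset (ivec (-1) 0) (replicate_mset 2 (ivec 1 0)))"
      by simp
    moreover have "add_mset (ivec 1 1) (add_mset (ivec (-1) 0) (replicate_mset 2 (ivec 1 0))) = S1"
      by (simp add: S1_def numeral_2_eq_2)
    ultimately show ?thesis
      using fin_type_bounded_act[OF fan m(4) A(1)] A q by simp
  qed
  show ?thesis
  proof (cases "q \<le> p")
    case True
    then show ?thesis using main wd pq b by blast
  next
    case False
    then show ?thesis using main[of "- l" q p] wd pq b by (simp add: add.commute)
  qed
qed

section \<open>Edges and quivers\<close>

definition face :: "(real ^ 2 \<Rightarrow> real) \<Rightarrow> int ^ 2 \<Rightarrow> (real ^ 2) set" where
  "face \<phi> w = {y \<in> body \<phi>. lat w \<bullet> y = - \<phi> (lat w)}"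

text \<open>Two distinct points of the face determine the normal up to sign, and the opposite sign
  is excluded by the origin, which lies strictly inside.\<close>

lemma inner_normal_face:
  assumes fan: "fan \<phi>" and w: "primitive w" and y: "y \<in> face \<phi> w" "y' \<in> face \<phi> w" "y \<noteq> y'"
  shows "inner_normal (body \<phi>) (face \<phi> w) = w"
  unfolding inner_normal_def
proof (rule the_equality)
  show "primitive w \<and> (\<exists>c. (\<forall>x\<in>face \<phi> w. lat w \<bullet> x = c) \<and> (\<forall>x\<in>body \<phi>. lat w \<bullet> x \<ge> c))"
    using w bodyD[of _ \<phi> "lat w"] by (intro conjI exI[of _ "- \<phi> (lat w)"]) (force simp: face_def)+
next
  fix u assume "primitive u \<and> (\<exists>c. (\<forall>x\<in>face \<phi> w. lat u \<bullet> x = c) \<and> (\<forall>x\<in>body \<phi>. lat u \<bullet> x \<ge> c))"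
  then obtain c where u: "primitive u" "\<And>x. x \<in> face \<phi> w \<Longrightarrow> lat u \<bullet> x = c" "\<And>x. x \<in> body \<phi> \<Longrightarrow> lat u \<bullet> x \<ge> c"
    by blast
  have w0: "lat w \<noteq> 0" using primitive_nonzero[OF w] by simp
  have "lat w \<bullet> (y' - y) = 0" using y by (simp add: face_def inner_diff_right)
  then obtain r where r: "y' - y = r *\<^sub>R rot (lat w)" using orthogonal_rot w0 by blast
  have "r \<noteq> 0" using r y(3) by auto
  moreover have "lat u \<bullet> (y' - y) = 0" using u(2) y by (simp add: inner_diff_right)
  ultimately have "cross (lat w) (lat u) = 0" unfolding r by (simp add: inner_rot)
  then have "wedge w u = 0" by (simp add: cross_lat)
  then have "u = w \<or> u = - w" using primitive_parallel w u(1) by blast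
  moreover have "u \<noteq> - w"
  proof
    assume uw: "u = - w"
    have "c = \<phi> (lat w)" using u(2)[OF y(1)] y(1) by (simp add: uw face_def)
    then have "0 \<ge> \<phi> (lat w)" using u(3)[OF fan_zero_body[OF fan]] by simp
    then show False using fan_pos[OF fan w0] by simp
  qed
  ultimately show "u = w" by blast
qed

text \<open>An edge is exposed, which supplies a real normal; its ends are lattice points, which
  makes that normal proportional to a primitive one. The number \<open>c\<close> is the gcd of the
  coordinates of their difference, hence the lattice length.\<close>

lemma edge_of_body:
  assumes fan: "fan \<phi>" and E: "E edge_of body \<phi>"
  obtains w v and c :: nat where "primitive w" "c \<ge> 1" "E = face \<phi> w"
    "E = (\<lambda>t. lat v + t *\<^sub>R rot (lat w)) ` {0..real c}"
proof -
  note result = that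
  have fano: "fano_polygon (body \<phi>)" using fan by (rule fan_fano_polygon)
  then have poly: "polytope (body \<phi>)" by (simp add: fano_polygon_def)
  have face: "E face_of body \<phi>" and dim: "aff_dim E = 1" using E by (auto simp: edge_of_def)
  have "polytope E" using face poly face_of_polytope_polytope by blast
  then have "compact E" "convex E" by (simp_all add: polytope_imp_compact polytope_imp_convex)
  moreover have "collinear E" using dim by (simp add: collinear_aff_dim)
  moreover have E0: "E \<noteq> {}" using dim by auto
  ultimately obtain a b where ab: "E = closed_segment a b"
    using compact_convex_collinear_segment by metis
  have neq: "a \<noteq> b" using dim unfolding ab by auto
  have "a extreme_point_of E" "b extreme_point_of E" unfolding ab by (simp_all add: extreme_point_of_segment)
  then have "a extreme_point_of body \<phi>" "b extreme_point_of body \<phi>"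
    using extreme_point_of_face[OF face] by simp_all
  then obtain va vb where v: "a = lat va" "b = lat vb"
    using fano unfolding fano_polygon_def by metis
  have "E exposed_face_of body \<phi>"
    using face poly exposed_face_of_polyhedron polytope_imp_polyhedron by blast
  moreover have "E \<noteq> body \<phi>"
  proof
    assume "E = body \<phi>"
    moreover have "interior (body \<phi>) \<noteq> {}" using fano by (auto simp: fano_polygon_def)
    ultimately have "aff_dim E = int DIM(real ^ 2)" using aff_dim_nonempty_interior by metis
    then show False using dim by simp
  qed
  ultimately obtain n \<beta> where n: "n \<noteq> 0" "body \<phi> \<subseteq> {x. n \<bullet> x \<le> \<beta>}" "E = body \<phi> \<inter> {x. n \<bullet> x = \<beta>}"
    using E0 unfolding exposed_face_of by blast
  let ?m = "- n"
  have \<beta>: "\<phi> ?m = \<beta>"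
  proof (rule antisym)
    obtain u where "lat u \<in> body \<phi>" "\<phi> ?m = - (?m \<bullet> lat u)" using fan_attained fan by metis
    then show "\<phi> ?m \<le> \<beta>" using n(2) by auto
    obtain e where "e \<in> E" using E0 by blast
    then show "\<beta> \<le> \<phi> ?m" using bodyD[of e \<phi> ?m] n(3) by simp
  qed
  have "vb - va \<noteq> 0" using neq v by simp
  then obtain c w0 where c: "c > 0" "primitive w0" "vb - va = c *s w0" using primitive_multiple by blast
  have vb: "vb = va + c *s w0" unfolding c(3)[symmetric] by simp
  have "a \<in> E" "b \<in> E" unfolding ab by simp_all
  then have "n \<bullet> lat va = n \<bullet> lat vb" using n(3) v by simp
  then have nw: "n \<bullet> lat w0 = 0" using c(1) by (simp add: vb inner_add_right)
  have main: thesis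
    if w: "primitive w" "?m = r *\<^sub>R lat w" "r > 0" and seg: "E = closed_segment (lat v) (lat v + of_int c *\<^sub>R rot (lat w))"
    for w r v
  proof (rule result)
    show "primitive w" by (rule w(1))
    show "nat c \<ge> 1" using c(1) by simp
    have "\<phi> ?m = r * \<phi> (lat w)" unfolding w(2) using w(3) by (intro fan_scale[OF fan]) simp
    moreover have "n \<bullet> x = - r * (lat w \<bullet> x)" for x
      using arg_cong[OF w(2), of "\<lambda>z. - (z \<bullet> x)"] by simp
    ultimately have "n \<bullet> x = \<beta> \<longleftrightarrow> r * (lat w \<bullet> x + \<phi> (lat w)) = 0" for x
      unfolding \<beta>[symmetric] by (auto simp: algebra_simps)
    then have "n \<bullet> x = \<beta> \<longleftrightarrow> lat w \<bullet> x = - \<phi> (lat w)" for x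
      using w(3) by (simp add: add_eq_0_iff2)
    then show "E = face \<phi> w" unfolding n(3) face_def by blast
    show "E = (\<lambda>t. lat v + t *\<^sub>R rot (lat w)) ` {0..real (nat c)}"
    proof -
      have "closed_segment (lat v) (lat v + of_int c *\<^sub>R rot (lat w)) =
          (\<lambda>u. lat v + (u * of_int c) *\<^sub>R rot (lat w)) ` {0..1}"
        by (auto simp: closed_segment_def algebra_simps image_iff)
      also have "\<dots> = (\<lambda>t. lat v + t *\<^sub>R rot (lat w)) ` ((\<lambda>u. u * of_int c) ` {0..1})"
        by (simp add: image_image)
      also have "(\<lambda>u. u * real_of_int c) ` {0..1} = {0..real (nat c)}"
        using c(1) image_mult_atLeastAtMost_if'[of "real_of_int c" 0 1] by simp
      finally show ?thesis using seg by simp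
    qed
  qed
  \<comment> \<open>Chosen so that \<open>rot (lat ?w)\<close> is the primitive direction from
    \<open>va\<close> to \<open>vb\<close>. The sign of \<open>r\<close> decides which of
    \<open>?w\<close> and \<open>- ?w\<close> points inwards; in the second case the segment is read
    from \<open>vb\<close>.\<close>
  let ?w = "- irot w0"
  have prim: "primitive ?w"
    using c(2) by (simp add: primitive_def coprime_commute)
  have rot: "rot (lat ?w) = lat w0" by (simp add: vec2_eq)
  have w0: "lat ?w \<noteq> 0" using primitive_nonzero[OF prim] by simp
  have "cross (lat ?w) ?m = 0" using nw by (simp add: inner_rot[symmetric] rot del: lat_simps)
  then obtain r where r: "?m = r *\<^sub>R lat ?w" using cross_0_parallel w0 by blast
  have "r \<noteq> 0" using r n(1) by auto
  then consider "r > 0" | "- r > 0" by linarith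
  then show thesis
  proof cases
    case 1
    have "E = closed_segment (lat va) (lat va + of_int c *\<^sub>R rot (lat ?w))"
      unfolding rot ab v by (simp add: vb)
    then show thesis using main[OF prim r 1] by blast
  next
    case 2
    have "lat vb + of_int c *\<^sub>R rot (lat (- ?w)) = lat va" by (simp add: vb vec2_eq)
    then have "E = closed_segment (lat vb) (lat vb + of_int c *\<^sub>R rot (lat (- ?w)))"
      unfolding ab v by (simp only: closed_segment_commute)
    moreover have "?m = (- r) *\<^sub>R lat (- ?w)" using r by simp
    ultimately show thesis using main[of "- ?w" "- r" vb] prim 2 by simp
  qed
qed

text \<open>An edge of lattice length \<open>c\<close> contains \<open>c + 1\<close> lattice points,
  and a segment of \<open>k\<close> times the height \<open>h\<close> fits into it exactly if
  \<open>k * h \<le> c\<close>; the largest such \<open>k\<close> is the floor of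
  \<open>c / h\<close>.\<close>

lemma edge_mult_eq:
  assumes fan: "fan \<phi>" and w: "primitive w" and c: "c \<ge> 1" and Ef: "E = face \<phi> w"
    and Es: "E = (\<lambda>t. lat v + t *\<^sub>R rot (lat w)) ` {0..real c}"
  shows "inner_normal (body \<phi>) E = w" "edge_mult (body \<phi>) E = node_mult \<phi> (lat w)"
proof -
  have w0: "lat w \<noteq> 0" using primitive_nonzero[OF w] by simp
  have rw: "rot (lat w) \<noteq> 0" using w0 norm_rot[of "lat w"] by (metis norm_eq_zero)
  have in_E: "lat v + t *\<^sub>R rot (lat w) \<in> E \<longleftrightarrow> 0 \<le> t \<and> t \<le> real c" for t
    unfolding Es using rw by (auto simp: image_iff)
  have v: "lat v \<in> E" using in_E[of 0] by simp
  have v': "lat v + real c *\<^sub>R rot (lat w) \<in> E" using in_E[of "real c"] by simp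
  show normal: "inner_normal (body \<phi>) E = w"
    unfolding Ef using v v' rw c by (intro inner_normal_face[OF fan w, of "lat v" "lat v + real c *\<^sub>R rot (lat w)"]) (auto simp: Ef)
  obtain h' where h': "\<phi> (lat w) = of_int h'" using fan_integral fan by metis
  define h where "h = nat h'"
  have "h' > 0" using fan_pos[OF fan w0] h' by simp
  then have h: "\<phi> (lat w) = real h" "h > 0" using h' by (auto simp: h_def)
  have height: "edge_height (body \<phi>) E = h"
    unfolding edge_height_def normal
  proof (rule the_equality)
    show "\<forall>x\<in>E. lat w \<bullet> x = - real h" using h by (simp add: Ef face_def)
    fix k assume "\<forall>x\<in>E. lat w \<bullet> x = - real k"
    then show "k = h" using v h by (auto simp: Ef face_def)
  qed
  have "E \<inter> range lat = (\<lambda>k. lat v + real k *\<^sub>R rot (lat w)) ` {0..c}"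
  proof safe
    fix u assume "lat u \<in> E"
    then obtain t where t: "lat u = lat v + t *\<^sub>R rot (lat w)" "t \<in> {0..real c}" unfolding Es by blast
    have "lat w \<bullet> (lat u - lat v) = 0" unfolding t(1) by simp
    then have "real_of_int (w $ 1 * (u - v) $ 1 + w $ 2 * (u - v) $ 2) = 0" by (simp add: inner2)
    then have "w $ 1 * (u - v) $ 1 + w $ 2 * (u - v) $ 2 = 0" by (simp only: of_int_eq_0_iff)
    then obtain d where d: "u - v = d *s irot w" using primitive_orthogonal w by blast
    have "lat (u - v) = of_int d *\<^sub>R rot (lat w)" unfolding d by (simp add: vec2_eq)
    moreover have "lat (u - v) = t *\<^sub>R rot (lat w)" using t(1) by (simp add: vec2_eq)
    ultimately have "t = of_int d" using rw by simp
    then have "t = real (nat d)" "nat d \<le> c" using t(2) by auto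
    then show "lat u \<in> (\<lambda>k. lat v + real k *\<^sub>R rot (lat w)) ` {0..c}" unfolding t(1) by auto
  next
    fix k assume "k \<in> {0..c}"
    then show "lat v + real k *\<^sub>R rot (lat w) \<in> E" unfolding in_E by simp
    have "lat v + real k *\<^sub>R rot (lat w) = lat (v + int k *s irot w)" by (simp add: vec2_eq)
    then show "lat v + real k *\<^sub>R rot (lat w) \<in> range lat" by (metis rangeI)
  qed
  moreover have "inj (\<lambda>k. lat v + real k *\<^sub>R rot (lat w))" using rw by (auto simp: inj_def)
  ultimately have "card (E \<inter> range lat) = c + 1" by (simp add: card_image inj_on_subset)
  then have length: "lattice_length E = c" by (simp add: lattice_length_def)
  have "k \<le> node_mult \<phi> (lat w) \<longleftrightarrow> real k * real h \<le> real c" for k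
  proof
    assume "k \<le> node_mult \<phi> (lat w)"
    then have "mult_ge \<phi> (lat w) (real k)" using le_mult_iff[OF fan w0] by simp
    then obtain y where y: "y \<in> body \<phi>" "lat w \<bullet> y = - \<phi> (lat w)" "y + (real k * real h) *\<^sub>R rot (lat w) \<in> body \<phi>"
      using h by (auto simp: mult_ge_def)
    have "y \<in> E" "y + (real k * real h) *\<^sub>R rot (lat w) \<in> E"
      unfolding Ef face_def using y by (simp_all add: inner_add_right)
    moreover from this obtain t where t: "y = lat v + t *\<^sub>R rot (lat w)" "t \<in> {0..real c}" unfolding Es by blast
    ultimately have "lat v + (t + real k * real h) *\<^sub>R rot (lat w) \<in> E" by (simp add: scaleR_add_left add.assoc)
    then show "real k * real h \<le> real c" using t(2) unfolding in_E by simp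
  next
    assume "real k * real h \<le> real c"
    then have "lat v + (real k * real h) *\<^sub>R rot (lat w) \<in> E" unfolding in_E by simp
    then have "mult_ge \<phi> (lat w) (real k)"
      unfolding mult_ge_def using v h by (intro bexI[of _ "lat v"]) (simp_all add: Ef face_def)
    then show "k \<le> node_mult \<phi> (lat w)" using le_mult_iff[OF fan w0] by simp
  qed
  moreover have "k \<le> edge_mult (body \<phi>) E \<longleftrightarrow> real k * real h \<le> real c" for k
  proof -
    have "k \<le> nat \<lfloor>real c / real h\<rfloor> \<longleftrightarrow> int k \<le> \<lfloor>real c / real h\<rfloor>"
      by (simp add: le_nat_iff)
    also have "\<dots> \<longleftrightarrow> real k * real h \<le> real c" using h(2) by (simp add: le_floor_iff pos_le_divide_eq)
    finally show ?thesis by (simp only: edge_mult_def height length)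
  qed
  ultimately show "edge_mult (body \<phi>) E = node_mult \<phi> (lat w)" by (metis le_refl order_antisym)
qed

text \<open>Converse of \<open>edge_of_body\<close>: a node provides two distinct points of the
  face, as \<open>\<phi> (lat w) > 0\<close>, so its dimension is one.\<close>

lemma face_edge:
  assumes fan: "fan \<phi>" and w: "primitive w" and m: "1 \<le> node_mult \<phi> (lat w)"
  shows "face \<phi> w edge_of body \<phi>" "inner_normal (body \<phi>) (face \<phi> w) = w"
proof -
  have w0: "lat w \<noteq> 0" using primitive_nonzero[OF w] by simp
  have rw: "rot (lat w) \<noteq> 0" using w0 norm_rot[of "lat w"] by (metis norm_eq_zero)
  have "mult_ge \<phi> (lat w) 1" using le_mult_iff[OF fan w0, of 1] m by simp
  then obtain y where y: "y \<in> body \<phi>" "lat w \<bullet> y = - \<phi> (lat w)" "y + \<phi> (lat w) *\<^sub>R rot (lat w) \<in> body \<phi>"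
    by (auto simp: mult_ge_def)
  let ?z = "y + \<phi> (lat w) *\<^sub>R rot (lat w)"
  have yz: "y \<in> face \<phi> w" "?z \<in> face \<phi> w" using y by (simp_all add: face_def inner_add_right)
  have neq: "y \<noteq> ?z" using rw fan_pos[OF fan w0] by simp
  show "inner_normal (body \<phi>) (face \<phi> w) = w" using inner_normal_face[OF fan w yz neq] .
  have "body \<phi> \<inter> {x. lat w \<bullet> x = - \<phi> (lat w)} face_of body \<phi>"
    by (rule face_of_Int_supporting_hyperplane_ge[OF convex_body]) (use bodyD[of _ \<phi> "lat w"] in force)
  moreover have "body \<phi> \<inter> {x. lat w \<bullet> x = - \<phi> (lat w)} = face \<phi> w" by (auto simp: face_def)
  moreover have "aff_dim (face \<phi> w) \<le> 1"
    unfolding collinear_aff_dim[symmetric] collinear_def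
  proof (rule exI[of _ "rot (lat w)"], intro ballI)
    fix a b assume "a \<in> face \<phi> w" "b \<in> face \<phi> w"
    then have "lat w \<bullet> (a - b) = 0" by (simp add: face_def inner_diff_right)
    then show "\<exists>c. a - b = c *\<^sub>R rot (lat w)" using orthogonal_rot w0 by metis
  qed
  moreover have "aff_dim {y, ?z} \<le> aff_dim (face \<phi> w)" using yz by (intro aff_dim_subset) auto
  ultimately show "face \<phi> w edge_of body \<phi>" using neq by (simp add: edge_of_def aff_dim_2)
qed

lemma realizes_fano_quiver:
  assumes fan: "fan \<phi>"
  shows "realizes \<phi> (qverts (fano_quiver (body \<phi>))) (\<lambda>i. inner_normal (body \<phi>) (fst i))"
proof -
  let ?P = "body \<phi>"
  let ?V = "{(E, k). E edge_of ?P \<and> k < edge_mult ?P E}"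
  have V: "qverts (fano_quiver ?P) = ?V" by (simp add: fano_quiver_def Let_def)
  have "polytope ?P" using fan_fano_polygon[OF fan] by (simp add: fano_polygon_def)
  then have "finite {E. E face_of ?P}" by (rule finite_polytope_faces)
  then have "finite (SIGMA E:{E. E face_of ?P}. {..<edge_mult ?P E})" by blast
  then have finV: "finite ?V" by (rule rev_finite_subset) (auto simp: edge_of_def)
  have edge: "primitive (inner_normal ?P E) \<and> E = face \<phi> (inner_normal ?P E) \<and>
      edge_mult ?P E = node_mult \<phi> (lat (inner_normal ?P E))" if "E edge_of ?P" for E
    using edge_of_body[OF fan that] edge_mult_eq[OF fan] by metis
  have "{i \<in> ?V. inner_normal ?P (fst i) = w} = {face \<phi> w} \<times> {..<node_mult \<phi> (lat w)}" if w: "primitive w" for w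
  proof (intro set_eqI iffI)
    fix i assume "i \<in> {i \<in> ?V. inner_normal ?P (fst i) = w}"
    then show "i \<in> {face \<phi> w} \<times> {..<node_mult \<phi> (lat w)}" using edge by (cases i) auto
  next
    fix i assume "i \<in> {face \<phi> w} \<times> {..<node_mult \<phi> (lat w)}"
    then obtain k where i: "i = (face \<phi> w, k)" "k < node_mult \<phi> (lat w)" by auto
    then have "1 \<le> node_mult \<phi> (lat w)" by simp
    note f = face_edge[OF fan w this]
    then show "i \<in> {i \<in> ?V. inner_normal ?P (fst i) = w}" using edge[OF f(1)] i by simp
  qed
  then have "occurrences ?V (\<lambda>i. inner_normal ?P (fst i)) w = node_mult \<phi> (lat w)" if "primitive w" for w
    using that by (simp add: occurrences_def card_cartesian_product)
  moreover have "primitive (inner_normal ?P (fst i))" if "i \<in> ?V" for i using edge that by auto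
  ultimately show ?thesis unfolding V realizes_def using finV by blast
qed

section \<open>Mutation of quivers given by families of normals\<close>

definition vector_quiver :: "'v set \<Rightarrow> ('v \<Rightarrow> int ^ 2) \<Rightarrow> 'v quiver" where
  "vector_quiver V x =
     \<lparr>qverts = V, arrows = \<lambda>i j. if i \<in> V \<and> j \<in> V then nat (wedge (x i) (x j)) else 0\<rparr>"

lemma fano_quiver_vector:
  "fano_quiver P = vector_quiver (qverts (fano_quiver P)) (\<lambda>i. inner_normal P (fst i))"
  by (simp add: fano_quiver_def vector_quiver_def Let_def)

text \<open>With \<open>p\<close>, \<open>q\<close> the wedge products of \<open>x v\<close> with
  \<open>x i\<close>, \<open>x j\<close>, both rules add
  \<open>max 0 (- p) * max 0 q - max 0 (- q) * max 0 p\<close> to \<open>wedge (x i) (x j)\<close>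
  for nodes other than \<open>v\<close>. Arrows vanish outside \<open>V\<close>, so the two sides
  are equal as records and not merely isomorphic.\<close>

lemma quiver_mutation_vector:
  assumes v: "v \<in> V"
  shows "quiver_mutation v (vector_quiver V x) = vector_quiver V (family_mutation v x)"
proof -
  let ?a = "\<lambda>i j. if i \<in> V \<and> j \<in> V then nat (wedge (x i) (x j)) else 0"
  have "reverse_at v (delete_two_cycles (add_composites v ?a)) i j =
      (if i \<in> V \<and> j \<in> V then nat (wedge (family_mutation v x i) (family_mutation v x j)) else 0)" for i j
  proof (cases "i \<in> V \<and> j \<in> V")
    case True
    have sw: "wedge (x j) (x i) = - wedge (x i) (x j)" "wedge (x i) (x v) = - wedge (x v) (x i)"
      "wedge (x j) (x v) = - wedge (x v) (x j)" by (simp_all add: wedge_def)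
    have truncate: "nat a - nat (- a) = nat a" "nat (- a) - nat a = nat (- a)" for a :: int by linarith+
    consider "i = v" | "j = v" "i \<noteq> v" | "i \<noteq> v" "j \<noteq> v" by blast
    then show ?thesis
    proof cases
      case 3
      let ?p = "wedge (x v) (x i)" and ?q = "wedge (x v) (x j)" and ?b = "wedge (x i) (x j)"
      have "wedge (family_mutation v x i) (family_mutation v x j) = ?b - max 0 ?q * ?p + max 0 ?p * ?q"
        using 3 by (simp add: family_mutation_other mutate_def sw)
      moreover have "nat ?b + nat (- ?p) * nat ?q - (nat (- ?b) + nat (- ?q) * nat ?p) =
          nat (?b - max 0 ?q * ?p + max 0 ?p * ?q)"
      proof -
        have nat_diff: "nat b + m - (nat (- b) + n) = nat (b + int m - int n)" for b :: int and m n
          by linarith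
        have "int (nat (- ?p) * nat ?q) = max 0 (- ?p) * max 0 ?q" "int (nat (- ?q) * nat ?p) = max 0 (- ?q) * max 0 ?p"
          by (simp_all add: max_def)
        moreover have "max 0 (- ?p) * max 0 ?q - max 0 (- ?q) * max 0 ?p = - max 0 ?q * ?p + max 0 ?p * ?q"
          by (simp add: max_def)
        ultimately have "?b + int (nat (- ?p) * nat ?q) - int (nat (- ?q) * nat ?p) =
            ?b - max 0 ?q * ?p + max 0 ?p * ?q"
          by linarith
        then show ?thesis unfolding nat_diff by (rule arg_cong)
      qed
      ultimately show ?thesis
        using 3 True v by (simp add: reverse_at_def delete_two_cycles_def add_composites_def sw)
    qed (use True v in \<open>auto simp: reverse_at_def delete_two_cycles_def add_composites_def sw
           family_mutation_def mutate_def truncate\<close>)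
  next
    case False
    then show ?thesis
      using v by (auto simp: reverse_at_def delete_two_cycles_def add_composites_def)
  qed
  then show ?thesis
    by (simp add: quiver_mutation_def vector_quiver_def fun_eq_iff)
qed

lemma quiver_step_vector:
  "quiver_step (vector_quiver V x) Q \<longleftrightarrow> (\<exists>y. family_step V x y \<and> Q = vector_quiver V y)"
proof -
  have "qverts (vector_quiver V x) = V" by (simp add: vector_quiver_def)
  then show ?thesis unfolding quiver_step_def family_step_def using quiver_mutation_vector by metis
qed

lemma quiver_steps_vector:
  "quiver_step\<^sup>*\<^sup>* (vector_quiver V x) Q \<longleftrightarrow> (\<exists>y. (family_step V)\<^sup>*\<^sup>* x y \<and> Q = vector_quiver V y)"
proof
  assume "quiver_step\<^sup>*\<^sup>* (vector_quiver V x) Q"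
  then show "\<exists>y. (family_step V)\<^sup>*\<^sup>* x y \<and> Q = vector_quiver V y"
  proof (induction rule: rtranclp_induct)
    case (step Q Q')
    then obtain y z where "(family_step V)\<^sup>*\<^sup>* x y" "family_step V y z" "Q' = vector_quiver V z"
      by (auto simp: quiver_step_vector)
    then have "(family_step V)\<^sup>*\<^sup>* x z \<and> Q' = vector_quiver V z" by simp
    then show ?case by (rule exI[of _ z])
  qed auto
next
  assume "\<exists>y. (family_step V)\<^sup>*\<^sup>* x y \<and> Q = vector_quiver V y"
  then obtain y where y: "(family_step V)\<^sup>*\<^sup>* x y" "Q = vector_quiver V y" by blast
  from y(1) have "quiver_step\<^sup>*\<^sup>* (vector_quiver V x) (vector_quiver V y)"
  proof (induction rule: rtranclp_induct)
    case (step y z)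
    then have "quiver_step (vector_quiver V y) (vector_quiver V z)" unfolding quiver_step_vector by blast
    with step.IH show ?case by simp
  qed simp
  then show "quiver_step\<^sup>*\<^sup>* (vector_quiver V x) Q" using y(2) by simp
qed

text \<open>In the given numbering \<open>A_2\<close>, \<open>A_3\<close> and \<open>D_4\<close> are
  the stars with centre \<open>1\<close> and one, two or three leaves, so that they can be treated
  together.\<close>

definition star_diagram :: "nat \<Rightarrow> diagram" where
  "star_diagram n = ({..<n}, {{1, j} | j. j < n \<and> j \<noteq> 1})"

lemma star_diagrams: "dynkin_A 2 = star_diagram 2" "dynkin_A 3 = star_diagram 3" "dynkin_D 4 = star_diagram 4"
proof -
  have "{i. Suc i < 2} = {0}" "{j. j < 2 \<and> j \<noteq> 1} = {0 :: nat}" by auto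
  then show "dynkin_A 2 = star_diagram 2"
    by (simp add: dynkin_A_def star_diagram_def setcompr_eq_image insert_commute)
  have 3: "{i. Suc i < 3} = {0, 1}" and "{j. j < 3 \<and> j \<noteq> 1} = {0, 2 :: nat}" by auto
  then show "dynkin_A 3 = star_diagram 3"
    by (simp add: dynkin_A_def star_diagram_def setcompr_eq_image insert_commute numeral_2_eq_2)
  have "{j. j < 4 \<and> j \<noteq> 1} = {0, 2, 3 :: nat}" by auto
  then show "dynkin_D 4 = star_diagram 4"
    using 3 by (simp add: dynkin_D_def star_diagram_def setcompr_eq_image insert_commute numeral_2_eq_2)
qed

lemma edge_star_diagram: "{i, j} \<in> snd (star_diagram n) \<longleftrightarrow> i < n \<and> j < n \<and> 1 < n \<and> (i = 1) \<noteq> (j = 1)" if "n \<ge> 2"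
  using that by (auto simp: star_diagram_def doubleton_eq_iff)

lemma nat_plus_nat: "nat a + nat (- a) = nat \<bar>a\<bar>"
  by simp

lemma quiver_isomorphic_vector:
  assumes "bij_betw f V W"
  shows "quiver_isomorphic (vector_quiver V x) (vector_quiver W (x \<circ> inv_into V f))"
  unfolding quiver_isomorphic_def using assms
  by (intro exI[of _ f]) (auto simp: vector_quiver_def bij_betw_def)

lemma parallel_quiver:
  assumes "finite V" "\<forall>i\<in>V. \<forall>j\<in>V. wedge (x i) (x j) = 0"
  obtains Q :: "nat quiver" where "quiver_isomorphic (vector_quiver V x) Q" "quiver_of_type Q (dynkin_A1_power (card V))"
proof -
  obtain f where f: "bij_betw f V {..<card V}"
    using ex_bij_betw_finite_nat[OF assms(1)] by (auto simp: atLeast0LessThan)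
  let ?Q = "vector_quiver {..<card V} (x \<circ> inv_into V f)"
  have "inv_into V f i \<in> V" if "i < card V" for i
    using f that by (metis bij_betw_imp_surj_on inv_into_into lessThan_iff)
  then have "quiver_of_type ?Q (dynkin_A1_power (card V))"
    using assms(2) by (simp add: quiver_of_type_def dynkin_A1_power_def vector_quiver_def)
  then show thesis using quiver_isomorphic_vector[OF f] that by blast
qed

lemma star_quiver:
  assumes "finite V" "star V x c"
  obtains Q :: "nat quiver" where "quiver_isomorphic (vector_quiver V x) Q" "quiver_of_type Q (star_diagram (card V))"
proof -
  have c: "c \<in> V" and n: "card V \<in> {2, 3, 4}" using assms(2) by (auto simp: star_def)
  then have n2: "card V \<ge> 2" by auto
  obtain f where f: "bij_betw f (V - {c}) ({..<card V} - {1})"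
    using finite_same_card_bij[of "V - {c}" "{..<card V} - {1}"] assms(1) c n by auto
  define g where "g i = (if i = c then 1 else f i)" for i
  have "bij_betw g (insert c (V - {c})) (insert 1 ({..<card V} - {1}))"
  proof -
    have "bij_betw g (V - {c}) ({..<card V} - {1})"
      using f by (rule bij_betw_cong[THEN iffD1, rotated]) (simp add: g_def)
    moreover have "g c = 1" by (simp add: g_def)
    ultimately show ?thesis using notIn_Un_bij_betw[of c "V - {c}" g "{..<card V} - {1}"] by simp
  qed
  moreover have "insert c (V - {c}) = V" "insert 1 ({..<card V} - {1}) = {..<card V}" using c n by auto
  ultimately have g: "bij_betw g V {..<card V}" by simp
  let ?h = "inv_into V g"
  let ?Q = "vector_quiver {..<card V} (x \<circ> ?h)"
  have h: "?h i \<in> V" "g (?h i) = i" if "i < card V" for i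
    using g that by (metis bij_betw_imp_surj_on inv_into_into lessThan_iff, metis bij_betw_inv_into_right lessThan_iff)
  have hc: "?h i = c \<longleftrightarrow> i = 1" if "i < card V" for i
  proof
    assume "?h i = c"
    then show "i = 1" using h(2)[OF that] by (simp add: g_def)
  next
    assume "i = 1"
    moreover have "?h (g c) = c" using bij_betw_inv_into_left[OF g c] .
    ultimately show "?h i = c" by (simp add: g_def)
  qed
  have "arrows ?Q i j + arrows ?Q j i = (if {i, j} \<in> snd (star_diagram (card V)) then 1 else 0)" for i j
  proof (cases "i < card V \<and> j < card V")
    case False
    then show ?thesis by (simp only: edge_star_diagram[OF n2]) (auto simp: vector_quiver_def)
  next
    case True
    have "arrows ?Q i j + arrows ?Q j i = nat \<bar>wedge (x (?h i)) (x (?h j))\<bar>"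
      using True nat_plus_nat[of "wedge (x (?h i)) (x (?h j))"] wedge_swap[of "x (?h j)"]
      by (simp add: vector_quiver_def)
    also have "\<dots> = (if (i = 1) \<noteq> (j = 1) then 1 else 0)"
    proof -
      have hi: "?h i \<in> V" "?h j \<in> V" "?h i = c \<longleftrightarrow> i = 1" "?h j = c \<longleftrightarrow> j = 1" using h hc True by auto
      then show ?thesis
        using assms(2) wedge_swap[of "x (?h i)" "x c"] unfolding star_def
        by (cases "i = 1"; cases "j = 1") auto
    qed
    also have "\<dots> = (if {i, j} \<in> snd (star_diagram (card V)) then 1 else 0)"
      by (simp only: edge_star_diagram[OF n2]) (use True n2 in auto)
    finally show ?thesis .
  qed
  then have "quiver_of_type ?Q (star_diagram (card V))"
    by (simp add: quiver_of_type_def star_diagram_def vector_quiver_def)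
  then show thesis using quiver_isomorphic_vector[OF g] that by blast
qed

lemma isomorphic_arrows:
  assumes "quiver_isomorphic (vector_quiver V x) Q"
  obtains f where "bij_betw f V (qverts Q)"
    "\<And>i j. i \<in> V \<Longrightarrow> j \<in> V \<Longrightarrow> arrows Q (f i) (f j) + arrows Q (f j) (f i) = nat \<bar>wedge (x i) (x j)\<bar>"
proof -
  obtain f where f: "bij_betw f V (qverts Q)"
      "\<And>i j. i \<in> V \<Longrightarrow> j \<in> V \<Longrightarrow> arrows Q (f i) (f j) = nat (wedge (x i) (x j))"
    using assms by (auto simp: quiver_isomorphic_def vector_quiver_def)
  have "arrows Q (f i) (f j) + arrows Q (f j) (f i) = nat \<bar>wedge (x i) (x j)\<bar>" if "i \<in> V" "j \<in> V" for i j
    using f(2)[OF that] f(2)[OF that(2,1)] nat_plus_nat[of "wedge (x i) (x j)"] wedge_swap[of "x j"] by simp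
  with f(1) show thesis by (rule that)
qed

lemma type_A1_power_parallel:
  assumes "quiver_isomorphic (vector_quiver V x) Q" "quiver_of_type Q (dynkin_A1_power n)" "i \<in> V" "j \<in> V"
  shows "wedge (x i) (x j) = 0"
proof -
  obtain f where f: "\<And>i j. i \<in> V \<Longrightarrow> j \<in> V \<Longrightarrow> arrows Q (f i) (f j) + arrows Q (f j) (f i) = nat \<bar>wedge (x i) (x j)\<bar>"
    using isomorphic_arrows[OF assms(1)] by metis
  have "arrows Q (f i) (f j) + arrows Q (f j) (f i) = 0"
    using assms(2) by (simp add: quiver_of_type_def dynkin_A1_power_def)
  then show ?thesis using f[OF assms(3,4)] by simp
qed

lemma type_star_diagram_star:
  assumes "quiver_isomorphic (vector_quiver V x) Q" "quiver_of_type Q (star_diagram n)" "n \<in> {2, 3, 4}"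
  obtains c where "star V x c"
proof -
  obtain f where f: "bij_betw f V (qverts Q)"
    "\<And>i j. i \<in> V \<Longrightarrow> j \<in> V \<Longrightarrow> arrows Q (f i) (f j) + arrows Q (f j) (f i) = nat \<bar>wedge (x i) (x j)\<bar>"
    using isomorphic_arrows[OF assms(1)] by metis
  have Q: "qverts Q = {..<n}"
    "\<And>i j. arrows Q i j + arrows Q j i = (if {i, j} \<in> snd (star_diagram n) then 1 else 0)"
    using assms(2) by (auto simp: quiver_of_type_def star_diagram_def)
  have bij: "bij_betw f V {..<n}" using f(1) Q(1) by simp
  have card: "card V = n" using bij_betw_same_card[OF bij] by simp
  have "1 \<in> f ` V" using bij assms(3) by (auto simp: bij_betw_def)
  then obtain c where c: "c \<in> V" "f c = 1" by auto
  have inj: "f i = 1 \<longleftrightarrow> i = c" if "i \<in> V" for i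
    using bij that c by (metis bij_betw_def inj_on_def)
  have lt: "f i < n" if "i \<in> V" for i using bij that by (auto simp: bij_betw_def)
  have w: "nat \<bar>wedge (x i) (x j)\<bar> = (if (i = c) \<noteq> (j = c) then 1 else 0)" if "i \<in> V" "j \<in> V" for i j
    using f(2)[OF that] Q(2)[of "f i" "f j"] edge_star_diagram[of n "f i" "f j"] lt that inj assms(3) by auto
  have "star V x c"
    unfolding star_def
  proof (intro conjI ballI)
    show "c \<in> V" by (rule c(1))
    show "card V \<in> {2, 3, 4}" using card assms(3) by simp
    show "\<bar>wedge (x c) (x i)\<bar> = 1" if "i \<in> V - {c}" for i using w[OF c(1), of i] that by simp
    show "wedge (x i) (x j) = 0" if "i \<in> V - {c}" "j \<in> V - {c}" for i j using w[of i j] that by simp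
  qed
  then show thesis by (rule that)
qed

lemma parallel_fin_type:
  assumes fan: "fan \<phi>" and real: "realizes \<phi> V x" and par: "\<forall>i\<in>V. \<forall>j\<in>V. wedge (x i) (x j) = 0"
  shows "fin_type \<phi>"
proof -
  have V: "finite V" "\<And>i. i \<in> V \<Longrightarrow> primitive (x i)" "\<And>w. primitive w \<Longrightarrow> occurrences V x w = node_mult \<phi> (lat w)"
    using real by (auto simp: realizes_def)
  have node: "\<exists>i\<in>V. x i = u" if "primitive u" "1 \<le> node_mult \<phi> (lat u)" for u
  proof (rule ccontr)
    assume "\<not> ?thesis"
    then have "{i \<in> V. x i = u} = {}" by blast
    then have "occurrences V x u = 0" by (simp only: occurrences_def card.empty)
    then show False using V(3)[OF that(1)] that(2) by simp
  qed
  show ?thesis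
  proof (cases "V = {}")
    case True
    \<comment> \<open>Without nodes no direction is distinguished, and any primitive vector can play
      the part of \<open>w\<close>.\<close>
    then show ?thesis using fin_type_parallel[OF fan, of "ivec 1 0"] node by (auto simp: primitive_def)
  next
    case False
    then obtain i where i: "i \<in> V" by blast
    show ?thesis
    proof (rule fin_type_parallel[OF fan V(2)[OF i]])
      fix u assume u: "primitive u" "1 \<le> node_mult \<phi> (lat u)"
      then obtain j where "j \<in> V" "x j = u" using node by blast
      then show "u = x i \<or> u = - x i" using primitive_parallel[OF V(2)[OF i] u(1)] par i by blast
    qed
  qed
qed

lemma star_fin_type:
  assumes fan: "fan \<phi>" and real: "realizes \<phi> V x" and star: "star V x c"
  shows "fin_type \<phi>"
proof -
  have V: "finite V" "\<And>i. i \<in> V \<Longrightarrow> primitive (x i)" "\<And>w. primitive w \<Longrightarrow> occurrences V x w = node_mult \<phi> (lat w)"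
    using real by (auto simp: realizes_def)
  have c: "c \<in> V" and n: "card V \<in> {2, 3, 4}" and st: "\<And>i. i \<in> V - {c} \<Longrightarrow> \<bar>wedge (x c) (x i)\<bar> = 1"
    "\<And>i j. i \<in> V - {c} \<Longrightarrow> j \<in> V - {c} \<Longrightarrow> wedge (x i) (x j) = 0"
    using star by (auto simp: star_def)
  have cV: "card (V - {c}) = card V - 1" using c V(1) by simp
  then have "card (V - {c}) \<noteq> 0" using n by auto
  then obtain j where j: "j \<in> V - {c}" by (metis card.empty equals0I)
  let ?l = "x j"
  let ?p = "card {i \<in> V - {c}. x i = ?l}" and ?q = "card {i \<in> V - {c}. x i = - ?l}"
  have l: "primitive ?l" using V(2) j by blast
  have ne: "?l \<noteq> - ?l" using primitive_nonzero[OF l] by (auto simp: vec2_eq)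
  have leaf: "x i = ?l \<or> x i = - ?l" if "i \<in> V - {c}" for i
    using primitive_parallel[OF l V(2), of i] st(2)[OF j that] that by blast
  have "?p + ?q = card ({i \<in> V - {c}. x i = ?l} \<union> {i \<in> V - {c}. x i = - ?l})"
    using V(1) ne by (intro card_Un_disjoint[symmetric]) auto
  also have "\<dots> \<le> card (V - {c})" using V(1) by (intro card_mono) auto
  finally have pq: "?p + ?q \<le> 3" using cV n by auto
  have "node_mult \<phi> (lat u) \<le> count (add_mset (x c) (replicate_mset ?p ?l + replicate_mset ?q (- ?l))) u"
    if u: "primitive u" for u
  proof -
    have xc: "x c \<noteq> ?l" "x c \<noteq> - ?l" using st(1)[OF j] by auto
    have split: "{i \<in> V. x i = u} = (if x c = u then {c} else {}) \<union> {i \<in> V - {c}. x i = u}"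
      using c by auto
    consider "u = x c" | "u = ?l" | "u = - ?l" | "u \<noteq> x c" "u \<noteq> ?l" "u \<noteq> - ?l" by blast
    then have "occurrences V x u \<le> count (add_mset (x c) (replicate_mset ?p ?l + replicate_mset ?q (- ?l))) u"
    proof cases
      case 1
      then have none: "{i \<in> V - {c}. x i = u} = {}" using leaf xc by force
      show ?thesis unfolding occurrences_def split none using 1 by simp
    next
      case 2
      then show ?thesis unfolding occurrences_def split using xc ne by simp
    next
      case 3
      then show ?thesis unfolding occurrences_def split using xc ne by simp
    next
      case 4
      then have "{i \<in> V. x i = u} = {}" using leaf by blast
      then show ?thesis by (simp only: occurrences_def card.empty)
    qed
    then show ?thesis using V(3)[OF u] by simp
  qed
  then have "bounded_by \<phi> (add_mset (x c) (replicate_mset ?p ?l + replicate_mset ?q (- ?l)))"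
    unfolding bounded_by_def by blast
  then show ?thesis using fin_type_star[OF fan st(1)[OF j] pq] by blast
qed

theorem theorem4p1:
  fixes P :: "(real ^ 2) set"
  assumes "fano_polygon P"
  shows "finite_mutation_type P \<longleftrightarrow>
    (\<exists>Q :: nat quiver. quiver_mutation_equivalent (fano_quiver P) Q \<and>
       ((\<exists>n. quiver_of_type Q (dynkin_A1_power n)) \<or>
        quiver_of_type Q (dynkin_A 2) \<or>
        quiver_of_type Q (dynkin_A 3) \<or>
        quiver_of_type Q (dynkin_D 4)))"
proof -
  obtain \<phi> where \<phi>: "fan \<phi>" "P = body \<phi>" using fano_polygon_fan assms by blast
  let ?V = "qverts (fano_quiver P)" and ?x = "\<lambda>i. inner_normal P (fst i)"
  have real: "realizes \<phi> ?V ?x" unfolding \<phi>(2) by (rule realizes_fano_quiver[OF \<phi>(1)])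
  then have finV: "finite ?V" by (simp add: realizes_def)
  have fin: "finite_mutation_type P \<longleftrightarrow> fin_type \<phi>" unfolding \<phi>(2) by (rule finite_mutation_type_iff[OF \<phi>(1)])
  \<comment> \<open>Every quiver reachable from that of \<open>P\<close> is the vector quiver of a
    reachable family on the same index set; an isomorphism occurs only at the end.\<close>
  have equiv: "quiver_mutation_equivalent (fano_quiver P) Q \<longleftrightarrow>
      (\<exists>y. (family_step ?V)\<^sup>*\<^sup>* ?x y \<and> quiver_isomorphic (vector_quiver ?V y) Q)" for Q :: "nat quiver"
    unfolding quiver_mutation_equivalent_def
    by (subst fano_quiver_vector, unfold quiver_steps_vector) blast
  show ?thesis
    unfolding fin equiv star_diagrams
  proof
    assume ft: "fin_type \<phi>"
    have small: "small ?V y" if y: "(family_step ?V)\<^sup>*\<^sup>* ?x y" for y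
    proof -
      obtain \<psi> where "fstep\<^sup>*\<^sup>* \<phi> \<psi>" "fan \<psi>" "realizes \<psi> ?V y" using realizes_steps[OF y \<phi>(1) real] by blast
      then show ?thesis using fin_type_small fin_type_reachable[OF \<phi>(1) ft] by blast
    qed
    obtain y where y: "(family_step ?V)\<^sup>*\<^sup>* ?x y"
      "(\<forall>i\<in>?V. \<forall>j\<in>?V. wedge (y i) (y j) = 0) \<or> (\<exists>c. star ?V y c)"
      using reachable_parallel_or_star[OF finV small] by blast
    from y(2) show "\<exists>Q :: nat quiver. (\<exists>y. (family_step ?V)\<^sup>*\<^sup>* ?x y \<and> quiver_isomorphic (vector_quiver ?V y) Q) \<and>
       ((\<exists>n. quiver_of_type Q (dynkin_A1_power n)) \<or> quiver_of_type Q (star_diagram 2) \<or>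
        quiver_of_type Q (star_diagram 3) \<or> quiver_of_type Q (star_diagram 4))"
    proof
      assume "\<forall>i\<in>?V. \<forall>j\<in>?V. wedge (y i) (y j) = 0"
      then show ?thesis using parallel_quiver[OF finV] y(1) by metis
    next
      assume "\<exists>c. star ?V y c"
      then obtain c where c: "star ?V y c" by blast
      then have "card ?V \<in> {2, 3, 4}" by (simp add: star_def)
      moreover obtain Q :: "nat quiver" where "quiver_isomorphic (vector_quiver ?V y) Q" "quiver_of_type Q (star_diagram (card ?V))"
        using star_quiver[OF finV c] by blast
      ultimately show ?thesis using y(1) by auto
    qed
  next
    assume "\<exists>Q :: nat quiver. (\<exists>y. (family_step ?V)\<^sup>*\<^sup>* ?x y \<and> quiver_isomorphic (vector_quiver ?V y) Q) \<and>
       ((\<exists>n. quiver_of_type Q (dynkin_A1_power n)) \<or> quiver_of_type Q (star_diagram 2) \<or>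
        quiver_of_type Q (star_diagram 3) \<or> quiver_of_type Q (star_diagram 4))"
    then obtain Q :: "nat quiver" and y where y: "(family_step ?V)\<^sup>*\<^sup>* ?x y"
      and iso: "quiver_isomorphic (vector_quiver ?V y) Q"
      and type: "(\<exists>n. quiver_of_type Q (dynkin_A1_power n)) \<or> (\<exists>n\<in>{2, 3, 4}. quiver_of_type Q (star_diagram n))"
      by auto
    obtain \<psi> where \<psi>: "fstep\<^sup>*\<^sup>* \<phi> \<psi>" "fan \<psi>" "realizes \<psi> ?V y" using realizes_steps[OF y \<phi>(1) real] by blast
    from type have "fin_type \<psi>"
    proof
      assume "\<exists>n. quiver_of_type Q (dynkin_A1_power n)"
      then show ?thesis using type_A1_power_parallel[OF iso] parallel_fin_type[OF \<psi>(2,3)] by blast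
    next
      assume "\<exists>n\<in>{2, 3, 4}. quiver_of_type Q (star_diagram n)"
      then show ?thesis using type_star_diagram_star[OF iso] star_fin_type[OF \<psi>(2,3)] by blast
    qed
    then show "fin_type \<phi>" using fin_type_fsteps \<psi>(1) \<phi>(1) by blast
  qed
qed

end
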